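(* Let $G$ be a finite group with unit element $e$, and let $\mathcal{A}=\{A_t\}_{t\in G}$ and $\mathcal{B}=\{B_t\}_{t\in G}$ be $C^*$-algebraic bundles over $G$. Let $C=\oplus_{t\in G}A_t$, $D=\oplus_{t\in G}B_t$, $A=A_e$ and $B=B_e$. Suppose that $C$ and $D$ are unital and that $A$ and $B$ contain the unit elements of $C$ and $D$, respectively. Suppose that there is an $\mathcal{A}-\mathcal{B}$-equivalence bundle $\mathcal{X}=\{X_t\}_{t\in G}$ over $G$ such that $${}_{C}\langle X_t, X_s\rangle=A_{ts^{-1}},\qquad \langle X_t, X_s\rangle_{D}=B_{t^{-1}s}$$ for all $t,s\in G$. Then the unital inclusions of unital $C^*$-algebras $A\subset C$ and $B\subset D$ are strongly Morita equivalent.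
   Context: **$C^*$-algebraic bundles.** A $C^*$-algebraic bundle (Fell bundle) over a finite group $G$ is a family $\mathcal{A}=\{A_t\}_{t\in G}$ of complex Banach spaces with bilinear associative products $A_t\times A_s\to A_{ts}$ and conjugate linear involutions $a\in A_t\mapsto a^*\in A_{t^{-1}}$ satisfying $(ab)^*=b^*a^*$, $a^{**}=a$, $\|ab\|\le\|a\|\|b\|$, $\|a^*a\|=\|a\|^2$, and $a^*a\ge 0$ in the $C^*$-algebra $A_e$. Then $C=\oplus_{t\in G}A_t$ is a $*$-algebra which, $G$ being finite, is a $C^*$-algebra for the unique $C^*$-norm, extending the norms of the $A_t$. The inclusion $A=A_e\subset C$ is called the inclusion induced by $\mathcal{A}$. **Equivalence bundles (Abadie–Ferraro).** Let $\mathcal A,\mathcal B$ be $C^*$-algebraic bundles over $G$, $C=\oplus_t A_t$, $D=\oplus_t B_t$. An $\mathcal{A}-\mathcal{B}$-equivalence bundle is a family $\mathcal{X}=\{X_t\}_{t\in G}$ of complex Banach spaces with bilinear maps $A_t\times X_s\to X_{ts}$, $(a,x)\mapsto a\cdot x$, and $X_s\times B_t\to X_{st}$, $(x,b)\mapsto x\cdot b$, and with maps ${}_C\langle\cdot,\cdot\rangle: X_t\times X_s\to A_{ts^{-1}}$ (linear in the first variable) and $\langle\cdot,\cdot\rangle_D:X_t\times X_s\to B_{t^{-1}s}$ (linear in the second variable) such that: ${}_C\langle a\cdot x,y\rangle=a\,{}_C\langle x,y\rangle$ and ${}_C\langle x,y\rangle^*={}_C\langle y,x\rangle$; $\langle x,y\cdot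 b\rangle_D=\langle x,y\rangle_D b$ and $\langle x,y\rangle_D^*=\langle y,x\rangle_D$; ${}_C\langle x,x\rangle\ge0$ in $A_e$ and $\langle x,x\rangle_D\ge 0$ in $B_e$, each vanishing only for $x=0$; the norm of $X_t$ is $\|x\|=\|{}_C\langle x,x\rangle\|^{1/2}=\|\langle x,x\rangle_D\|^{1/2}$; the linear spans of $\bigcup_t {}_C\langle X_t,X_t\rangle$ and $\bigcup_t\langle X_t,X_t\rangle_D$ are dense in $A_e$ and $B_e$, respectively; and ${}_C\langle x,y\rangle\cdot z=x\cdot\langle y,z\rangle_D$ for all $x,y,z$ in the fibres. Here and in the claim, ${}_C\langle X_t,X_s\rangle$ and $\langle X_t,X_s\rangle_D$ denote the linear spans of the sets $\{{}_C\langle x,y\rangle: x\in X_t,y\in X_s\}$ and $\{\langle x,y\rangle_D: x\in X_t,y\in X_s\}$. **Strong Morita equivalence of inclusions.** A $C-D$-equivalence bimodule is an imprimitivity bimodule (full for both inner products). Unital inclusions of unital $C^*$-algebras $A\subset C$ and $B\subset D$ are strongly Morita equivalent if there are a $C-D$-equivalence bimodule $Y$ and a closed subspace $X\subset Y$ such that: $a\cdot x\in X$, $x\cdot b\in X$, ${}_C\langle x,y\rangle\in A$, $\langle x,y\rangle_D\in B$ for all $a\in A$, $b\in B$, $x,y\in X$; with these operations $X$ is an $A-B$-equivalence bimodule (in particular ${}_C\langle X,X\rangle=A$, $\langle X,X\rangle_D=B$); and ${}_C\langle Y,X\rangle=C$, $\langle Y,X\rangle_D=D$ (linear spans). *)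

theory Defs
  imports
    "HOL-Analysis.Abstract_Metric_Spaces"
    "HOL-Library.Function_Algebras"
    "HOL-Algebra.Group"
begin

section \<open>Complex Banach spaces inside an ambient vector space\<close>

text \<open>
  A complex vector space is given as a linear subspace \<open>carrier V\<close> of an ambient type that is a
  complex vector space for the scalar multiplication \<open>scl V\<close>.  Any family of vector spaces can be
  realised in this way, as subspaces of their product.
\<close>

record 'v cspace = "'v partial_object" +
  scl :: "complex \<Rightarrow> 'v \<Rightarrow> 'v"

record 'v cnormed = "'v cspace" +
  nrm :: "'v \<Rightarrow> real"

locale complex_space =
  fixes V :: "('v::ab_group_add, 'm) cspace_scheme"
  assumes vector_space: "vector_space (scl V)"
    and subspace: "module.subspace (scl V) (carrier V)"

definition semilinear_map ::
  "(complex \<Rightarrow> complex) \<Rightarrow> ('v::ab_group_add, 'm) cspace_scheme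
    \<Rightarrow> ('w::ab_group_add, 'n) cspace_scheme \<Rightarrow> ('v \<Rightarrow> 'w) \<Rightarrow> bool"
  where "semilinear_map \<sigma> V W f \<longleftrightarrow>
    (\<forall>x\<in>carrier V. f x \<in> carrier W) \<and>
    (\<forall>x\<in>carrier V. \<forall>y\<in>carrier V. f (x + y) = f x + f y) \<and>
    (\<forall>c. \<forall>x\<in>carrier V. f (scl V c x) = scl W (\<sigma> c) (f x))"

abbreviation "linear_map \<equiv> semilinear_map (\<lambda>c. c)"
abbreviation "conj_linear_map \<equiv> semilinear_map cnj"

definition bilinear_map ::
  "('u::ab_group_add, 'l) cspace_scheme \<Rightarrow> ('v::ab_group_add, 'm) cspace_scheme
    \<Rightarrow> ('w::ab_group_add, 'n) cspace_scheme \<Rightarrow> ('u \<Rightarrow> 'v \<Rightarrow> 'w) \<Rightarrow> bool"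
  where "bilinear_map U V W f \<longleftrightarrow>
    (\<forall>v\<in>carrier V. linear_map U W (\<lambda>u. f u v)) \<and>
    (\<forall>u\<in>carrier U. linear_map V W (\<lambda>v. f u v))"

text \<open>
  The distance is cut to 0 off \<open>V\<close> because \<^locale>\<open>Metric_space\<close> asks for nonnegativity and
  symmetry everywhere; the notions below only depend on its values on \<open>V\<close>.
\<close>

definition norm_dist :: "'v::ab_group_add set \<Rightarrow> ('v \<Rightarrow> real) \<Rightarrow> 'v \<Rightarrow> 'v \<Rightarrow> real"
  where "norm_dist V n x y = (if x \<in> V \<and> y \<in> V then n (x - y) else 0)"

definition complete_wrt :: "'v::ab_group_add set \<Rightarrow> ('v \<Rightarrow> real) \<Rightarrow> bool"
  where "complete_wrt V n \<longleftrightarrow> Metric_space.mcomplete V (norm_dist V n)"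

definition closed_wrt :: "'v::ab_group_add set \<Rightarrow> ('v \<Rightarrow> real) \<Rightarrow> 'v set \<Rightarrow> bool"
  where "closed_wrt V n S \<longleftrightarrow> closedin (Metric_space.mtopology V (norm_dist V n)) S"

definition dense_wrt :: "'v::ab_group_add set \<Rightarrow> ('v \<Rightarrow> real) \<Rightarrow> 'v set \<Rightarrow> bool"
  where "dense_wrt V n S \<longleftrightarrow> Metric_space.mtopology V (norm_dist V n) closure_of S = V"

locale complex_banach = complex_space V
  for V :: "('v::ab_group_add, 'm) cnormed_scheme" +
  assumes norm_nonneg: "x \<in> carrier V \<Longrightarrow> 0 \<le> nrm V x"
    and norm_eq_0: "x \<in> carrier V \<Longrightarrow> nrm V x = 0 \<longleftrightarrow> x = 0"
    and norm_scl: "x \<in> carrier V \<Longrightarrow> nrm V (scl V c x) = cmod c * nrm V x"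
    and norm_triangle:
      "x \<in> carrier V \<Longrightarrow> y \<in> carrier V \<Longrightarrow> nrm V (x + y) \<le> nrm V x + nrm V y"
    and complete: "complete_wrt (carrier V) (nrm V)"


section \<open>C*-algebras\<close>

record 'a cstar = "'a cnormed" +
  mul :: "'a \<Rightarrow> 'a \<Rightarrow> 'a"
  star :: "'a \<Rightarrow> 'a"

locale cstar_algebra = complex_banach A
  for A :: "('a::ab_group_add, 'm) cstar_scheme" +
  assumes mul_bilinear: "bilinear_map A A A (mul A)"
    and mul_assoc: "a \<in> carrier A \<Longrightarrow> b \<in> carrier A \<Longrightarrow> c \<in> carrier A
      \<Longrightarrow> mul A (mul A a b) c = mul A a (mul A b c)"
    and star_conj_linear: "conj_linear_map A A (star A)"
    and star_mul: "a \<in> carrier A \<Longrightarrow> b \<in> carrier A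
      \<Longrightarrow> star A (mul A a b) = mul A (star A b) (star A a)"
    and star_star: "a \<in> carrier A \<Longrightarrow> star A (star A a) = a"
    and norm_mul: "a \<in> carrier A \<Longrightarrow> b \<in> carrier A
      \<Longrightarrow> nrm A (mul A a b) \<le> nrm A a * nrm A b"
    and cstar_identity: "a \<in> carrier A \<Longrightarrow> nrm A (mul A (star A a) a) = (nrm A a)\<^sup>2"

definition positive_in :: "('a, 'm) cstar_scheme \<Rightarrow> 'a \<Rightarrow> bool"
  where "positive_in A a \<longleftrightarrow> (\<exists>b\<in>carrier A. a = mul A (star A b) b)"

definition is_unit_of :: "('a, 'm) cstar_scheme \<Rightarrow> 'a \<Rightarrow> bool"
  where "is_unit_of A u \<longleftrightarrow>
    u \<in> carrier A \<and> (\<forall>a\<in>carrier A. mul A u a = a \<and> mul A a u = a)"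

definition unital_inclusion :: "'a::ab_group_add set \<Rightarrow> ('a, 'm) cstar_scheme \<Rightarrow> bool"
  where "unital_inclusion A C \<longleftrightarrow>
    cstar_algebra C \<and> A \<subseteq> carrier C \<and> cstar_algebra (C\<lparr>carrier := A\<rparr>) \<and>
    (\<exists>u\<in>A. is_unit_of C u)"


section \<open>C*-algebraic bundles\<close>

record ('g, 'v) banach_family =
  fset :: "'g \<Rightarrow> 'v set"
  fscl :: "complex \<Rightarrow> 'v \<Rightarrow> 'v"
  fnrm :: "'g \<Rightarrow> 'v \<Rightarrow> real"

definition fibre :: "('g, 'v, 'm) banach_family_scheme \<Rightarrow> 'g \<Rightarrow> 'v cnormed"
  where "fibre F t = \<lparr>carrier = fset F t, scl = fscl F, nrm = fnrm F t\<rparr>"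

text \<open>
  Fibres over different group elements may overlap in the ambient type, so the operations carry
  the degrees of their arguments: \<open>bmul \<A> t s\<close> is the product of the fibres over \<open>t\<close> and \<open>s\<close>,
  and \<open>bstar \<A> t\<close> is the involution on the fibre over \<open>t\<close>.
\<close>

record ('g, 'a) fell_bundle = "('g, 'a) banach_family" +
  bmul :: "'g \<Rightarrow> 'g \<Rightarrow> 'a \<Rightarrow> 'a \<Rightarrow> 'a"
  bstar :: "'g \<Rightarrow> 'a \<Rightarrow> 'a"

definition unit_fibre :: "('g, 'k) monoid_scheme \<Rightarrow> ('g, 'a, 'm) fell_bundle_scheme \<Rightarrow> 'a cstar"
  where "unit_fibre G \<A> =
    \<lparr>carrier = fset \<A> \<one>\<^bsub>G\<^esub>, scl = fscl \<A>, nrm = fnrm \<A> \<one>\<^bsub>G\<^esub>,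
      mul = bmul \<A> \<one>\<^bsub>G\<^esub> \<one>\<^bsub>G\<^esub>, star = bstar \<A> \<one>\<^bsub>G\<^esub>\<rparr>"

locale cstar_bundle = group G
  for G :: "('g, 'k) monoid_scheme" (structure) +
  fixes \<A> :: "('g, 'a::ab_group_add, 'm) fell_bundle_scheme"
  assumes fibre_banach: "t \<in> carrier G \<Longrightarrow> complex_banach (fibre \<A> t)"
    and bmul_bilinear: "t \<in> carrier G \<Longrightarrow> s \<in> carrier G
      \<Longrightarrow> bilinear_map (fibre \<A> t) (fibre \<A> s) (fibre \<A> (t \<otimes> s)) (bmul \<A> t s)"
    and bmul_assoc: "t \<in> carrier G \<Longrightarrow> s \<in> carrier G \<Longrightarrow> r \<in> carrier G
      \<Longrightarrow> a \<in> fset \<A> t \<Longrightarrow> b \<in> fset \<A> s \<Longrightarrow> c \<in> fset \<A> r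
      \<Longrightarrow> bmul \<A> (t \<otimes> s) r (bmul \<A> t s a b) c = bmul \<A> t (s \<otimes> r) a (bmul \<A> s r b c)"
    and bstar_conj_linear: "t \<in> carrier G
      \<Longrightarrow> conj_linear_map (fibre \<A> t) (fibre \<A> (inv t)) (bstar \<A> t)"
    and bstar_bmul: "t \<in> carrier G \<Longrightarrow> s \<in> carrier G \<Longrightarrow> a \<in> fset \<A> t \<Longrightarrow> b \<in> fset \<A> s
      \<Longrightarrow> bstar \<A> (t \<otimes> s) (bmul \<A> t s a b) = bmul \<A> (inv s) (inv t) (bstar \<A> s b) (bstar \<A> t a)"
    and bstar_bstar: "t \<in> carrier G \<Longrightarrow> a \<in> fset \<A> t \<Longrightarrow> bstar \<A> (inv t) (bstar \<A> t a) = a"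
    and norm_bmul: "t \<in> carrier G \<Longrightarrow> s \<in> carrier G \<Longrightarrow> a \<in> fset \<A> t \<Longrightarrow> b \<in> fset \<A> s
      \<Longrightarrow> fnrm \<A> (t \<otimes> s) (bmul \<A> t s a b) \<le> fnrm \<A> t a * fnrm \<A> s b"
    and norm_bstar_bmul: "t \<in> carrier G \<Longrightarrow> a \<in> fset \<A> t
      \<Longrightarrow> fnrm \<A> \<one> (bmul \<A> (inv t) t (bstar \<A> t a) a) = (fnrm \<A> t a)\<^sup>2"
    and bstar_bmul_positive: "t \<in> carrier G \<Longrightarrow> a \<in> fset \<A> t
      \<Longrightarrow> positive_in (unit_fibre G \<A>) (bmul \<A> (inv t) t (bstar \<A> t a) a)"

text \<open>
  The direct sum of the fibres of a bundle over a finite group: the sections, extended by 0 off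
  the group, with the convolution product, for a given norm.
\<close>

definition sections :: "('g, 'k) monoid_scheme \<Rightarrow> ('g, 'v::zero, 'm) banach_family_scheme
    \<Rightarrow> ('g \<Rightarrow> 'v) set"
  where "sections G F =
    {f. (\<forall>t\<in>carrier G. f t \<in> fset F t) \<and> (\<forall>t. t \<notin> carrier G \<longrightarrow> f t = 0)}"

definition section_star_algebra ::
  "('g, 'k) monoid_scheme \<Rightarrow> ('g, 'a::ab_group_add, 'm) fell_bundle_scheme
    \<Rightarrow> (('g \<Rightarrow> 'a) \<Rightarrow> real) \<Rightarrow> ('g \<Rightarrow> 'a) cstar"
  where "section_star_algebra G \<A> n =
    \<lparr>carrier = sections G \<A>,
     scl = (\<lambda>c f t. fscl \<A> c (f t)),
     nrm = n,
     mul = (\<lambda>f g r. if r \<in> carrier G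
       then \<Sum>t\<in>carrier G. bmul \<A> t (inv\<^bsub>G\<^esub> t \<otimes>\<^bsub>G\<^esub> r) (f t) (g (inv\<^bsub>G\<^esub> t \<otimes>\<^bsub>G\<^esub> r)) else 0),
     star = (\<lambda>f t. if t \<in> carrier G then bstar \<A> (inv\<^bsub>G\<^esub> t) (f (inv\<^bsub>G\<^esub> t)) else 0)\<rparr>"

text \<open>
  The C*-norm is unique on the sections; it is chosen with \<open>SOME\<close> because nothing determines its
  values elsewhere.
\<close>

definition section_norm ::
  "('g, 'k) monoid_scheme \<Rightarrow> ('g, 'a::ab_group_add, 'm) fell_bundle_scheme \<Rightarrow> ('g \<Rightarrow> 'a) \<Rightarrow> real"
  where "section_norm G \<A> =
    (SOME n. cstar_algebra (section_star_algebra G \<A> n) \<and>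
      (\<forall>t\<in>carrier G. \<forall>a\<in>fset \<A> t. n ((\<lambda>_. 0)(t := a)) = fnrm \<A> t a))"

definition section_algebra ::
  "('g, 'k) monoid_scheme \<Rightarrow> ('g, 'a::ab_group_add, 'm) fell_bundle_scheme \<Rightarrow> ('g \<Rightarrow> 'a) cstar"
  where "section_algebra G \<A> = section_star_algebra G \<A> (section_norm G \<A>)"

definition unit_fibre_sections ::
  "('g, 'k) monoid_scheme \<Rightarrow> ('g, 'a::zero, 'm) fell_bundle_scheme \<Rightarrow> ('g \<Rightarrow> 'a) set"
  where "unit_fibre_sections G \<A> = (\<lambda>a. (\<lambda>_. 0)(\<one>\<^bsub>G\<^esub> := a)) ` fset \<A> \<one>\<^bsub>G\<^esub>"


section \<open>Equivalence bundles\<close>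

text \<open>
  As above, the first two arguments of each operation are the degrees of the other two:
  \<open>elact \<X> t s\<close> is the action of \<open>A\<^sub>t\<close> on \<open>X\<^sub>s\<close>, \<open>eract \<X> s t\<close> that of \<open>B\<^sub>t\<close> on \<open>X\<^sub>s\<close>, and
  \<open>elip \<X> t s\<close> and \<open>erip \<X> t s\<close> are the \<open>C\<close>- and \<open>D\<close>-valued inner products on \<open>X\<^sub>t \<times> X\<^sub>s\<close>.
\<close>

record ('g, 'a, 'b, 'x) equiv_bundle = "('g, 'x) banach_family" +
  elact :: "'g \<Rightarrow> 'g \<Rightarrow> 'a \<Rightarrow> 'x \<Rightarrow> 'x"
  eract :: "'g \<Rightarrow> 'g \<Rightarrow> 'x \<Rightarrow> 'b \<Rightarrow> 'x"
  elip :: "'g \<Rightarrow> 'g \<Rightarrow> 'x \<Rightarrow> 'x \<Rightarrow> 'a"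
  erip :: "'g \<Rightarrow> 'g \<Rightarrow> 'x \<Rightarrow> 'x \<Rightarrow> 'b"

locale equivalence_bundle =
  A: cstar_bundle G \<A> + B: cstar_bundle G \<B>
  for G :: "('g, 'k) monoid_scheme" (structure)
    and \<A> :: "('g, 'a::ab_group_add, 'm) fell_bundle_scheme"
    and \<B> :: "('g, 'b::ab_group_add, 'n) fell_bundle_scheme" +
  fixes \<X> :: "('g, 'a, 'b, 'x::ab_group_add, 'l) equiv_bundle_scheme"
  assumes X_banach: "t \<in> carrier G \<Longrightarrow> complex_banach (fibre \<X> t)"
    and elact_bilinear: "t \<in> carrier G \<Longrightarrow> s \<in> carrier G
      \<Longrightarrow> bilinear_map (fibre \<A> t) (fibre \<X> s) (fibre \<X> (t \<otimes> s)) (elact \<X> t s)"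
    and eract_bilinear: "s \<in> carrier G \<Longrightarrow> t \<in> carrier G
      \<Longrightarrow> bilinear_map (fibre \<X> s) (fibre \<B> t) (fibre \<X> (s \<otimes> t)) (eract \<X> s t)"
    and elip_linear: "t \<in> carrier G \<Longrightarrow> s \<in> carrier G \<Longrightarrow> y \<in> fset \<X> s
      \<Longrightarrow> linear_map (fibre \<X> t) (fibre \<A> (t \<otimes> inv s)) (\<lambda>x. elip \<X> t s x y)"
    and erip_linear: "t \<in> carrier G \<Longrightarrow> s \<in> carrier G \<Longrightarrow> x \<in> fset \<X> t
      \<Longrightarrow> linear_map (fibre \<X> s) (fibre \<B> (inv t \<otimes> s)) (\<lambda>y. erip \<X> t s x y)"
    and elip_elact: "r \<in> carrier G \<Longrightarrow> t \<in> carrier G \<Longrightarrow> s \<in> carrier G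
      \<Longrightarrow> a \<in> fset \<A> r \<Longrightarrow> x \<in> fset \<X> t \<Longrightarrow> y \<in> fset \<X> s
      \<Longrightarrow> elip \<X> (r \<otimes> t) s (elact \<X> r t a x) y = bmul \<A> r (t \<otimes> inv s) a (elip \<X> t s x y)"
    and elip_star: "t \<in> carrier G \<Longrightarrow> s \<in> carrier G \<Longrightarrow> x \<in> fset \<X> t \<Longrightarrow> y \<in> fset \<X> s
      \<Longrightarrow> bstar \<A> (t \<otimes> inv s) (elip \<X> t s x y) = elip \<X> s t y x"
    and erip_eract: "t \<in> carrier G \<Longrightarrow> s \<in> carrier G \<Longrightarrow> r \<in> carrier G
      \<Longrightarrow> x \<in> fset \<X> t \<Longrightarrow> y \<in> fset \<X> s \<Longrightarrow> b \<in> fset \<B> r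
      \<Longrightarrow> erip \<X> t (s \<otimes> r) x (eract \<X> s r y b) = bmul \<B> (inv t \<otimes> s) r (erip \<X> t s x y) b"
    and erip_star: "t \<in> carrier G \<Longrightarrow> s \<in> carrier G \<Longrightarrow> x \<in> fset \<X> t \<Longrightarrow> y \<in> fset \<X> s
      \<Longrightarrow> bstar \<B> (inv t \<otimes> s) (erip \<X> t s x y) = erip \<X> s t y x"
    and elip_positive: "t \<in> carrier G \<Longrightarrow> x \<in> fset \<X> t
      \<Longrightarrow> positive_in (unit_fibre G \<A>) (elip \<X> t t x x)"
    and erip_positive: "t \<in> carrier G \<Longrightarrow> x \<in> fset \<X> t
      \<Longrightarrow> positive_in (unit_fibre G \<B>) (erip \<X> t t x x)"
    and elip_definite: "t \<in> carrier G \<Longrightarrow> x \<in> fset \<X> t \<Longrightarrow> elip \<X> t t x x = 0 \<Longrightarrow> x = 0"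
    and erip_definite: "t \<in> carrier G \<Longrightarrow> x \<in> fset \<X> t \<Longrightarrow> erip \<X> t t x x = 0 \<Longrightarrow> x = 0"
    and norm_elip: "t \<in> carrier G \<Longrightarrow> x \<in> fset \<X> t
      \<Longrightarrow> fnrm \<X> t x = sqrt (fnrm \<A> \<one> (elip \<X> t t x x))"
    and norm_erip: "t \<in> carrier G \<Longrightarrow> x \<in> fset \<X> t
      \<Longrightarrow> fnrm \<X> t x = sqrt (fnrm \<B> \<one> (erip \<X> t t x x))"
    and elip_dense: "dense_wrt (fset \<A> \<one>) (fnrm \<A> \<one>)
      (module.span (fscl \<A>)
        {elip \<X> t t x y | t x y. t \<in> carrier G \<and> x \<in> fset \<X> t \<and> y \<in> fset \<X> t})"
    and erip_dense: "dense_wrt (fset \<B> \<one>) (fnrm \<B> \<one>)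
      (module.span (fscl \<B>)
        {erip \<X> t t x y | t x y. t \<in> carrier G \<and> x \<in> fset \<X> t \<and> y \<in> fset \<X> t})"
    and elip_elact_erip: "t \<in> carrier G \<Longrightarrow> s \<in> carrier G \<Longrightarrow> r \<in> carrier G
      \<Longrightarrow> x \<in> fset \<X> t \<Longrightarrow> y \<in> fset \<X> s \<Longrightarrow> z \<in> fset \<X> r
      \<Longrightarrow> elact \<X> (t \<otimes> inv s) r (elip \<X> t s x y) z = eract \<X> t (inv s \<otimes> r) x (erip \<X> s r y z)"


section \<open>Strong Morita equivalence of unital inclusions\<close>

record ('c, 'd, 'y) bimodule = "'y cspace" +
  lact :: "'c \<Rightarrow> 'y \<Rightarrow> 'y"
  ract :: "'y \<Rightarrow> 'd \<Rightarrow> 'y"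
  lip :: "'y \<Rightarrow> 'y \<Rightarrow> 'c"
  rip :: "'y \<Rightarrow> 'y \<Rightarrow> 'd"

definition left_norm :: "('c, 'p) cstar_scheme \<Rightarrow> ('c, 'd, 'y, 'q) bimodule_scheme \<Rightarrow> 'y \<Rightarrow> real"
  where "left_norm C Y y = sqrt (nrm C (lip Y y y))"

definition right_norm :: "('d, 'p) cstar_scheme \<Rightarrow> ('c, 'd, 'y, 'q) bimodule_scheme \<Rightarrow> 'y \<Rightarrow> real"
  where "right_norm D Y y = sqrt (nrm D (rip Y y y))"

definition left_ip_span :: "('c::ab_group_add, 'p) cstar_scheme
    \<Rightarrow> ('c, 'd, 'y, 'q) bimodule_scheme \<Rightarrow> 'y set \<Rightarrow> 'y set \<Rightarrow> 'c set"
  where "left_ip_span C Y S T = module.span (scl C) {lip Y x y | x y. x \<in> S \<and> y \<in> T}"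

definition right_ip_span :: "('d::ab_group_add, 'p) cstar_scheme
    \<Rightarrow> ('c, 'd, 'y, 'q) bimodule_scheme \<Rightarrow> 'y set \<Rightarrow> 'y set \<Rightarrow> 'd set"
  where "right_ip_span D Y S T = module.span (scl D) {rip Y x y | x y. x \<in> S \<and> y \<in> T}"

text \<open>
  Imprimitivity bimodules: full left Hilbert \<open>C\<close>-modules that are also full right Hilbert
  \<open>D\<close>-modules, with compatible structures.  The equality of \<^const>\<open>left_norm\<close> and
  \<^const>\<open>right_norm\<close> is a consequence of these axioms.
\<close>

locale equivalence_bimodule =
  C: cstar_algebra C + D: cstar_algebra D + Y: complex_space Y
  for C :: "('c::ab_group_add, 'p) cstar_scheme"
    and D :: "('d::ab_group_add, 'q) cstar_scheme"
    and Y :: "('c, 'd, 'y::ab_group_add, 'r) bimodule_scheme" +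
  assumes lact_bilinear: "bilinear_map C Y Y (lact Y)"
    and ract_bilinear: "bilinear_map Y D Y (ract Y)"
    and lact_lact: "a \<in> carrier C \<Longrightarrow> c \<in> carrier C \<Longrightarrow> x \<in> carrier Y
      \<Longrightarrow> lact Y (mul C a c) x = lact Y a (lact Y c x)"
    and ract_ract: "x \<in> carrier Y \<Longrightarrow> b \<in> carrier D \<Longrightarrow> d \<in> carrier D
      \<Longrightarrow> ract Y x (mul D b d) = ract Y (ract Y x b) d"
    and lact_ract: "c \<in> carrier C \<Longrightarrow> x \<in> carrier Y \<Longrightarrow> d \<in> carrier D
      \<Longrightarrow> ract Y (lact Y c x) d = lact Y c (ract Y x d)"
    and lip_linear: "y \<in> carrier Y \<Longrightarrow> linear_map Y C (\<lambda>x. lip Y x y)"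
    and rip_linear: "x \<in> carrier Y \<Longrightarrow> linear_map Y D (\<lambda>y. rip Y x y)"
    and lip_lact: "c \<in> carrier C \<Longrightarrow> x \<in> carrier Y \<Longrightarrow> y \<in> carrier Y
      \<Longrightarrow> lip Y (lact Y c x) y = mul C c (lip Y x y)"
    and rip_ract: "x \<in> carrier Y \<Longrightarrow> y \<in> carrier Y \<Longrightarrow> d \<in> carrier D
      \<Longrightarrow> rip Y x (ract Y y d) = mul D (rip Y x y) d"
    and lip_star: "x \<in> carrier Y \<Longrightarrow> y \<in> carrier Y \<Longrightarrow> star C (lip Y x y) = lip Y y x"
    and rip_star: "x \<in> carrier Y \<Longrightarrow> y \<in> carrier Y \<Longrightarrow> star D (rip Y x y) = rip Y y x"
    and lip_positive: "x \<in> carrier Y \<Longrightarrow> positive_in C (lip Y x x)"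
    and rip_positive: "x \<in> carrier Y \<Longrightarrow> positive_in D (rip Y x x)"
    and lip_definite: "x \<in> carrier Y \<Longrightarrow> lip Y x x = 0 \<Longrightarrow> x = 0"
    and rip_definite: "x \<in> carrier Y \<Longrightarrow> rip Y x x = 0 \<Longrightarrow> x = 0"
    and rip_lact: "c \<in> carrier C \<Longrightarrow> x \<in> carrier Y \<Longrightarrow> y \<in> carrier Y
      \<Longrightarrow> rip Y (lact Y c x) y = rip Y x (lact Y (star C c) y)"
    and lip_ract: "x \<in> carrier Y \<Longrightarrow> d \<in> carrier D \<Longrightarrow> y \<in> carrier Y
      \<Longrightarrow> lip Y (ract Y x d) y = lip Y x (ract Y y (star D d))"
    and lip_lact_rip: "x \<in> carrier Y \<Longrightarrow> y \<in> carrier Y \<Longrightarrow> z \<in> carrier Y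
      \<Longrightarrow> lact Y (lip Y x y) z = ract Y x (rip Y y z)"
    and left_complete: "complete_wrt (carrier Y) (left_norm C Y)"
    and right_complete: "complete_wrt (carrier Y) (right_norm D Y)"
    and left_full: "dense_wrt (carrier C) (nrm C) (left_ip_span C Y (carrier Y) (carrier Y))"
    and right_full: "dense_wrt (carrier D) (nrm D) (right_ip_span D Y (carrier Y) (carrier Y))"

text \<open>
  HOL cannot quantify over types, so the type of the elements of the bimodule is a parameter.
\<close>

definition strongly_Morita_equivalent ::
  "'y::ab_group_add itself \<Rightarrow> 'c::ab_group_add set \<Rightarrow> ('c, 'p) cstar_scheme
    \<Rightarrow> 'd::ab_group_add set \<Rightarrow> ('d, 'q) cstar_scheme \<Rightarrow> bool"
  where "strongly_Morita_equivalent TYPE('y) A C B D \<longleftrightarrow>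
    unital_inclusion A C \<and> unital_inclusion B D \<and>
    (\<exists>(Y :: ('c, 'd, 'y) bimodule) X.
      equivalence_bimodule C D Y \<and>
      X \<subseteq> carrier Y \<and> module.subspace (scl Y) X \<and>
      closed_wrt (carrier Y) (left_norm C Y) X \<and>
      (\<forall>a\<in>A. \<forall>x\<in>X. lact Y a x \<in> X) \<and> (\<forall>x\<in>X. \<forall>b\<in>B. ract Y x b \<in> X) \<and>
      (\<forall>x\<in>X. \<forall>y\<in>X. lip Y x y \<in> A \<and> rip Y x y \<in> B) \<and>
      equivalence_bimodule (C\<lparr>carrier := A\<rparr>) (D\<lparr>carrier := B\<rparr>) (Y\<lparr>carrier := X\<rparr>) \<and>
      left_ip_span C Y (carrier Y) X = carrier C \<and>
      right_ip_span D Y (carrier Y) X = carrier D)"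

end

theory Submission
  imports Defs
begin

text \<open>
  The sections of \<open>\<X>\<close> form the bimodule \<open>Y\<close>, and \<open>X\<close> consists of the sections supported at the unit of
  the group.  Two points are not formal.

  The C*-norm on \<open>C = \<oplus>\<^sub>t A\<^sub>t\<close> is the operator norm of \<open>C\<close> acting by left multiplication on itself,
  seen as a Hilbert module over \<open>A\<^sub>e\<close> with inner product \<open>(f\<^sup>* g)(e)\<close>.  This needs the order of
  \<open>A\<^sub>e\<close>, which is developed without spectra: square roots come from the iteration
  \<open>y \<leftarrow> (x + y\<^sup>2)/2\<close>, whose limit for \<open>\<parallel>x\<parallel> \<le> 1\<close> satisfies \<open>(1 - y)\<^sup>2 = 1 - x\<close>, and \<open>b\<^sup>* b \<ge> 0\<close> is then
  proved as by Kaplansky.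

  Positivity of \<open>\<langle>x,x\<rangle>\<close> in \<open>C\<close> for \<open>x \<in> Y\<close>: since \<open>\<langle>X,X\<rangle>\<close> spans \<open>B\<^sub>e\<close>, the unit of \<open>D\<close> is a finite
  sum of elements \<open>\<langle>w,w\<rangle>\<close>, so \<open>x\<close> is the sum of the \<open>x \<cdot> \<langle>w,w\<rangle> = \<langle>x,w\<rangle> \<cdot> w\<close> and \<open>\<langle>x,x\<rangle>\<close> is the sum
  of the \<open>\<langle>w,x\<rangle>\<^sup>* \<langle>w,x\<rangle>\<close>.
\<close>

section \<open>Complex vector spaces\<close>

text \<open>The norm of \<open>C\<close> is picked by \<open>SOME\<close>, so no formula for it is
  available. What can be used is that it is a C*-norm restricting to the fibre norms: such a norm
  must first be constructed, and every later estimate in \<open>C\<close> has to come from the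
  C*-axioms.

  The link back to the fibres is evaluation at the unit e of the group. It sends positive sections
  to positive elements of \<open>A\<^sub>e\<close>, and applied to the positive element norm(f) - f
  it bounds the value of f at e by the norm of f. The value at e of the inner product of a section
  with itself is a sum of positive terms, one for each degree, and such a sum dominates each term.
  This gives definiteness and control of every coordinate, hence completeness of \<open>Y\<close>
  and closedness of \<open>X\<close>.

  The bundle axioms express positivity as being some b^* b, while these arguments add and compare
  such elements; Kaplansky's theorem is what makes this legitimate.\<close>

context complex_space
begin

sublocale vs: vector_space "scl V"
  by (rule vector_space)

lemma zero_closed [simp]: "0 \<in> carrier V"
  by (rule vs.subspace_0[OF subspace])

lemma add_closed [simp]: "x \<in> carrier V \<Longrightarrow> y \<in> carrier V \<Longrightarrow> x + y \<in> carrier V"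
  by (rule vs.subspace_add[OF subspace])

lemma diff_closed [simp]: "x \<in> carrier V \<Longrightarrow> y \<in> carrier V \<Longrightarrow> x - y \<in> carrier V"
  by (rule vs.subspace_diff[OF subspace])

lemma minus_closed [simp]: "x \<in> carrier V \<Longrightarrow> - x \<in> carrier V"
  by (rule vs.subspace_neg[OF subspace])

lemma scl_closed [simp]: "x \<in> carrier V \<Longrightarrow> scl V c x \<in> carrier V"
  by (rule vs.subspace_scale[OF subspace])

lemma sum_closed: "(\<And>i. i \<in> I \<Longrightarrow> f i \<in> carrier V) \<Longrightarrow> sum f I \<in> carrier V"
  by (rule vs.subspace_sum[OF subspace])

lemma span_subset: "S \<subseteq> carrier V \<Longrightarrow> vs.span S \<subseteq> carrier V"
  by (rule vs.span_minimal[OF _ subspace])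

end

text \<open>\<open>complex_banach\<close> without completeness, so that norm estimates and
  sequential criteria are available while completeness is still to be proved.\<close>

locale complex_normed = complex_space V
  for V :: "('v::ab_group_add, 'm) cnormed_scheme" +
  assumes norm_nonneg: "x \<in> carrier V \<Longrightarrow> 0 \<le> nrm V x"
    and norm_eq_0: "x \<in> carrier V \<Longrightarrow> nrm V x = 0 \<longleftrightarrow> x = 0"
    and norm_scl: "x \<in> carrier V \<Longrightarrow> nrm V (scl V c x) = cmod c * nrm V x"
    and norm_triangle:
      "x \<in> carrier V \<Longrightarrow> y \<in> carrier V \<Longrightarrow> nrm V (x + y) \<le> nrm V x + nrm V y"

sublocale complex_banach \<subseteq> complex_normed
  by unfold_locales (fact norm_nonneg norm_eq_0 norm_scl norm_triangle)+

context complex_normed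
begin

lemma norm_zero [simp]: "nrm V 0 = 0"
  using norm_eq_0[of 0] by simp

lemma norm_minus: "x \<in> carrier V \<Longrightarrow> nrm V (- x) = nrm V x"
  using norm_scl[of x "-1"] by simp

lemma norm_commute: "x \<in> carrier V \<Longrightarrow> y \<in> carrier V \<Longrightarrow> nrm V (x - y) = nrm V (y - x)"
  using norm_minus[of "x - y"] by simp

lemma norm_diff: "x \<in> carrier V \<Longrightarrow> y \<in> carrier V \<Longrightarrow> nrm V (x - y) \<le> nrm V x + nrm V y"
  using norm_triangle[of x "- y"] norm_minus[of y] by simp

lemma norm_sum:
  "(\<And>i. i \<in> I \<Longrightarrow> f i \<in> carrier V) \<Longrightarrow> nrm V (sum f I) \<le> (\<Sum>i\<in>I. nrm V (f i))"
proof (induction I rule: infinite_finite_induct)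
  case (insert i I)
  then have "nrm V (f i + sum f I) \<le> nrm V (f i) + nrm V (sum f I)"
    by (intro norm_triangle sum_closed) auto
  also have "nrm V (sum f I) \<le> (\<Sum>i\<in>I. nrm V (f i))"
    using insert by auto
  finally show ?case using insert by simp
qed auto

lemma Metric_space_norm: "Metric_space (carrier V) (norm_dist (carrier V) (nrm V))"
proof
  fix x y z
  show "0 \<le> norm_dist (carrier V) (nrm V) x y"
    by (simp add: norm_dist_def norm_nonneg)
  show "norm_dist (carrier V) (nrm V) x y = norm_dist (carrier V) (nrm V) y x"
    by (simp add: norm_dist_def norm_commute)
  assume x: "x \<in> carrier V" "y \<in> carrier V"
  then show "(norm_dist (carrier V) (nrm V) x y = 0) = (x = y)"
    by (simp add: norm_dist_def norm_eq_0)
  assume "z \<in> carrier V"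
  then show "norm_dist (carrier V) (nrm V) x z
      \<le> norm_dist (carrier V) (nrm V) x y + norm_dist (carrier V) (nrm V) y z"
    using x norm_triangle[of "x - y" "y - z"] by (simp add: norm_dist_def)
qed

text \<open>Removes the cut-off distance: completeness becomes a statement about Cauchy sequences
  for \<open>nrm\<close>, the form in which it is used for fibres and proved for sections.\<close>

lemma complete_wrt_iff:
  "complete_wrt (carrier V) (nrm V) \<longleftrightarrow>
    (\<forall>x. (\<forall>n. x n \<in> carrier V) \<longrightarrow>
      (\<forall>\<epsilon>>0. \<exists>N. \<forall>m\<ge>N. \<forall>n\<ge>N. nrm V (x m - x n) < \<epsilon>) \<longrightarrow>
      (\<exists>l\<in>carrier V. (\<lambda>n. nrm V (x n - l)) \<longlonglongrightarrow> 0))"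
proof -
  interpret M: Metric_space "carrier V" "norm_dist (carrier V) (nrm V)"
    by (rule Metric_space_norm)
  have C: "M.MCauchy x \<longleftrightarrow> (\<forall>n. x n \<in> carrier V) \<and>
      (\<forall>\<epsilon>>0. \<exists>N. \<forall>m\<ge>N. \<forall>n\<ge>N. nrm V (x m - x n) < \<epsilon>)" for x :: "nat \<Rightarrow> 'v"
  proof (cases "\<forall>n. x n \<in> carrier V")
    case True
    then show ?thesis
      unfolding M.MCauchy_def norm_dist_def by (simp add: image_subset_iff)
  next
    case False
    then show ?thesis
      unfolding M.MCauchy_def by blast
  qed
  have L: "limitin M.mtopology x l sequentially \<longleftrightarrow>
      l \<in> carrier V \<and> (\<lambda>n. nrm V (x n - l)) \<longlonglongrightarrow> 0" if x: "\<And>n. x n \<in> carrier V" for x l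
  proof -
    have "((\<lambda>n. norm_dist (carrier V) (nrm V) (x n) l) \<longlonglongrightarrow> 0)
        \<longleftrightarrow> ((\<lambda>n. nrm V (x n - l)) \<longlonglongrightarrow> 0)" if "l \<in> carrier V"
      using x that by (simp add: norm_dist_def)
    then show ?thesis
      using x by (auto simp: M.limitin_metric_dist_null)
  qed
  show ?thesis
    unfolding complete_wrt_def M.mcomplete_def
    by (intro iff_allI) (auto simp: C L)
qed

lemma closed_wrtI:
  assumes "S \<subseteq> carrier V"
    and "\<And>x. x \<in> carrier V \<Longrightarrow> x \<notin> S \<Longrightarrow> \<exists>r>0. \<forall>y\<in>S. r \<le> nrm V (x - y)"
  shows "closed_wrt (carrier V) (nrm V) S"
proof -
  interpret M: Metric_space "carrier V" "norm_dist (carrier V) (nrm V)"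
    by (rule Metric_space_norm)
  show ?thesis
    unfolding closed_wrt_def M.closedin_metric
  proof (intro conjI allI impI assms(1))
    fix x assume x: "x \<in> carrier V - S"
    then obtain r where "r > 0" "\<forall>y\<in>S. r \<le> nrm V (x - y)"
      using assms(2) by auto
    then show "\<exists>r>0. disjnt S (M.mball x r)"
      using x assms(1) by (intro exI[of _ r]) (force simp: disjnt_iff norm_dist_def)
  qed
qed

lemma dense_wrt_carrier: "dense_wrt (carrier V) (nrm V) (carrier V)"
proof -
  interpret M: Metric_space "carrier V" "norm_dist (carrier V) (nrm V)"
    by (rule Metric_space_norm)
  show ?thesis
    unfolding dense_wrt_def using closure_of_topspace[of M.mtopology] by simp
qed

section \<open>Sequential limits in normed spaces\<close>

definition converges :: "(nat \<Rightarrow> 'v) \<Rightarrow> 'v \<Rightarrow> bool"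
  where "converges x l \<longleftrightarrow>
    (\<forall>n. x n \<in> carrier V) \<and> l \<in> carrier V \<and> (\<lambda>n. nrm V (x n - l)) \<longlonglongrightarrow> 0"

lemma convergesI:
  assumes "\<And>n. x n \<in> carrier V" "l \<in> carrier V"
    and "\<And>n. nrm V (x n - l) \<le> e n" "e \<longlonglongrightarrow> 0"
  shows "converges x l"
proof -
  have "(\<lambda>n. nrm V (x n - l)) \<longlonglongrightarrow> 0"
    by (rule tendsto_sandwich[OF _ _ tendsto_const assms(4)]) (simp_all add: assms norm_nonneg)
  then show ?thesis
    using assms by (simp add: converges_def)
qed

lemma converges_unique: "converges x l \<Longrightarrow> converges x m \<Longrightarrow> l = m"
proof -
  assume l: "converges x l" and m: "converges x m"
  have "(\<lambda>n. nrm V (x n - l) + nrm V (x n - m)) \<longlonglongrightarrow> 0 + 0"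
    using l m unfolding converges_def by (intro tendsto_add) auto
  moreover have "nrm V (l - m) \<le> nrm V (x n - l) + nrm V (x n - m)" for n
    using l m norm_diff[of "x n - m" "x n - l"] by (auto simp: converges_def)
  ultimately have "nrm V (l - m) \<le> 0"
    by (intro LIMSEQ_le_const) auto
  then show ?thesis
    using l m norm_nonneg[of "l - m"] norm_eq_0[of "l - m"] by (auto simp: converges_def)
qed

lemma converges_const: "l \<in> carrier V \<Longrightarrow> converges (\<lambda>_. l) l"
  by (simp add: converges_def)

lemma converges_Suc: "converges x l \<Longrightarrow> converges (\<lambda>n. x (Suc n)) l"
  using LIMSEQ_Suc[of "\<lambda>n. nrm V (x n - l)"] by (auto simp: converges_def)

lemma converges_add:
  assumes "converges x l" "converges y m" shows "converges (\<lambda>n. x n + y n) (l + m)"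
proof (rule convergesI)
  show "(\<lambda>n. nrm V (x n - l) + nrm V (y n - m)) \<longlonglongrightarrow> 0"
    using assms tendsto_add[of _ 0 _ _ 0] by (force simp: converges_def)
  show "nrm V (x n + y n - (l + m)) \<le> nrm V (x n - l) + nrm V (y n - m)" for n
    using assms norm_triangle[of "x n - l" "y n - m"] by (auto simp: converges_def algebra_simps)
qed (use assms in \<open>auto simp: converges_def\<close>)

lemma converges_scl:
  assumes "converges x l" shows "converges (\<lambda>n. scl V c (x n)) (scl V c l)"
proof (rule convergesI)
  show "(\<lambda>n. cmod c * nrm V (x n - l)) \<longlonglongrightarrow> 0"
    using assms tendsto_mult_right_zero by (auto simp: converges_def)
  show "nrm V (scl V c (x n) - scl V c l) \<le> cmod c * nrm V (x n - l)" for n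
    using assms norm_scl[of "x n - l" c] by (auto simp: converges_def vs.scale_right_diff_distrib)
qed (use assms in \<open>auto simp: converges_def\<close>)

lemma norm_limit_le:
  assumes x: "converges x l" and b: "\<And>n. nrm V (x n) \<le> b" shows "nrm V l \<le> b"
proof -
  have "(\<lambda>n. nrm V (x n - l) + b) \<longlonglongrightarrow> 0 + b"
    using x by (intro tendsto_add) (auto simp: converges_def)
  moreover have "nrm V l \<le> nrm V (x n - l) + b" for n
    using x b[of n] norm_diff[of "x n" "x n - l"] by (auto simp: converges_def)
  ultimately show ?thesis
    by (intro LIMSEQ_le_const) auto
qed

end

text \<open>The increments telescope, so distances in x are bounded by distances in the convergent
  real sequence t and x is Cauchy. The majorant t will be a scalar iteration for square roots and a
  geometric series for inverses.\<close>

lemma (in complex_banach) converges_if_dominated: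
  assumes x: "\<And>n. x n \<in> carrier V" and t: "convergent t"
    and le: "\<And>n. nrm V (x (Suc n) - x n) \<le> t (Suc n) - t n"
  obtains l where "converges x l"
proof -
  have *: "nrm V (x (n + k) - x n) \<le> t (n + k) - t n" for n k :: nat
  proof (induction k)
    case (Suc k)
    have "nrm V ((x (Suc (n + k)) - x (n + k)) + (x (n + k) - x n)) \<le> t (Suc (n + k)) - t n"
      using x Suc le[of "n + k"]
      by (intro order_trans[OF norm_triangle]) auto
    then show ?case by simp
  qed simp
  have **: "nrm V (x m - x n) \<le> \<bar>t m - t n\<bar>" for m n
  proof (cases "n \<le> m")
    case True
    then show ?thesis using *[of n "m - n"] by simp
  next
    case False
    then show ?thesis using *[of m "n - m"] norm_commute[of "x m" "x n"] x by simp
  qed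
  have "Cauchy t"
    using t by (rule convergent_Cauchy)
  then have "\<forall>\<epsilon>>0. \<exists>N. \<forall>m\<ge>N. \<forall>n\<ge>N. nrm V (x m - x n) < \<epsilon>"
    using ** unfolding Cauchy_def dist_real_def by (metis order_le_less_trans)
  then obtain l where "l \<in> carrier V" "(\<lambda>n. nrm V (x n - l)) \<longlonglongrightarrow> 0"
    using complete x unfolding complete_wrt_iff by blast
  then show ?thesis
    using x by (intro that[of l]) (auto simp: converges_def)
qed

section \<open>Star algebras\<close>

text \<open>The algebraic axioms of \<open>cstar_algebra\<close>: the sections have to be handled as
  a *-algebra before any C*-norm on them is known to exist.\<close>

locale star_algebra = complex_space A
  for A :: "('a::ab_group_add, 'm) cstar_scheme" +
  assumes mul_bilinear: "bilinear_map A A A (mul A)"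
    and mul_assoc: "a \<in> carrier A \<Longrightarrow> b \<in> carrier A \<Longrightarrow> c \<in> carrier A
      \<Longrightarrow> mul A (mul A a b) c = mul A a (mul A b c)"
    and star_conj_linear: "conj_linear_map A A (star A)"
    and star_mul: "a \<in> carrier A \<Longrightarrow> b \<in> carrier A
      \<Longrightarrow> star A (mul A a b) = mul A (star A b) (star A a)"
    and star_star: "a \<in> carrier A \<Longrightarrow> star A (star A a) = a"
begin

lemma mul_closed [simp]: "a \<in> carrier A \<Longrightarrow> b \<in> carrier A \<Longrightarrow> mul A a b \<in> carrier A"
  using mul_bilinear by (auto simp: bilinear_map_def semilinear_map_def)

lemma mul_add_left: "a \<in> carrier A \<Longrightarrow> b \<in> carrier A \<Longrightarrow> c \<in> carrier A
    \<Longrightarrow> mul A (a + b) c = mul A a c + mul A b c"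
  using mul_bilinear by (auto simp: bilinear_map_def semilinear_map_def)

lemma mul_add_right: "a \<in> carrier A \<Longrightarrow> b \<in> carrier A \<Longrightarrow> c \<in> carrier A
    \<Longrightarrow> mul A c (a + b) = mul A c a + mul A c b"
  using mul_bilinear by (auto simp: bilinear_map_def semilinear_map_def)

lemma mul_scl_left: "a \<in> carrier A \<Longrightarrow> b \<in> carrier A
    \<Longrightarrow> mul A (scl A z a) b = scl A z (mul A a b)"
  using mul_bilinear by (auto simp: bilinear_map_def semilinear_map_def)

lemma mul_scl_right: "a \<in> carrier A \<Longrightarrow> b \<in> carrier A
    \<Longrightarrow> mul A a (scl A z b) = scl A z (mul A a b)"
  using mul_bilinear by (auto simp: bilinear_map_def semilinear_map_def)

lemma mul_minus_left: "a \<in> carrier A \<Longrightarrow> b \<in> carrier A \<Longrightarrow> mul A (- a) b = - mul A a b"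
  using mul_scl_left[of a b "-1"] by simp

lemma mul_minus_right: "a \<in> carrier A \<Longrightarrow> b \<in> carrier A \<Longrightarrow> mul A a (- b) = - mul A a b"
  using mul_scl_right[of a b "-1"] by simp

lemma mul_diff_left: "a \<in> carrier A \<Longrightarrow> b \<in> carrier A \<Longrightarrow> c \<in> carrier A
    \<Longrightarrow> mul A (a - b) c = mul A a c - mul A b c"
  using mul_add_left[of a "- b" c] by (simp add: mul_minus_left)

lemma mul_diff_right: "a \<in> carrier A \<Longrightarrow> b \<in> carrier A \<Longrightarrow> c \<in> carrier A
    \<Longrightarrow> mul A c (a - b) = mul A c a - mul A c b"
  using mul_add_right[of a "- b" c] by (simp add: mul_minus_right)

lemma mul_zero_left [simp]: "a \<in> carrier A \<Longrightarrow> mul A 0 a = 0"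
  using mul_scl_left[of a a 0] by simp

lemma mul_zero_right [simp]: "a \<in> carrier A \<Longrightarrow> mul A a 0 = 0"
  using mul_scl_right[of a a 0] by simp

lemma star_closed [simp]: "a \<in> carrier A \<Longrightarrow> star A a \<in> carrier A"
  using star_conj_linear by (auto simp: semilinear_map_def)

lemma star_add: "a \<in> carrier A \<Longrightarrow> b \<in> carrier A \<Longrightarrow> star A (a + b) = star A a + star A b"
  using star_conj_linear by (auto simp: semilinear_map_def)

lemma star_scl: "a \<in> carrier A \<Longrightarrow> star A (scl A z a) = scl A (cnj z) (star A a)"
  using star_conj_linear by (auto simp: semilinear_map_def)

lemma star_minus: "a \<in> carrier A \<Longrightarrow> star A (- a) = - star A a"
  using star_scl[of a "-1"] by simp

lemma star_diff: "a \<in> carrier A \<Longrightarrow> b \<in> carrier A \<Longrightarrow> star A (a - b) = star A a - star A b"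
  using star_add[of a "- b"] by (simp add: star_minus)

lemma star_zero [simp]: "star A 0 = 0"
  using star_scl[of 0 0] by simp

lemmas mul_distribs = mul_add_left mul_add_right mul_diff_left mul_diff_right
  mul_minus_left mul_minus_right mul_scl_left mul_scl_right

lemmas star_distribs = star_add star_diff star_minus star_scl star_mul star_star

end

locale unital_star_algebra = star_algebra A
  for A :: "('a::ab_group_add, 'm) cstar_scheme" +
  fixes unit :: 'a
  assumes is_unit: "is_unit_of A unit"
begin

lemma unit_closed [simp]: "unit \<in> carrier A"
  using is_unit by (simp add: is_unit_of_def)

lemma unit_left [simp]: "a \<in> carrier A \<Longrightarrow> mul A unit a = a"
  using is_unit by (simp add: is_unit_of_def)

lemma unit_right [simp]: "a \<in> carrier A \<Longrightarrow> mul A a unit = a"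
  using is_unit by (simp add: is_unit_of_def)

lemma star_unit [simp]: "star A unit = unit"
proof -
  have "star A unit = mul A (star A unit) (star A (star A unit))"
    by (simp add: star_star)
  also have "\<dots> = star A (mul A (star A unit) unit)"
    by (simp only: star_mul star_closed unit_closed)
  also have "\<dots> = unit"
    by (simp add: star_star)
  finally show ?thesis .
qed

end

sublocale cstar_algebra \<subseteq> star_algebra
  by unfold_locales (fact mul_bilinear mul_assoc star_conj_linear star_mul star_star)+

section \<open>Isometry of the involution and continuity of the operations\<close>

context cstar_algebra
begin

lemma norm_star_le: "a \<in> carrier A \<Longrightarrow> nrm A a \<le> nrm A (star A a)"
proof (cases "nrm A a = 0")
  case False
  assume a: "a \<in> carrier A"
  have "nrm A a * nrm A a \<le> nrm A (star A a) * nrm A a"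
    using cstar_identity[OF a] norm_mul[of "star A a" a] a by (simp add: power2_eq_square)
  then show ?thesis
    using False norm_nonneg[OF a] by (simp add: mult_le_cancel_right)
qed (simp add: norm_nonneg)

lemma norm_star [simp]: "a \<in> carrier A \<Longrightarrow> nrm A (star A a) = nrm A a"
  using norm_star_le[of a] norm_star_le[of "star A a"] by (simp add: star_star)

lemma converges_mul:
  assumes x: "converges x l" and y: "converges y m"
  shows "converges (\<lambda>n. mul A (x n) (y n)) (mul A l m)"
proof (rule convergesI)
  let ?e = "\<lambda>n. nrm A (x n - l) * nrm A (y n - m) + nrm A (x n - l) * nrm A m
    + nrm A l * nrm A (y n - m)"
  have *: "(\<lambda>n. nrm A (x n - l)) \<longlonglongrightarrow> 0" "(\<lambda>n. nrm A (y n - m)) \<longlonglongrightarrow> 0"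
    using x y by (auto simp: converges_def)
  show "?e \<longlonglongrightarrow> 0"
    by (rule tendsto_eq_intros * | simp)+
  fix n
  have xy: "x n \<in> carrier A" "y n \<in> carrier A" "l \<in> carrier A" "m \<in> carrier A"
    using x y by (auto simp: converges_def)
  have "mul A (x n) (y n) - mul A l m
      = mul A (x n - l) (y n - m) + mul A (x n - l) m + mul A l (y n - m)"
    using xy by (simp add: mul_distribs)
  also have "nrm A \<dots> \<le> nrm A (mul A (x n - l) (y n - m)) + nrm A (mul A (x n - l) m)
      + nrm A (mul A l (y n - m))"
    using xy by (intro order_trans[OF norm_triangle] add_right_mono norm_triangle) auto
  also have "\<dots> \<le> ?e n"
    using xy by (intro add_mono norm_mul) auto
  finally show "nrm A (mul A (x n) (y n) - mul A l m) \<le> ?e n" .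
qed (use x y in \<open>auto simp: converges_def\<close>)

lemma converges_star: "converges x l \<Longrightarrow> converges (\<lambda>n. star A (x n)) (star A l)"
  by (auto simp: converges_def simp flip: star_diff)

end

section \<open>Positivity in unital C*-algebras\<close>

text \<open>The scalar case x = 1 of the square root iteration. It increases because (1 - t)^2 \<ge>
  0 and stays below 1; its increments will majorise those of the iteration in the algebra.\<close>

lemma iteration_half_square:
  defines "t \<equiv> rec_nat 0 (\<lambda>_ r. (1 + r\<^sup>2) / 2)"
  shows "0 \<le> (t n :: real)" "t n \<le> 1" "convergent t" "t (Suc n) = (1 + (t n)\<^sup>2) / 2"
proof -
  have S: "t (Suc n) = (1 + (t n)\<^sup>2) / 2" for n
    by (simp add: t_def)
  have b: "0 \<le> t n \<and> t n \<le> 1" for n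
  proof (induction n)
    case (Suc n)
    then show ?case
      using power_mono[of "t n" 1 2] by (simp add: S)
  qed (simp add: t_def)
  have "t n \<le> t (Suc n)" for n
    using zero_le_power2[of "1 - t n"] by (simp add: S power2_eq_square algebra_simps)
  then have "incseq t"
    by (rule incseq_SucI)
  then show "convergent t"
    using b incseq_convergent[of t 1] by (metis convergentI)
  show "0 \<le> t n" "t n \<le> 1" "t (Suc n) = (1 + (t n)\<^sup>2) / 2"
    using b S by auto
qed

text \<open>If s < a, then (s/a)^n (1 + n) tends to 0, which contradicts the hypothesis for large n
  = 2^k. Exponents 2^k suffice for norms of selfadjoint elements, where squaring is compatible with
  the norm.\<close>

lemma le_if_powers_of_two_le:
  fixes a s :: real
  assumes s: "0 < s" and le: "\<And>k. a ^ 2 ^ k \<le> s ^ 2 ^ k * (1 + 2 ^ k)"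
  shows "a \<le> s"
proof (rule ccontr)
  assume "\<not> a \<le> s"
  then have as: "s < a" by simp
  define r where "r = s / a"
  have r: "0 < r" "r < 1"
    using s as by (auto simp: r_def)
  have "(\<lambda>n. r ^ n + real n * r ^ n) \<longlonglongrightarrow> 0 + 0"
    using r by (intro tendsto_add LIMSEQ_power_zero powser_times_n_limit_0) auto
  then have "\<forall>\<^sub>F n in sequentially. r ^ n + real n * r ^ n < 1"
    by (rule order_tendstoD) simp
  then obtain N where N: "\<And>n. n \<ge> N \<Longrightarrow> r ^ n + real n * r ^ n < 1"
    by (auto simp: eventually_sequentially)
  have "N \<le> 2 ^ N"
    by (simp add: less_imp_le)
  from N[OF this] have "r ^ 2 ^ N * (1 + 2 ^ N) < 1"
    by (simp add: algebra_simps)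
  then have "s ^ 2 ^ N * (1 + 2 ^ N) < a ^ 2 ^ N"
    using s as by (simp add: r_def power_divide field_simps)
  with le[of N] show False by simp
qed

locale unital_cstar_algebra = cstar_algebra A + unital_star_algebra A unit
  for A :: "('a::ab_group_add, 'm) cstar_scheme" and unit :: 'a
begin

text \<open>Only an inequality, because in the zero algebra the unit is 0.\<close>

lemma norm_unit_le: "nrm A unit \<le> 1"
proof -
  have "(nrm A unit)\<^sup>2 = nrm A unit"
    using cstar_identity[of unit] by simp
  then show ?thesis
    by (auto simp: power2_eq_square)
qed

definition selfadjoint :: "'a \<Rightarrow> bool"
  where "selfadjoint a \<longleftrightarrow> a \<in> carrier A \<and> star A a = a"

text \<open>
  Positivity is defined through selfadjoint square roots: this cone is closed under sums by the
  characterisation \<open>\<parallel>s - a\<parallel> \<le> s\<close>, whereas for the elements \<open>b* b\<close> additivity is the hard part of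
  the theory.
\<close>

definition pos :: "'a \<Rightarrow> bool"
  where "pos a \<longleftrightarrow> (\<exists>h. selfadjoint h \<and> a = mul A h h)"

lemma selfadjoint_closed [simp]: "selfadjoint a \<Longrightarrow> a \<in> carrier A"
  by (simp add: selfadjoint_def)

lemma selfadjoint_star: "selfadjoint a \<Longrightarrow> star A a = a"
  by (simp add: selfadjoint_def)

lemma selfadjoint_scl: "selfadjoint a \<Longrightarrow> selfadjoint (scl A (of_real s) a)"
  by (simp add: selfadjoint_def star_scl)

lemma selfadjoint_add: "selfadjoint a \<Longrightarrow> selfadjoint b \<Longrightarrow> selfadjoint (a + b)"
  by (simp add: selfadjoint_def star_add)

lemma selfadjoint_diff: "selfadjoint a \<Longrightarrow> selfadjoint b \<Longrightarrow> selfadjoint (a - b)"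
  by (simp add: selfadjoint_def star_diff)

lemma selfadjoint_unit: "selfadjoint unit"
  by (simp add: selfadjoint_def)

lemma norm_square: "selfadjoint a \<Longrightarrow> nrm A (mul A a a) = (nrm A a)\<^sup>2"
  using cstar_identity[of a] by (simp add: selfadjoint_star)

lemma pos_selfadjoint: "pos a \<Longrightarrow> selfadjoint a"
  by (auto simp: pos_def selfadjoint_def star_mul)

lemma pos_closed [simp]: "pos a \<Longrightarrow> a \<in> carrier A"
  using pos_selfadjoint by auto

lemma pos_square: "selfadjoint h \<Longrightarrow> pos (mul A h h)"
  unfolding pos_def by blast

lemma pos_zero: "pos 0"
  using pos_square[of 0] by (simp add: selfadjoint_def)

text \<open>The conclusions beyond the root replace functional calculus: being within 1 of the unit
  will make the root itself positive, and it commutes with everything that commutes with x because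
  each iterate does.\<close>

lemma sqrt_one_minus:
  assumes x: "selfadjoint x" and le: "nrm A x \<le> 1"
  obtains h where "selfadjoint h" "mul A h h = unit - x" "nrm A (unit - h) \<le> 1"
    "\<And>z. z \<in> carrier A \<Longrightarrow> mul A z x = mul A x z \<Longrightarrow> mul A z h = mul A h z"
proof -
  define y where "y = rec_nat 0 (\<lambda>_ r. scl A (1/2) (x + mul A r r))"
  define t where "t = rec_nat 0 (\<lambda>_ r. (1 + r\<^sup>2) / (2::real))"
  note t = iteration_half_square[folded t_def]
  have y0: "y 0 = 0" and yS: "y (Suc n) = scl A (1/2) (x + mul A (y n) (y n))" for n
    by (auto simp: y_def)
  have ysa: "selfadjoint (y n)" for n
  proof (induction n)
    case (Suc n)
    then show ?case
      using x by (simp add: yS selfadjoint_def star_distribs)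
  qed (simp add: y0 selfadjoint_def)
  have yc [simp]: "y n \<in> carrier A" for n
    using ysa by auto
  have xc [simp]: "x \<in> carrier A"
    using x by auto
  have yn: "nrm A (y n) \<le> t n" for n
  proof (induction n)
    case (Suc n)
    have "nrm A (y (Suc n)) = nrm A (x + mul A (y n) (y n)) / 2"
      by (simp add: yS norm_scl)
    also have "\<dots> \<le> (nrm A x + nrm A (y n) * nrm A (y n)) / 2"
      using norm_triangle[of x "mul A (y n) (y n)"] norm_mul[of "y n" "y n"] by simp
    also have "\<dots> \<le> (1 + t n * t n) / 2"
      using Suc le by (intro divide_right_mono add_mono mult_mono) (auto simp: norm_nonneg t)
    finally show ?case
      by (simp add: t power2_eq_square)
  qed (simp add: y0 t_def)
  \<comment> \<open>The factorisation a^2 - b^2 = a (a - b) + (a - b) b holds without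
    commutativity.\<close>
  have square_diff: "scl A (1/2) (x + mul A a a) - scl A (1/2) (x + mul A b b)
      = scl A (1/2) (mul A a (a - b) + mul A (a - b) b)"
    if "a \<in> carrier A" "b \<in> carrier A" for a b
    using that by (simp add: mul_distribs flip: vs.scale_right_diff_distrib)
  \<comment> \<open>The scalar iteration satisfies the same difference identity, so its increments
    bound those of y by induction.\<close>
  have step: "nrm A (y (Suc n) - y n) \<le> t (Suc n) - t n" for n
  proof (induction n)
    case 0
    then show ?case
      using le by (simp add: yS y0 t_def norm_scl)
  next
    case (Suc n)
    let ?a = "y (Suc n)" and ?b = "y n"
    have "y (Suc (Suc n)) - ?a = scl A (1/2) (mul A ?a (?a - ?b) + mul A (?a - ?b) ?b)"
      unfolding yS[of "Suc n"] using square_diff[of ?a ?b] by (simp flip: yS[of n])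
    also have "nrm A \<dots> = nrm A (mul A ?a (?a - ?b) + mul A (?a - ?b) ?b) / 2"
      by (simp add: norm_scl)
    also have "\<dots> \<le> (nrm A ?a * nrm A (?a - ?b) + nrm A (?a - ?b) * nrm A ?b) / 2"
      using norm_triangle[of "mul A ?a (?a - ?b)" "mul A (?a - ?b) ?b"]
        norm_mul[of ?a "?a - ?b"] norm_mul[of "?a - ?b" ?b] by simp
    also have "\<dots> \<le> (t (Suc n) * (t (Suc n) - t n) + (t (Suc n) - t n) * t n) / 2"
      using Suc yn[of n] yn[of "Suc n"] t(1)[of n] t(1)[of "Suc n"]
        order_trans[OF norm_nonneg[OF diff_closed[OF yc yc]] Suc]
      by (intro divide_right_mono add_mono mult_mono) (auto simp: norm_nonneg intro: order_trans[OF norm_nonneg])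
    also have "\<dots> = t (Suc (Suc n)) - t (Suc n)"
      by (subst (3) t(4), subst (5) t(4)) (simp add: power2_eq_square field_simps)
    finally show ?case .
  qed
  obtain l where l: "converges y l"
    by (rule converges_if_dominated[OF yc t(3) step])
  have lc [simp]: "l \<in> carrier A"
    using l by (simp add: converges_def)
  have "converges (\<lambda>n. y (Suc n)) (scl A (1/2) (x + mul A l l))"
    unfolding yS by (intro converges_scl converges_add converges_const converges_mul l) simp
  then have leq: "l = scl A (1/2) (x + mul A l l)"
    by (rule converges_unique[OF converges_Suc[OF l]])
  have "l + l = scl A 2 l"
    using vs.scale_left_distrib[of 1 1 l] by simp
  also have "\<dots> = x + mul A l l"
    by (subst leq) simp
  finally have l2: "l + l = x + mul A l l" .
  have sl: "star A l = l"
  proof (rule converges_unique[OF _ l])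
    show "converges y (star A l)"
      using converges_star[OF l] ysa by (simp add: selfadjoint_star)
  qed
  have com: "mul A z l = mul A l z" if z: "z \<in> carrier A" "mul A z x = mul A x z" for z
  proof (rule converges_unique)
    have zy: "mul A z (y n) = mul A (y n) z" for n
    proof (induction n)
      case (Suc n)
      have "mul A z (mul A (y n) (y n)) = mul A (mul A (y n) (y n)) z"
        using z Suc by (metis mul_assoc yc)
      then show ?case
        using z by (simp add: yS mul_distribs)
    qed (use z in \<open>simp add: y0\<close>)
    show "converges (\<lambda>n. mul A z (y n)) (mul A z l)"
      using z l by (intro converges_mul converges_const)
    show "converges (\<lambda>n. mul A z (y n)) (mul A l z)"
      unfolding zy using z l by (intro converges_mul converges_const)
  qed
  show ?thesis
  proof (rule that[of "unit - l"])
    have "x = l + l - mul A l l"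
      using l2 by simp
    then show "mul A (unit - l) (unit - l) = unit - x"
      by (simp add: mul_distribs)
    show "selfadjoint (unit - l)"
      using sl by (simp add: selfadjoint_def star_diff)
    show "nrm A (unit - (unit - l)) \<le> 1"
      using norm_limit_le[OF l order_trans[OF yn t(2)]] by simp
    show "mul A z (unit - l) = mul A (unit - l) z" if "z \<in> carrier A" "mul A z x = mul A x z" for z
      using that com[OF that] by (simp add: mul_distribs)
  qed
qed

text \<open>For commuting a and b, the element c = a + i b satisfies c^* c = a^2 + b^2 = s, so
  norm(c)^2 \<le> s by the C*-identity, and a is the real part of c.\<close>

lemma norm_le_if_squares_sum:
  assumes a: "selfadjoint a" and b: "selfadjoint b" and ab: "mul A a b = mul A b a"
    and eq: "mul A a a + mul A b b = scl A (of_real s) unit" and s: "0 \<le> s"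
  shows "(nrm A a)\<^sup>2 \<le> s"
proof -
  define c where "c = a + scl A \<i> b"
  have [simp]: "a \<in> carrier A" "b \<in> carrier A" "c \<in> carrier A"
    using a b by (auto simp: c_def)
  have sc: "star A c = a - scl A \<i> b"
    using a b by (simp add: c_def star_distribs selfadjoint_star)
  have "mul A (star A c) c = scl A (of_real s) unit"
    by (simp add: sc) (simp add: c_def mul_distribs ab eq vs.scale_right_diff_distrib vs.scale_right_distrib)
  then have "(nrm A c)\<^sup>2 = s * nrm A unit"
    using cstar_identity[of c] s by (simp add: norm_scl)
  then have c2: "(nrm A c)\<^sup>2 \<le> s"
    using norm_unit_le s by (simp add: mult_left_le)
  have "scl A 2 a = c + star A c"
    using vs.scale_left_distrib[of 1 1 a] by (simp add: sc) (simp add: c_def)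
  then have "2 * nrm A a \<le> 2 * nrm A c"
    using norm_triangle[of c "star A c"] norm_scl[of a 2] by simp
  then have "(nrm A a)\<^sup>2 \<le> (nrm A c)\<^sup>2"
    by (intro power_mono) (auto simp: norm_nonneg)
  with c2 show ?thesis by simp
qed

text \<open>\<open>sqrt_one_minus\<close> for x = 1 - a/s, rescaled by the square root of s.\<close>

lemma sqrt_near_scalar:
  assumes a: "selfadjoint a" and le: "nrm A (scl A (of_real s) unit - a) \<le> s" and s: "0 < s"
  obtains h where "selfadjoint h" "mul A h h = a"
    "nrm A (scl A (of_real (sqrt s)) unit - h) \<le> sqrt s"
    "\<And>z. z \<in> carrier A \<Longrightarrow> mul A z a = mul A a z \<Longrightarrow> mul A z h = mul A h z"
proof -
  define x where "x = scl A (of_real (1/s)) (scl A (of_real s) unit - a)"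
  have ac [simp]: "a \<in> carrier A" using a by simp
  have x: "selfadjoint x"
    unfolding x_def by (intro selfadjoint_scl selfadjoint_diff selfadjoint_unit a)
  have xeq: "x = unit - scl A (of_real (1/s)) a"
    using s by (simp add: x_def vs.scale_right_diff_distrib flip: of_real_mult)
  have "nrm A x \<le> 1"
    using le s unfolding x_def by (simp add: norm_scl norm_divide)
  then obtain h where h: "selfadjoint h" "mul A h h = unit - x" "nrm A (unit - h) \<le> 1"
    "\<And>z. z \<in> carrier A \<Longrightarrow> mul A z x = mul A x z \<Longrightarrow> mul A z h = mul A h z"
    using sqrt_one_minus[OF x] by blast
  let ?h = "scl A (of_real (sqrt s)) h"
  show ?thesis
  proof (rule that[of ?h])
    show "selfadjoint ?h"
      by (rule selfadjoint_scl[OF h(1)])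
    show "mul A ?h ?h = a"
      using h(1,2) s by (simp add: mul_distribs xeq flip: of_real_mult)
    have "scl A (of_real (sqrt s)) unit - ?h = scl A (of_real (sqrt s)) (unit - h)"
      by (simp add: vs.scale_right_diff_distrib)
    then show "nrm A (scl A (of_real (sqrt s)) unit - ?h) \<le> sqrt s"
      using h(1,3) s by (simp add: norm_scl mult_left_le)
    fix z assume z: "z \<in> carrier A" "mul A z a = mul A a z"
    then have "mul A z h = mul A h z"
      by (intro h) (auto simp: xeq mul_distribs)
    then show "mul A z ?h = mul A ?h z"
      using z h(1) by (simp add: mul_distribs)
  qed
qed

text \<open>Since norm(a^2) \<le> s, the element s - a^2 has a selfadjoint root h, which commutes
  with a. Then h^2 + a^2 = s forces norm(h)^2 \<le> s, and h^2 is the element to be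
  estimated.\<close>

lemma norm_scalar_minus_square_le:
  assumes a: "selfadjoint a" and le: "(nrm A a)\<^sup>2 \<le> s"
  shows "nrm A (scl A (of_real s) unit - mul A a a) \<le> s"
proof (cases "s = 0")
  case True
  then show ?thesis
    using le a norm_square[OF a] norm_minus[of "mul A a a"] by simp
next
  case False
  then have s: "0 < s"
    using le zero_le_power2[of "nrm A a"] by linarith
  have ac [simp]: "a \<in> carrier A" using a by simp
  have x: "selfadjoint (scl A (of_real s) unit - mul A a a)"
    using a by (simp add: selfadjoint_def star_distribs)
  have "nrm A (scl A (of_real s) unit - (scl A (of_real s) unit - mul A a a)) \<le> s"
    using le norm_square[OF a] by simp
  from sqrt_near_scalar[OF x this s] obtain h where h: "selfadjoint h"
    "mul A h h = scl A (of_real s) unit - mul A a a"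
    "\<And>z. z \<in> carrier A \<Longrightarrow> mul A z (scl A (of_real s) unit - mul A a a)
      = mul A (scl A (of_real s) unit - mul A a a) z \<Longrightarrow> mul A z h = mul A h z"
    by blast
  have "mul A a h = mul A h a"
    by (rule h(3)) (auto simp: mul_distribs mul_assoc)
  then have "(nrm A h)\<^sup>2 \<le> s"
    using a h(1,2) s by (intro norm_le_if_squares_sum[of h a]) auto
  then show ?thesis
    using norm_square[OF h(1)] h(2) by simp
qed

section \<open>The positive cone described by balls around scalars\<close>

lemma posI_near_scalar:
  assumes a: "selfadjoint a" and le: "nrm A (scl A (of_real s) unit - a) \<le> s"
  shows "pos a"
proof (cases "s = 0")
  case True
  then have "a = 0"
    using le a norm_nonneg[of a] norm_eq_0[of a] norm_minus[of a] by simp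
  then show ?thesis
    by (simp add: pos_zero)
next
  case False
  have "0 \<le> s"
    using a by (intro order_trans[OF norm_nonneg le]) simp
  with False have "0 < s" by simp
  with a le show ?thesis
    by (metis pos_def sqrt_near_scalar)
qed

lemma pos_near_scalar: "pos a \<Longrightarrow> nrm A a \<le> s \<Longrightarrow> nrm A (scl A (of_real s) unit - a) \<le> s"
  unfolding pos_def using norm_scalar_minus_square_le norm_square by auto

lemma pos_add:
  assumes "pos a" "pos b" shows "pos (a + b)"
proof (rule posI_near_scalar)
  show "selfadjoint (a + b)"
    using assms pos_selfadjoint selfadjoint_add by blast
  have "scl A (of_real (nrm A a + nrm A b)) unit - (a + b)
      = (scl A (of_real (nrm A a)) unit - a) + (scl A (of_real (nrm A b)) unit - b)"
    by (simp add: vs.scale_left_distrib)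
  also have "nrm A \<dots> \<le> nrm A a + nrm A b"
    using assms pos_near_scalar[of a "nrm A a"] pos_near_scalar[of b "nrm A b"]
    by (intro order_trans[OF norm_triangle]) auto
  finally show "nrm A (scl A (of_real (nrm A a + nrm A b)) unit - (a + b)) \<le> nrm A a + nrm A b" .
qed

lemma pos_sum: "(\<And>i. i \<in> I \<Longrightarrow> pos (f i)) \<Longrightarrow> pos (sum f I)"
  by (induction I rule: infinite_finite_induct) (auto simp: pos_zero pos_add)

lemma pos_scl: "pos a \<Longrightarrow> 0 \<le> s \<Longrightarrow> pos (scl A (of_real s) a)"
proof -
  assume "pos a" "0 \<le> s"
  then obtain h where h: "selfadjoint h" "a = mul A h h"
    by (auto simp: pos_def)
  have "scl A (of_real s) a = mul A (scl A (of_real (sqrt s)) h) (scl A (of_real (sqrt s)) h)"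
    using h \<open>0 \<le> s\<close> by (simp add: mul_distribs flip: of_real_mult)
  then show ?thesis
    using pos_square selfadjoint_scl h(1) by metis
qed

lemma pos_sqrt:
  assumes "pos a"
  obtains h where "pos h" "mul A h h = a"
    "\<And>z. z \<in> carrier A \<Longrightarrow> mul A z a = mul A a z \<Longrightarrow> mul A z h = mul A h z"
proof -
  have "nrm A (scl A (of_real (nrm A a + 1)) unit - a) \<le> nrm A a + 1"
    using assms by (intro pos_near_scalar) auto
  moreover have "0 < nrm A a + 1"
    using norm_nonneg[of a] assms by simp
  ultimately show ?thesis
    using assms pos_selfadjoint posI_near_scalar that sqrt_near_scalar by metis
qed

lemma pos_scalar_minus:
  assumes "selfadjoint a" "nrm A a \<le> s" shows "pos (scl A (of_real s) unit - a)"
  by (rule posI_near_scalar[where s = s])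
    (use assms in \<open>auto intro!: selfadjoint_diff selfadjoint_scl selfadjoint_unit\<close>)

text \<open>Roots h of a and k of s - a commute, since k commutes with everything that commutes with
  a; then h^2 + k^2 = s bounds norm(h)^2 = norm(a).\<close>

lemma norm_le_scalar:
  assumes a: "pos a" and b: "pos (scl A (of_real s) unit - a)" and s: "0 \<le> s"
  shows "nrm A a \<le> s"
proof -
  obtain h where h: "pos h" "mul A h h = a"
    "\<And>z. z \<in> carrier A \<Longrightarrow> mul A z a = mul A a z \<Longrightarrow> mul A z h = mul A h z"
    using pos_sqrt[OF a] by blast
  obtain k where k: "pos k" "mul A k k = scl A (of_real s) unit - a"
    "\<And>z. z \<in> carrier A \<Longrightarrow> mul A z (scl A (of_real s) unit - a) = mul A (scl A (of_real s) unit - a) z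
      \<Longrightarrow> mul A z k = mul A k z"
    using pos_sqrt[OF b] by blast
  have "mul A h a = mul A a h"
    using pos_closed[OF h(1)] by (simp add: mul_assoc flip: h(2))
  then have "mul A h k = mul A k h"
    using h(1) a by (intro k(3)) (auto simp: mul_distribs)
  then have "(nrm A h)\<^sup>2 \<le> s"
    using h(1,2) k(1,2) s by (intro norm_le_if_squares_sum[of h k]) (auto intro: pos_selfadjoint)
  then show ?thesis
    using norm_square[OF pos_selfadjoint[OF h(1)]] h(2) by simp
qed

text \<open>Reduces to a scalar bound: norm(b) - a is the sum of the positive elements norm(b) - b
  and b - a.\<close>

lemma norm_mono:
  assumes a: "pos a" and ab: "pos (b - a)" shows "nrm A a \<le> nrm A b"
proof -
  have b: "pos b"
    using pos_add[OF a ab] by simp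
  have "pos ((scl A (of_real (nrm A b)) unit - b) + (b - a))"
    using b ab pos_selfadjoint by (intro pos_add pos_scalar_minus) auto
  then show ?thesis
    using a b norm_nonneg by (intro norm_le_scalar) auto
qed

lemma pos_pointed: "pos a \<Longrightarrow> pos (- a) \<Longrightarrow> a = 0"
  using norm_mono[of a 0] norm_nonneg[of a] norm_eq_0[of a] by simp

lemma pos_add_eq_0: "pos a \<Longrightarrow> pos b \<Longrightarrow> a + b = 0 \<Longrightarrow> a = 0"
  using pos_pointed[of a] by (metis add_eq_0_iff)

lemma pos_sum_eq_0:
  assumes "finite I" "\<And>i. i \<in> I \<Longrightarrow> pos (f i)" "sum f I = 0" "i \<in> I"
  shows "f i = 0"
  using assms pos_add_eq_0[of "f i" "sum f (I - {i})"] pos_sum[of "I - {i}" f]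
  by (auto simp: sum.remove)

text \<open>Elements \<open>c* c\<close> and \<open>c c*\<close> have the same spectrum off 0; this lemma is what remains of that.\<close>

lemma norm_scalar_plus_swap:
  assumes c [simp]: "c \<in> carrier A" and s: "0 < s" "(nrm A c)\<^sup>2 \<le> s"
    and le: "nrm A (scl A (of_real s) unit + mul A (star A c) c) \<le> s"
  shows "nrm A (scl A (of_real s) unit + mul A c (star A c)) \<le> s"
proof -
  define w where "w = scl A (of_real s) unit + mul A (star A c) c"
  define v where "v = scl A (of_real s) unit + mul A c (star A c)"
  \<comment> \<open>With w = s + c^* c and v = s + c c^* one has v c = c w. Hence the power p n =
    v^n equals s^n + c q_n c^*, where q_n is the sum of s^(n-1-k) w^k over k < n. The hypothesis on
    w thus controls the powers of v.\<close>
  define p where "p n = (mul A v ^^ n) unit" for n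
  define q where "q = rec_nat 0 (\<lambda>n r. scl A (of_real (s ^ n)) unit + mul A w r)"
  have [simp]: "w \<in> carrier A" "v \<in> carrier A"
    by (auto simp: w_def v_def)
  have v: "selfadjoint v"
    by (simp add: v_def selfadjoint_def star_distribs)
  have p0: "p 0 = unit" and pS: "p (Suc n) = mul A v (p n)" for n
    by (auto simp: p_def)
  have q0: "q 0 = 0" and qS: "q (Suc n) = scl A (of_real (s ^ n)) unit + mul A w (q n)" for n
    by (auto simp: q_def)
  have pc [simp]: "p n \<in> carrier A" and qc [simp]: "q n \<in> carrier A" for n
    by (induction n) (auto simp: p0 pS q0 qS)
  have vc: "mul A v c = mul A c w"
    by (simp add: v_def w_def mul_distribs mul_assoc)
  have pq: "p n = scl A (of_real (s ^ n)) unit + mul A c (mul A (q n) (star A c))" for n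
  proof (induction n)
    case (Suc n)
    have "p (Suc n) = scl A (of_real (s ^ n)) v + mul A (mul A v c) (mul A (q n) (star A c))"
      by (simp add: pS Suc mul_distribs mul_assoc)
    also have "\<dots> = scl A (of_real (s ^ n)) v + mul A c (mul A (mul A w (q n)) (star A c))"
      by (simp add: vc mul_assoc)
    also have "\<dots> = scl A (of_real (s ^ Suc n)) unit + mul A c (mul A (q (Suc n)) (star A c))"
      by (simp add: qS mul_distribs) (simp add: v_def vs.scale_right_distrib mult.commute add_ac)
    finally show ?case .
  qed (simp add: p0 q0)
  \<comment> \<open>The expected bound n s^(n-1) for the norm of q_n, multiplied by s to avoid the
    predecessor of n.\<close>
  have nq: "s * nrm A (q n) \<le> n * s ^ n" for n
  proof (induction n)
    case (Suc n)
    have "nrm A (q (Suc n)) \<le> s ^ n * nrm A unit + nrm A w * nrm A (q n)"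
      unfolding qS using s norm_triangle[of "scl A (of_real (s ^ n)) unit" "mul A w (q n)"]
        norm_mul[of w "q n"] by (simp add: norm_scl norm_power)
    also have "\<dots> \<le> s ^ n + s * nrm A (q n)"
      using s le norm_unit_le unfolding w_def
      by (intro add_mono mult_right_mono) (auto simp: norm_nonneg mult_left_le)
    also have "\<dots> \<le> s ^ n + n * s ^ n"
      using Suc by simp
    finally have "s * nrm A (q (Suc n)) \<le> s * (s ^ n + n * s ^ n)"
      using s by (intro mult_left_mono) auto
    then show ?case by (simp add: algebra_simps)
  qed (simp add: q0)
  have np: "nrm A (p n) \<le> s ^ n * (1 + n)" for n
  proof -
    have "nrm A (p n) \<le> s ^ n * nrm A unit + nrm A c * (nrm A (q n) * nrm A c)"
      unfolding pq using s norm_triangle[of "scl A (of_real (s ^ n)) unit" "mul A c (mul A (q n) (star A c))"]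
        norm_mul[of c "mul A (q n) (star A c)"]
        mult_left_mono[OF norm_mul[of "q n" "star A c"] norm_nonneg[of c]]
      by (simp add: norm_scl norm_power)
    also have "\<dots> = s ^ n * nrm A unit + (nrm A c)\<^sup>2 * nrm A (q n)"
      by (simp add: power2_eq_square)
    also have "\<dots> \<le> s ^ n * 1 + s * nrm A (q n)"
      using s norm_unit_le by (intro add_mono mult_left_mono mult_right_mono) (auto simp: norm_nonneg)
    also have "\<dots> \<le> s ^ n * (1 + n)"
      using nq[of n] by (simp add: algebra_simps)
    finally show ?thesis .
  qed
  have padd: "p (m + n) = mul A (p m) (p n)" for m n
    by (induction m) (simp_all add: p0 pS mul_assoc)
  have pv: "mul A (p n) v = mul A v (p n)" for n
    by (induction n) (simp_all add: p0 pS mul_assoc)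
  have psa: "selfadjoint (p n)" for n
    by (induction n) (use v in \<open>auto simp: p0 pS pv selfadjoint_def star_mul\<close>)
  have np2: "nrm A (p (2 ^ k)) = nrm A v ^ 2 ^ k" for k
  proof (induction k)
    case (Suc k)
    have "p (2 ^ Suc k) = mul A (p (2 ^ k)) (p (2 ^ k))"
      by (simp add: mult_2 padd)
    then show ?case
      using norm_square[OF psa] Suc by (simp add: power_mult power2_eq_square power_mult_distrib)
  qed (simp add: pS p0)
  \<comment> \<open>As v is selfadjoint, norm(v)^(2^k) is the norm of v^(2^k), and the linear factor
    1 + 2^k disappears under roots.\<close>
  have "nrm A v \<le> s"
    by (rule le_if_powers_of_two_le[OF s(1)]) (use np[of "2 ^ _"] in \<open>simp flip: np2\<close>)
  then show ?thesis
    by (simp add: v_def)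
qed

lemma star_mul_negative_imp_0:
  assumes c [simp]: "c \<in> carrier A" and neg: "pos (- mul A (star A c) c)"
  shows "c = 0"
proof (rule ccontr)
  assume "c \<noteq> 0"
  define s where "s = (nrm A c)\<^sup>2"
  have s: "0 < s"
    using \<open>c \<noteq> 0\<close> norm_eq_0[of c] by (simp add: s_def)
  have "nrm A (scl A (of_real s) unit - (- mul A (star A c) c)) \<le> s"
    by (rule pos_near_scalar[OF neg]) (simp add: norm_minus cstar_identity s_def)
  then have "nrm A (scl A (of_real s) unit - (- mul A c (star A c))) \<le> s"
    using norm_scalar_plus_swap[of c s] s by (simp add: s_def)
  then have neg': "pos (- mul A c (star A c))"
    by (rule posI_near_scalar[rotated]) (simp add: selfadjoint_def star_distribs)
  define x where "x = c + star A c"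
  define y where "y = scl A \<i> (c - star A c)"
  have "selfadjoint x" "selfadjoint y"
    by (auto simp: x_def y_def selfadjoint_def star_distribs vs.scale_right_diff_distrib)
  then have "pos (mul A x x + mul A y y)"
    by (intro pos_add pos_square)
  also have "mul A x x + mul A y y
      = (mul A c (star A c) + mul A (star A c) c) + (mul A c (star A c) + mul A (star A c) c)"
    by (simp add: x_def y_def mul_distribs vs.scale_right_diff_distrib)
  finally have "pos \<dots>" .
  moreover have "pos (- \<dots>)"
    using pos_add[OF pos_add[OF neg neg'] pos_add[OF neg neg']] by (simp add: algebra_simps)
  ultimately have "(mul A c (star A c) + mul A (star A c) c) + (mul A c (star A c) + mul A (star A c) c) = 0"
    by (rule pos_pointed)
  then have "scl A 2 (mul A c (star A c) + mul A (star A c) c) = 0"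
    using vs.scale_left_distrib[of 1 1 "mul A c (star A c) + mul A (star A c) c"] by simp
  then have "mul A (star A c) c = - mul A c (star A c)"
    by (simp add: eq_neg_iff_add_eq_0 add.commute)
  then have "mul A (star A c) c = 0"
    using neg neg' pos_pointed by metis
  then show False
    using cstar_identity[of c] s by (simp add: s_def)
qed

text \<open>Put a = b^* b, let m be the positive root of a^2 and n = m - a, twice the negative part
  of a. Then a n = -m n, so (b n)^* (b n) = n a n is minus a square and b n = 0. Hence m n^2 = 0,
  and n^2 = 2 m n gives n^3 = 0 and n = 0, so a = m.\<close>

theorem pos_star_mul:
  assumes b [simp]: "b \<in> carrier A" shows "pos (mul A (star A b) b)"
proof -
  define a where "a = mul A (star A b) b"
  have a: "selfadjoint a"
    by (simp add: a_def selfadjoint_def star_distribs)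
  have [simp]: "a \<in> carrier A" using a by simp
  obtain m where m: "pos m" "mul A m m = mul A a a"
    "\<And>z. z \<in> carrier A \<Longrightarrow> mul A z (mul A a a) = mul A (mul A a a) z \<Longrightarrow> mul A z m = mul A m z"
    using pos_sqrt[OF pos_square[OF a]] by blast
  have [simp]: "m \<in> carrier A" using m(1) by simp
  have am: "mul A a m = mul A m a"
    by (rule m) (auto simp: mul_assoc)
  \<comment> \<open>A root of m exhibits m n^2 as the square of the selfadjoint element r n.\<close>
  obtain r where r: "pos r" "mul A r r = m"
    "\<And>z. z \<in> carrier A \<Longrightarrow> mul A z m = mul A m z \<Longrightarrow> mul A z r = mul A r z"
    using pos_sqrt[OF m(1)] by blast
  have [simp]: "r \<in> carrier A" using r(1) by simp
  define n where "n = m - a"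
  have n: "selfadjoint n"
    using m(1) a by (simp add: n_def selfadjoint_diff pos_selfadjoint)
  have [simp]: "n \<in> carrier A" using n by simp
  have nm: "mul A n m = mul A m n"
    by (simp add: n_def mul_distribs am)
  have nr: "mul A n r = mul A r n"
    by (rule r) (auto simp: nm)
  have an: "mul A a n = - mul A m n"
    by (simp add: n_def mul_distribs am m(2))
  have nn: "mul A n n = mul A m n + mul A m n"
    by (simp add: n_def mul_distribs am m(2))
  have rn: "mul A (mul A r n) (mul A r n) = mul A (mul A m n) n"
    by (metis (no_types, lifting) \<open>n \<in> carrier A\<close> \<open>r \<in> carrier A\<close> mul_assoc mul_closed nr r(2))
  have "mul A (star A (mul A b n)) (mul A b n) = mul A n (mul A a n)"
    using n by (simp add: star_mul mul_assoc a_def selfadjoint_star)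
  also have "\<dots> = - mul A (mul A r n) (mul A r n)"
    by (simp add: an mul_distribs rn) (simp add: nm flip: mul_assoc)
  finally have eq: "mul A (star A (mul A b n)) (mul A b n) = - mul A (mul A r n) (mul A r n)" .
  have "selfadjoint (mul A r n)"
    using n pos_selfadjoint[OF r(1)] nr by (simp add: selfadjoint_def star_mul)
  then have "pos (mul A (mul A r n) (mul A r n))"
    by (rule pos_square)
  with eq have "mul A b n = 0"
    by (intro star_mul_negative_imp_0) auto
  with eq have "mul A (mul A m n) n = 0"
    by (simp add: rn)
  then have "mul A (mul A n n) n = 0"
    by (subst nn) (simp add: mul_distribs)
  then have "mul A (mul A n n) (mul A n n) = 0"
    by (simp flip: mul_assoc)
  then have "nrm A n = 0"
    using norm_square[of "mul A n n"] norm_square[OF n] n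
    by (simp add: selfadjoint_def star_mul)
  then have "n = 0"
    using norm_eq_0 by simp
  then show ?thesis
    using m(1) by (simp add: n_def a_def)
qed

lemma positive_in_iff_pos: "positive_in A a \<longleftrightarrow> pos a"
proof
  assume "pos a"
  then obtain h where "selfadjoint h" "a = mul A h h"
    by (auto simp: pos_def)
  then show "positive_in A a"
    unfolding positive_in_def by (intro bexI[of _ h]) (auto simp: selfadjoint_star)
qed (auto simp: positive_in_def pos_star_mul)

section \<open>Conjugation and inverse square roots\<close>

lemma pos_conjugate: "pos p \<Longrightarrow> a \<in> carrier A \<Longrightarrow> pos (mul A (mul A (star A a) p) a)"
proof -
  assume p: "pos p" and a: "a \<in> carrier A"
  then obtain h where h: "selfadjoint h" "p = mul A h h"
    by (auto simp: pos_def)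
  have "mul A (mul A (star A a) p) a = mul A (star A (mul A h a)) (mul A h a)"
    using h a by (simp add: star_mul selfadjoint_star mul_assoc)
  then show ?thesis
    using pos_star_mul[of "mul A h a"] h a by simp
qed

text \<open>The iterates are the partial sums of 1 + x + x^2 + ..., with increments bounded by the
  powers of norm(x). They commute with whatever commutes with x, which passes to the limit and makes
  the inverse two-sided and selfadjoint.\<close>

lemma neumann_series:
  assumes x: "selfadjoint x" and lt: "nrm A x < 1"
  obtains y where "selfadjoint y" "mul A y (unit - x) = unit"
    "\<And>z. z \<in> carrier A \<Longrightarrow> mul A z x = mul A x z \<Longrightarrow> mul A z y = mul A y z"
proof -
  define y where "y = rec_nat 0 (\<lambda>_ r. unit + mul A x r)"
  define t where "t n = (\<Sum>k<n. nrm A x ^ k)" for n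
  have y0: "y 0 = 0" and yS: "y (Suc n) = unit + mul A x (y n)" for n
    by (auto simp: y_def)
  have xc [simp]: "x \<in> carrier A" using x by simp
  have yc [simp]: "y n \<in> carrier A" for n
    by (induction n) (auto simp: y0 yS)
  have zy: "mul A z (y n) = mul A (y n) z"
    if z: "z \<in> carrier A" "mul A z x = mul A x z" for z n
  proof (induction n)
    case (Suc n)
    have "mul A z (mul A x (y n)) = mul A (mul A x (y n)) z"
      using z Suc by (metis mul_assoc yc xc)
    then show ?case
      using z by (simp add: yS mul_distribs)
  qed (use z in \<open>simp add: y0\<close>)
  have ysa: "star A (y n) = y n" for n
  proof (induction n)
    case (Suc n)
    then show ?case
      using x zy[of x n] by (simp add: yS star_distribs selfadjoint_star)
  qed (simp add: y0)
  have step: "nrm A (y (Suc n) - y n) \<le> t (Suc n) - t n" for n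
  proof (induction n)
    case (Suc n)
    have "y (Suc (Suc n)) - y (Suc n) = mul A x (y (Suc n) - y n)"
      unfolding yS[of "Suc n"] by (subst (2) yS) (simp add: mul_distribs)
    also have "nrm A \<dots> \<le> nrm A x * (t (Suc n) - t n)"
      using Suc by (intro order_trans[OF norm_mul] mult_left_mono) (auto simp: norm_nonneg)
    finally show ?case
      by (simp add: t_def)
  qed (simp add: y0 yS t_def norm_unit_le)
  have "summable (\<lambda>k. nrm A x ^ k)"
    using lt norm_nonneg[of x] by (intro summable_geometric) simp
  then have "convergent t"
    unfolding t_def summable_iff_convergent .
  then obtain l where l: "converges y l"
    using converges_if_dominated[where x = y and t = t, OF yc _ step] by blast
  have lc [simp]: "l \<in> carrier A"
    using l by (simp add: converges_def)
  have "converges (\<lambda>n. y (Suc n)) (unit + mul A x l)"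
    unfolding yS by (intro converges_add converges_const converges_mul l) auto
  then have leq: "l = unit + mul A x l"
    by (rule converges_unique[OF converges_Suc[OF l]])
  have com: "mul A z l = mul A l z" if z: "z \<in> carrier A" "mul A z x = mul A x z" for z
  proof (rule converges_unique)
    show "converges (\<lambda>n. mul A z (y n)) (mul A z l)"
      using z l by (intro converges_mul converges_const)
    show "converges (\<lambda>n. mul A z (y n)) (mul A l z)"
      unfolding zy[OF z] using z l by (intro converges_mul converges_const)
  qed
  have "star A l = l"
    using converges_unique[OF converges_star[OF l]] l by (simp add: ysa)
  moreover have "mul A l (unit - x) = l - mul A x l"
    using com[of x] by (simp add: mul_distribs)
  then have "mul A l (unit - x) = unit"
    using leq by (metis add_diff_cancel_right')
  ultimately show ?thesis
    using com by (intro that[of l]) (auto simp: selfadjoint_def)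
qed

text \<open>From 1 \<le> h \<le> s follows 0 \<le> s - h \<le> s - 1, so h/s = 1 - x with norm(x)
  \<le> (s - 1)/s < 1 and h has an inverse g. With a root r of h, the element k = g r is the inverse
  square root.\<close>

lemma inverse_sqrt:
  assumes h: "pos (h - unit)"
  obtains k where "selfadjoint k" "mul A (mul A k h) k = unit"
proof -
  have hp: "pos h"
    using pos_add[OF h pos_square[OF selfadjoint_unit]] by simp
  have hc [simp]: "h \<in> carrier A" using hp by simp
  \<comment> \<open>The maximum guards against the zero algebra, where h has norm 0; otherwise h
    \<ge> 1 already has norm at least 1.\<close>
  define s where "s = max 1 (nrm A h)"
  have s: "1 \<le> s" "nrm A h \<le> s"
    by (auto simp: s_def)
  have "pos (scl A (of_real s) unit - h)"
    using pos_scalar_minus[OF pos_selfadjoint[OF hp] s(2)] .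
  moreover have eq: "scl A (of_real (s - 1)) unit - (scl A (of_real s) unit - h) = h - unit"
    by (simp add: vs.scale_left_diff_distrib)
  have "pos (scl A (of_real (s - 1)) unit - (scl A (of_real s) unit - h))"
    unfolding eq by (rule h)
  ultimately have le: "nrm A (scl A (of_real s) unit - h) \<le> s - 1"
    using s by (intro norm_le_scalar) auto
  define x where "x = scl A (of_real (1/s)) (scl A (of_real s) unit - h)"
  have x: "selfadjoint x"
    unfolding x_def using hp
    by (intro selfadjoint_scl selfadjoint_diff selfadjoint_unit pos_selfadjoint)
  have xeq: "x = unit - scl A (of_real (1/s)) h"
    using s by (simp add: x_def vs.scale_right_diff_distrib flip: of_real_mult)
  have "nrm A x \<le> (s - 1) / s"
    using le s unfolding x_def by (simp add: norm_scl norm_divide divide_right_mono)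
  also have "\<dots> < 1"
    using s by simp
  finally obtain y where y: "selfadjoint y" "mul A y (unit - x) = unit"
    "\<And>z. z \<in> carrier A \<Longrightarrow> mul A z x = mul A x z \<Longrightarrow> mul A z y = mul A y z"
    using neumann_series[OF x] by blast
  have yc [simp]: "y \<in> carrier A" using y(1) by simp
  define g where "g = scl A (of_real (1/s)) y"
  have gc [simp]: "g \<in> carrier A" by (simp add: g_def)
  have gh: "mul A g h = unit"
    using y(2) by (simp add: xeq g_def mul_distribs)
  have com: "mul A z g = mul A g z" if "z \<in> carrier A" "mul A z h = mul A h z" for z
    using that y(3)[of z] by (simp add: g_def xeq mul_distribs)
  obtain r where r: "pos r" "mul A r r = h"
    using pos_sqrt[OF hp] by blast
  have rc [simp]: "r \<in> carrier A" using r(1) by simp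
  have rg: "mul A r g = mul A g r"
    by (rule com) (auto simp: mul_assoc simp flip: r(2))
  have "selfadjoint (mul A g r)"
    using y(1) pos_selfadjoint[OF r(1)] rg
    by (auto simp: selfadjoint_def star_distribs g_def)
  moreover have "mul A (mul A (mul A g r) h) (mul A g r) = unit"
  proof -
    have "mul A (mul A g r) h = mul A (mul A g h) r"
      by (simp add: mul_assoc flip: r(2))
    then have "mul A (mul A (mul A g r) h) (mul A g r) = mul A r (mul A r g)"
      by (simp add: gh rg)
    also have "\<dots> = mul A h g"
      by (simp add: r(2) flip: mul_assoc)
    finally show ?thesis
      using com[of h] gh by simp
  qed
  ultimately show ?thesis
    by (rule that)
qed

end

section \<open>The C*-norm defined by a conditional expectation\<close>

text \<open>To be used with \<open>S\<close> the sections, still without a norm, \<open>E\<close>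
  evaluation at the unit of the group and \<iota> the inclusion of the unit fibre. The form E(x^* y)
  makes \<open>S\<close> a right pre-Hilbert module over \<open>A\<close>, on which \<open>S\<close>
  acts from the left.\<close>

locale expectation =
  S: unital_star_algebra S e + A: unital_cstar_algebra A u
  for S :: "('s::ab_group_add, 'm) cstar_scheme" and e :: 's
    and A :: "('a::ab_group_add, 'n) cstar_scheme" and u :: 'a +
  fixes E :: "'s \<Rightarrow> 'a" and \<iota> :: "'a \<Rightarrow> 's"
  assumes E_linear: "linear_map S A E"
    and E_star: "x \<in> carrier S \<Longrightarrow> E (star S x) = star A (E x)"
    and E_unit: "E e = u"
    and E_mul: "x \<in> carrier S \<Longrightarrow> a \<in> carrier A \<Longrightarrow> E (mul S x (\<iota> a)) = mul A (E x) a"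
    and \<iota>_closed: "a \<in> carrier A \<Longrightarrow> \<iota> a \<in> carrier S"
    and \<iota>_star: "a \<in> carrier A \<Longrightarrow> \<iota> (star A a) = star S (\<iota> a)"
    and E_pos: "x \<in> carrier S \<Longrightarrow> A.pos (E (mul S (star S x) x))"
    and E_definite: "x \<in> carrier S \<Longrightarrow> E (mul S (star S x) x) = 0 \<Longrightarrow> x = 0"
begin

section \<open>The pre-Hilbert module of an expectation\<close>

definition ip :: "'s \<Rightarrow> 's \<Rightarrow> 'a"
  where "ip x y = E (mul S (star S x) y)"

definition norm2 :: "'s \<Rightarrow> real"
  where "norm2 x = sqrt (nrm A (ip x x))"

lemma E_closed [simp]: "x \<in> carrier S \<Longrightarrow> E x \<in> carrier A"
  using E_linear by (auto simp: semilinear_map_def)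

lemma E_add: "x \<in> carrier S \<Longrightarrow> y \<in> carrier S \<Longrightarrow> E (x + y) = E x + E y"
  using E_linear by (auto simp: semilinear_map_def)

lemma E_scl: "x \<in> carrier S \<Longrightarrow> E (scl S c x) = scl A c (E x)"
  using E_linear by (auto simp: semilinear_map_def)

lemma ip_closed [simp]: "x \<in> carrier S \<Longrightarrow> y \<in> carrier S \<Longrightarrow> ip x y \<in> carrier A"
  by (simp add: ip_def)

lemma ip_add_left: "x \<in> carrier S \<Longrightarrow> y \<in> carrier S \<Longrightarrow> z \<in> carrier S
    \<Longrightarrow> ip (x + y) z = ip x z + ip y z"
  by (simp add: ip_def E_add S.star_add S.mul_add_left)

lemma ip_add_right: "x \<in> carrier S \<Longrightarrow> y \<in> carrier S \<Longrightarrow> z \<in> carrier S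
    \<Longrightarrow> ip z (x + y) = ip z x + ip z y"
  by (simp add: ip_def E_add S.mul_add_right)

lemma ip_scl_left: "x \<in> carrier S \<Longrightarrow> y \<in> carrier S \<Longrightarrow> ip (scl S c x) y = scl A (cnj c) (ip x y)"
  by (simp add: ip_def E_scl S.star_scl S.mul_scl_left)

lemma ip_scl_right: "x \<in> carrier S \<Longrightarrow> y \<in> carrier S \<Longrightarrow> ip x (scl S c y) = scl A c (ip x y)"
  by (simp add: ip_def E_scl S.mul_scl_right)

lemma ip_minus_left: "x \<in> carrier S \<Longrightarrow> y \<in> carrier S \<Longrightarrow> ip (- x) y = - ip x y"
  using ip_scl_left[of x y "-1"] by simp

lemma ip_minus_right: "x \<in> carrier S \<Longrightarrow> y \<in> carrier S \<Longrightarrow> ip x (- y) = - ip x y"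
  using ip_scl_right[of x y "-1"] by simp

lemma ip_diff_left: "x \<in> carrier S \<Longrightarrow> y \<in> carrier S \<Longrightarrow> z \<in> carrier S
    \<Longrightarrow> ip (x - y) z = ip x z - ip y z"
  using ip_add_left[of x "- y" z] by (simp add: ip_minus_left)

lemma ip_diff_right: "x \<in> carrier S \<Longrightarrow> y \<in> carrier S \<Longrightarrow> z \<in> carrier S
    \<Longrightarrow> ip z (x - y) = ip z x - ip z y"
  using ip_add_right[of x "- y" z] by (simp add: ip_minus_right)

lemma ip_star: "x \<in> carrier S \<Longrightarrow> y \<in> carrier S \<Longrightarrow> star A (ip x y) = ip y x"
  unfolding ip_def by (subst E_star[symmetric]) (simp_all add: S.star_distribs)

lemma ip_module_right: "x \<in> carrier S \<Longrightarrow> y \<in> carrier S \<Longrightarrow> a \<in> carrier A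
    \<Longrightarrow> ip x (mul S y (\<iota> a)) = mul A (ip x y) a"
  by (simp add: ip_def E_mul \<iota>_closed flip: S.mul_assoc)

lemma ip_module_left: "x \<in> carrier S \<Longrightarrow> y \<in> carrier S \<Longrightarrow> a \<in> carrier A
    \<Longrightarrow> ip (mul S x (\<iota> a)) y = mul A (star A a) (ip x y)"
  using arg_cong[OF ip_module_right[of y x a], of "star A"]
  by (simp add: ip_star A.star_mul \<iota>_closed)

lemma ip_mul_left: "x \<in> carrier S \<Longrightarrow> y \<in> carrier S \<Longrightarrow> z \<in> carrier S
    \<Longrightarrow> ip (mul S x y) z = ip y (mul S (star S x) z)"
  by (simp add: ip_def S.star_mul S.mul_assoc)

lemma ip_pos: "x \<in> carrier S \<Longrightarrow> A.pos (ip x x)"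
  unfolding ip_def by (rule E_pos)

lemma norm2_nonneg: "x \<in> carrier S \<Longrightarrow> 0 \<le> norm2 x"
  by (simp add: norm2_def A.norm_nonneg)

lemma norm2_square: "x \<in> carrier S \<Longrightarrow> (norm2 x)\<^sup>2 = nrm A (ip x x)"
  by (simp add: norm2_def A.norm_nonneg)

lemma norm2_eq_0: "x \<in> carrier S \<Longrightarrow> norm2 x = 0 \<longleftrightarrow> x = 0"
  using E_definite[of x] A.norm_eq_0[of "ip x x"]
  by (auto simp: norm2_def ip_def) (metis E_closed A.norm_zero S.zero_closed S.vs.scale_zero_left E_scl A.vs.scale_zero_left)

lemma norm2_scl: "x \<in> carrier S \<Longrightarrow> norm2 (scl S c x) = cmod c * norm2 x"
  by (simp add: norm2_def ip_scl_left ip_scl_right A.norm_scl real_sqrt_mult norm_mult flip: mult.assoc)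

text \<open>Cauchy-Schwarz for Hilbert modules: expand \<open>ip z z\<close> \<ge> 0 for z = x a - y
  and replace \<open>ip x x\<close> by its norm s in the term a^* \<open>ip x x\<close> a, which
  only enlarges it. The outcome is c^* c / s \<le> \<open>ip y y\<close> for c =
  \<open>ip x y\<close>.\<close>

lemma norm_ip_le:
  assumes x [simp]: "x \<in> carrier S" and y [simp]: "y \<in> carrier S"
  shows "nrm A (ip x y) \<le> norm2 x * norm2 y"
proof (cases "x = 0")
  case True
  then show ?thesis
    using ip_scl_left[of 0 y 0] norm2_eq_0[of 0] by simp
next
  case False
  define s where "s = nrm A (ip x x)"
  define c where "c = ip x y"
  \<comment> \<open>The usual minimiser, with the number s in place of \<open>ip x x\<close>, which
    need not be invertible.\<close>
  define a where "a = scl A (of_real (1/s)) c"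
  define z where "z = mul S x (\<iota> a) - y"
  have s: "0 < s"
    using False norm2_eq_0[of x] norm2_square[of x] by (simp add: s_def flip: norm2_square)
  have c [simp]: "c \<in> carrier A" and a [simp]: "a \<in> carrier A"
    by (simp_all add: c_def a_def)
  have yx: "ip y x = star A c"
    by (simp add: c_def ip_star)
  let ?cc = "scl A (of_real (1/s)) (mul A (star A c) c)"
  have "ip z z = mul A (mul A (star A a) (ip x x)) a - ?cc - ?cc + ip y y"
    by (simp add: z_def \<iota>_closed ip_diff_left ip_diff_right ip_module_left ip_module_right yx
        flip: c_def) (simp add: a_def A.star_distribs A.mul_distribs A.mul_assoc
          A.vs.scale_right_diff_distrib)
  moreover have "mul A (mul A (star A a) (scl A (of_real s) u - ip x x)) a
      = ?cc - mul A (mul A (star A a) (ip x x)) a"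
    using s by (simp add: a_def A.star_distribs A.mul_distribs A.vs.scale_right_diff_distrib
      flip: of_real_mult of_real_divide)
  ultimately have "ip y y - ?cc
      = ip z z + mul A (mul A (star A a) (scl A (of_real s) u - ip x x)) a"
    by simp
  moreover have "A.pos (scl A (of_real s) u - ip x x)"
    using ip_pos[OF x] by (intro A.pos_scalar_minus A.pos_selfadjoint) (simp_all add: s_def)
  then have "A.pos (ip z z + mul A (mul A (star A a) (scl A (of_real s) u - ip x x)) a)"
    by (intro A.pos_add ip_pos A.pos_conjugate) (simp_all add: z_def \<iota>_closed)
  ultimately have "A.pos (ip y y - ?cc)"
    by (simp only:)
  moreover have "A.pos ?cc"
    using A.pos_scl[OF A.pos_star_mul[OF c], of "1/s"] s by simp
  ultimately have "nrm A ?cc \<le> nrm A (ip y y)"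
    by (rule A.norm_mono[rotated])
  then have "(nrm A c)\<^sup>2 \<le> s * nrm A (ip y y)"
    using s by (simp add: A.norm_scl A.cstar_identity norm_divide field_simps)
  also have "\<dots> = (norm2 x * norm2 y)\<^sup>2"
    by (simp add: s_def power_mult_distrib norm2_square)
  finally show ?thesis
    unfolding c_def by (rule power2_le_imp_le) (simp add: norm2_nonneg)
qed

lemma norm2_triangle:
  assumes [simp]: "x \<in> carrier S" "y \<in> carrier S" shows "norm2 (x + y) \<le> norm2 x + norm2 y"
proof (rule power2_le_imp_le)
  have "nrm A (ip x y) \<le> norm2 x * norm2 y" "nrm A (ip y x) \<le> norm2 x * norm2 y"
    using norm_ip_le[of x y] norm_ip_le[of y x] by (simp_all add: mult.commute)
  moreover have "nrm A ((ip x x + ip x y) + (ip y x + ip y y))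
      \<le> (nrm A (ip x x) + nrm A (ip x y)) + (nrm A (ip y x) + nrm A (ip y y))"
    by (intro order_trans[OF A.norm_triangle] add_mono A.norm_triangle) auto
  ultimately show "(norm2 (x + y))\<^sup>2 \<le> (norm2 x + norm2 y)\<^sup>2"
    by (simp add: norm2_square power2_sum ip_add_left ip_add_right algebra_simps)
qed (simp add: norm2_nonneg)

lemma norm2_unit_le: "norm2 e \<le> 1"
  by (simp add: norm2_def ip_def E_unit A.norm_unit_le)

section \<open>The operator norm of left multiplication\<close>

definition op_norm :: "'s \<Rightarrow> real"
  where "op_norm x = Inf {K. 0 \<le> K \<and> (\<forall>y\<in>carrier S. norm2 (mul S x y) \<le> K * norm2 y)}"

lemma op_norm_le:
  assumes "0 \<le> K" "\<And>y. y \<in> carrier S \<Longrightarrow> norm2 (mul S x y) \<le> K * norm2 y"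
  shows "op_norm x \<le> K"
  unfolding op_norm_def using assms by (intro cInf_lower bdd_belowI[of _ 0]) auto

end

text \<open>Without a bound, \<open>op_norm\<close> would be an infimum over the empty set. For
  sections the bound will come from positivity of a^* a in the unit fibre.\<close>

locale bounded_expectation = expectation +
  assumes bounded: "x \<in> carrier S
    \<Longrightarrow> \<exists>K\<ge>0. \<forall>y\<in>carrier S. norm2 (mul S x y) \<le> K * norm2 y"
begin

lemma op_norm_nonneg: "x \<in> carrier S \<Longrightarrow> 0 \<le> op_norm x"
  unfolding op_norm_def using bounded[of x] by (intro cInf_greatest) auto

lemma norm2_mul_le:
  assumes x: "x \<in> carrier S" and y: "y \<in> carrier S"
  shows "norm2 (mul S x y) \<le> op_norm x * norm2 y"
proof (cases "y = 0")
  case True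
  then show ?thesis
    using x norm2_eq_0[of 0] by simp
next
  case False
  then have *: "0 < norm2 y"
    using y norm2_nonneg[of y] norm2_eq_0[of y] by simp
  have "norm2 (mul S x y) / norm2 y \<le> op_norm x"
    unfolding op_norm_def using bounded[OF x] y *
    by (intro cInf_greatest) (auto simp: divide_le_eq)
  with * show ?thesis
    by (simp add: divide_le_eq)
qed

lemma norm2_le_op_norm: "x \<in> carrier S \<Longrightarrow> norm2 x \<le> op_norm x"
  using norm2_mul_le[of x e] mult_left_le[OF norm2_unit_le op_norm_nonneg, of x] by simp

lemma op_norm_eq_0: "x \<in> carrier S \<Longrightarrow> op_norm x = 0 \<longleftrightarrow> x = 0"
proof
  show "x = 0" if "x \<in> carrier S" "op_norm x = 0"
    using that norm2_le_op_norm[of x] norm2_nonneg[of x] norm2_eq_0[of x] by simp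
  show "op_norm x = 0" if "x \<in> carrier S" "x = 0"
    using that op_norm_le[of 0 x] op_norm_nonneg[of x] norm2_eq_0[of 0] by simp
qed

lemma op_norm_triangle:
  assumes [simp]: "x \<in> carrier S" "y \<in> carrier S" shows "op_norm (x + y) \<le> op_norm x + op_norm y"
proof (rule op_norm_le)
  fix z assume [simp]: "z \<in> carrier S"
  have "norm2 (mul S x z + mul S y z) \<le> op_norm x * norm2 z + op_norm y * norm2 z"
    by (intro order_trans[OF norm2_triangle] add_mono norm2_mul_le) auto
  then show "norm2 (mul S (x + y) z) \<le> (op_norm x + op_norm y) * norm2 z"
    by (simp add: S.mul_add_left algebra_simps)
qed (simp add: op_norm_nonneg)

lemma op_norm_mul:
  assumes [simp]: "x \<in> carrier S" "y \<in> carrier S" shows "op_norm (mul S x y) \<le> op_norm x * op_norm y"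
proof (rule op_norm_le)
  fix z assume [simp]: "z \<in> carrier S"
  have "norm2 (mul S x (mul S y z)) \<le> op_norm x * (op_norm y * norm2 z)"
    by (intro order_trans[OF norm2_mul_le] mult_left_mono norm2_mul_le) (auto simp: op_norm_nonneg)
  then show "norm2 (mul S (mul S x y) z) \<le> op_norm x * op_norm y * norm2 z"
    by (simp add: S.mul_assoc)
qed (simp add: op_norm_nonneg)

lemma op_norm_scl_le: "x \<in> carrier S \<Longrightarrow> op_norm (scl S c x) \<le> cmod c * op_norm x"
  by (rule op_norm_le)
    (auto simp: op_norm_nonneg S.mul_scl_left norm2_scl mult.assoc intro!: mult_left_mono norm2_mul_le)

lemma op_norm_scl: "x \<in> carrier S \<Longrightarrow> op_norm (scl S c x) = cmod c * op_norm x"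
proof (cases "c = 0")
  case True
  then show "x \<in> carrier S \<Longrightarrow> ?thesis"
    using op_norm_eq_0[of 0] by simp
next
  case False
  assume x: "x \<in> carrier S"
  have "op_norm (scl S (1 / c) (scl S c x)) \<le> cmod (1 / c) * op_norm (scl S c x)"
    using x by (intro op_norm_scl_le) simp
  then have "cmod c * op_norm x \<le> op_norm (scl S c x)"
    using False by (simp add: norm_divide field_simps)
  with op_norm_scl_le[OF x] show ?thesis
    by (rule antisym)
qed

text \<open>Left multiplication by x^* is the adjoint of left multiplication by x, so the square of
  \<open>norm2\<close> of x y is the norm of \<open>ip y\<close> applied to x^* x y; Cauchy-Schwarz
  finishes.\<close>

lemma op_norm_square_le:
  assumes [simp]: "x \<in> carrier S" shows "(op_norm x)\<^sup>2 \<le> op_norm (mul S (star S x) x)"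
proof -
  let ?n = "op_norm (mul S (star S x) x)"
  have "op_norm x \<le> sqrt ?n"
  proof (rule op_norm_le)
    fix y assume [simp]: "y \<in> carrier S"
    have "(norm2 (mul S x y))\<^sup>2 = nrm A (ip y (mul S (mul S (star S x) x) y))"
      by (simp add: norm2_square ip_mul_left S.mul_assoc)
    also have "\<dots> \<le> norm2 y * (?n * norm2 y)"
      by (intro order_trans[OF norm_ip_le] mult_left_mono norm2_mul_le) (auto simp: norm2_nonneg)
    also have "\<dots> = (sqrt ?n * norm2 y)\<^sup>2"
      by (simp add: power_mult_distrib op_norm_nonneg) (simp add: power2_eq_square)
    finally show "norm2 (mul S x y) \<le> sqrt ?n * norm2 y"
      by (rule power2_le_imp_le) (simp add: norm2_nonneg op_norm_nonneg)
  qed (simp add: op_norm_nonneg)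
  then have "(op_norm x)\<^sup>2 \<le> (sqrt ?n)\<^sup>2"
    by (intro power_mono) (auto simp: op_norm_nonneg)
  then show ?thesis
    by (simp add: op_norm_nonneg)
qed

lemma op_norm_le_star: "x \<in> carrier S \<Longrightarrow> op_norm x \<le> op_norm (star S x)"
proof (cases "op_norm x = 0")
  case False
  assume x: "x \<in> carrier S"
  have "op_norm x * op_norm x \<le> op_norm (star S x) * op_norm x"
    using op_norm_square_le[OF x] op_norm_mul[of "star S x" x] x by (simp add: power2_eq_square)
  then show ?thesis
    using False op_norm_nonneg[OF x] by (simp add: mult_le_cancel_right)
qed (simp add: op_norm_nonneg)

lemma op_norm_cstar:
  assumes x: "x \<in> carrier S" shows "op_norm (mul S (star S x) x) = (op_norm x)\<^sup>2"
proof (rule antisym)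
  have "op_norm (star S x) \<le> op_norm x"
    using op_norm_le_star[of "star S x"] x by (simp add: S.star_star)
  then show "op_norm (mul S (star S x) x) \<le> (op_norm x)\<^sup>2"
    using op_norm_mul[of "star S x" x] x op_norm_nonneg[OF x]
    by (auto simp: power2_eq_square intro: order_trans mult_right_mono)
qed (rule op_norm_square_le[OF x])

end

section \<open>Sections of a family of Banach spaces\<close>

definition single :: "'g \<Rightarrow> 'v \<Rightarrow> 'g \<Rightarrow> 'v::zero"
  where "single t a = (\<lambda>_. 0)(t := a)"

lemma single_apply: "single t a s = (if s = t then a else 0)"
  by (simp add: single_def)

lemma single_same [simp]: "single t a t = a"
  by (simp add: single_def)

lemma single_zero [simp]: "single t 0 = 0"
  by (auto simp: single_def)

lemma single_add: "single t (a + b) = single t a + single t (b::'v::comm_monoid_add)"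
  by (auto simp: single_def)

lemma sum_fun_apply: "(\<Sum>i\<in>I. f i) x = (\<Sum>i\<in>I. f i x)"
  for f :: "'i \<Rightarrow> 'g \<Rightarrow> 'v::comm_monoid_add"
  by (induction I rule: infinite_finite_induct) auto

text \<open>Shared by both bundles and by the equivalence bundle: here only the Banach fibres
  matter.\<close>

locale section_space = group G
  for G :: "('g, 'k) monoid_scheme" (structure) +
  fixes F :: "('g, 'v::ab_group_add, 'm) banach_family_scheme"
  assumes finite_group: "finite (carrier G)"
    and banach: "t \<in> carrier G \<Longrightarrow> complex_banach (fibre F t)"
begin

lemma fibre_zero [simp]: "t \<in> carrier G \<Longrightarrow> 0 \<in> fset F t"
  using complex_space.zero_closed[OF complex_banach.axioms(1)[OF banach]] by (simp add: fibre_def)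

lemma fibre_add [simp]: "t \<in> carrier G \<Longrightarrow> a \<in> fset F t \<Longrightarrow> b \<in> fset F t \<Longrightarrow> a + b \<in> fset F t"
  using complex_space.add_closed[OF complex_banach.axioms(1)[OF banach]] by (simp add: fibre_def)

lemma fibre_scl [simp]: "t \<in> carrier G \<Longrightarrow> a \<in> fset F t \<Longrightarrow> fscl F c a \<in> fset F t"
  using complex_space.scl_closed[OF complex_banach.axioms(1)[OF banach]] by (simp add: fibre_def)

lemma fibre_sum: "t \<in> carrier G \<Longrightarrow> (\<And>i. i \<in> I \<Longrightarrow> f i \<in> fset F t) \<Longrightarrow> sum f I \<in> fset F t"
  using complex_space.sum_closed[OF complex_banach.axioms(1)[OF banach], of t I f]
  by (simp add: fibre_def)

sublocale fs: vector_space "fscl F"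
  using complex_space.vector_space[OF complex_banach.axioms(1)[OF banach[OF one_closed]]]
  by (simp add: fibre_def)

lemma section_apply: "f \<in> sections G F \<Longrightarrow> t \<in> carrier G \<Longrightarrow> f t \<in> fset F t"
  by (simp add: sections_def)

lemma section_off: "f \<in> sections G F \<Longrightarrow> t \<notin> carrier G \<Longrightarrow> f t = 0"
  by (simp add: sections_def)

lemma single_section [simp]: "t \<in> carrier G \<Longrightarrow> a \<in> fset F t \<Longrightarrow> single t a \<in> sections G F"
  by (auto simp: sections_def single_def)

lemma section_decompose:
  assumes "f \<in> sections G F" shows "f = (\<Sum>t\<in>carrier G. single t (f t))"
proof
  fix s
  show "f s = (\<Sum>t\<in>carrier G. single t (f t)) s"
    using assms finite_group by (simp add: sum_fun_apply single_apply section_off)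
qed

lemma sections_complex_space:
  assumes V: "carrier V = sections G F" "scl V = (\<lambda>c f t. fscl F c (f t))"
  shows "complex_space V"
proof (rule complex_space.intro)
  show vs: "vector_space (scl V)"
    unfolding V by unfold_locales
      (auto simp: fs.scale_left_distrib fs.scale_right_distrib)
  interpret vs: vector_space "scl V" by (rule vs)
  show "vs.subspace (carrier V)"
    unfolding vs.subspace_def unfolding V by (auto simp: sections_def)
qed

lemma section_sum: "(\<And>i. i \<in> I \<Longrightarrow> f i \<in> sections G F) \<Longrightarrow> sum f I \<in> sections G F"
  by (auto simp: sections_def sum_fun_apply fibre_sum)

lemma single_scl: "single t (fscl F c a) = (\<lambda>s. fscl F c (single t a s))"
  by (auto simp: single_def)

text \<open>Sections are finite sums of homogeneous ones, and 0 is homogeneous of degree e. Nested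
  use of this rule reduces an identity that is additive in each argument to its homogeneous case,
  which is an axiom of the bundles.\<close>

lemma section_induct [consumes 1, case_names single add]:
  assumes f: "f \<in> sections G F"
    and single: "\<And>t a. t \<in> carrier G \<Longrightarrow> a \<in> fset F t \<Longrightarrow> P (single t a)"
    and add: "\<And>f g. f \<in> sections G F \<Longrightarrow> g \<in> sections G F \<Longrightarrow> P f \<Longrightarrow> P g \<Longrightarrow> P (f + g)"
  shows "P f"
proof -
  have "finite T \<Longrightarrow> T \<subseteq> carrier G \<Longrightarrow> P (\<Sum>t\<in>T. single t (f t))" for T
  proof (induction rule: finite_induct)
    case empty
    have "P 0"
      using single[OF one_closed fibre_zero[OF one_closed]] by (simp only: single_zero)
    then show ?case
      by (simp only: sum.empty)
  next
    case (insert t T)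
    then have "(\<Sum>t\<in>T. single t (f t)) \<in> sections G F"
      using f by (intro section_sum single_section section_apply) auto
    moreover have "single t (f t) \<in> sections G F" "P (single t (f t))"
      using insert section_apply[OF f] by (auto intro: single)
    ultimately show ?case
      using insert.IH insert.prems
      by (subst sum.insert[OF insert.hyps(1,2)], intro add) auto
  qed
  from this[OF finite_group] show ?thesis
    using section_decompose[OF f] by simp
qed

lemma norm_le_sum_fibres:
  assumes V: "complex_normed V" "carrier V = sections G F"
    and single: "\<And>t a. t \<in> carrier G \<Longrightarrow> a \<in> fset F t \<Longrightarrow> nrm V (single t a) \<le> fnrm F t a"
    and f: "f \<in> sections G F"
  shows "nrm V f \<le> (\<Sum>t\<in>carrier G. fnrm F t (f t))"
proof -
  interpret V: complex_normed V by (rule V)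
  have "nrm V f \<le> (\<Sum>t\<in>carrier G. nrm V (single t (f t)))"
    using section_apply[OF f] by (subst section_decompose[OF f], intro V.norm_sum) (simp add: V)
  also have "\<dots> \<le> (\<Sum>t\<in>carrier G. fnrm F t (f t))"
    using section_apply[OF f] by (intro sum_mono single) auto
  finally show ?thesis .
qed

text \<open>The norm lies between each coordinate norm and the sum of all of them, so Cauchy
  sequences converge coordinatewise and, the group being finite, the coordinatewise limit is a limit
  in norm.\<close>

lemma sections_complete:
  assumes V: "complex_normed V" "carrier V = sections G F"
    and coord: "\<And>f t. f \<in> sections G F \<Longrightarrow> t \<in> carrier G \<Longrightarrow> fnrm F t (f t) \<le> nrm V f"
    and single: "\<And>t a. t \<in> carrier G \<Longrightarrow> a \<in> fset F t \<Longrightarrow> nrm V (single t a) \<le> fnrm F t a"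
  shows "complete_wrt (carrier V) (nrm V)"
proof -
  interpret V: complex_normed V by (rule V)
  show ?thesis
    unfolding V.complete_wrt_iff
  proof (intro allI impI)
    fix x :: "nat \<Rightarrow> 'g \<Rightarrow> 'v"
    assume x: "\<forall>n. x n \<in> carrier V"
      and cauchy: "\<forall>\<epsilon>>0. \<exists>N. \<forall>m\<ge>N. \<forall>n\<ge>N. nrm V (x m - x n) < \<epsilon>"
    have "\<exists>l\<in>fset F t. (\<lambda>n. fnrm F t (x n t - l)) \<longlonglongrightarrow> 0" if t: "t \<in> carrier G" for t
    proof -
      interpret B: complex_banach "fibre F t" by (rule banach[OF t])
      have "fnrm F t (x m t - x n t) \<le> nrm V (x m - x n)" for m n
        using coord[of "x m - x n" t] x t V.diff_closed[of "x m" "x n"] by (simp add: V)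
      then have "\<forall>\<epsilon>>0. \<exists>N. \<forall>m\<ge>N. \<forall>n\<ge>N. fnrm F t (x m t - x n t) < \<epsilon>"
        using cauchy by (meson order_le_less_trans)
      then show ?thesis
        using B.complete section_apply[of "x _" t] x t
        unfolding B.complete_wrt_iff by (simp add: fibre_def V)
    qed
    then obtain l where l: "\<And>t. t \<in> carrier G \<Longrightarrow> l t \<in> fset F t"
      "\<And>t. t \<in> carrier G \<Longrightarrow> (\<lambda>n. fnrm F t (x n t - l t)) \<longlonglongrightarrow> 0"
      by metis
    \<comment> \<open>The limits l are only chosen over the group, whereas a section has to vanish
      elsewhere.\<close>
    define L where "L = (\<lambda>t. if t \<in> carrier G then l t else 0)"
    have L: "L \<in> carrier V"
      using l by (auto simp: L_def V sections_def)
    have le: "nrm V (x n - L) \<le> (\<Sum>t\<in>carrier G. fnrm F t (x n t - l t))" for n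
    proof -
      have "x n - L \<in> sections G F"
        using x L V.diff_closed[of "x n" L] by (simp add: V)
      from norm_le_sum_fibres[OF V single this] show ?thesis
        by (simp add: L_def cong: sum.cong)
    qed
    have "(\<lambda>n. \<Sum>t\<in>carrier G. fnrm F t (x n t - l t)) \<longlonglongrightarrow> 0"
      by (intro tendsto_null_sum l)
    then have "(\<lambda>n. nrm V (x n - L)) \<longlonglongrightarrow> 0"
      by (rule tendsto_sandwich[OF _ _ tendsto_const, rotated 2])
        (use x L V.norm_nonneg le in auto)
    then show "\<exists>l\<in>carrier V. (\<lambda>n. nrm V (x n - l)) \<longlonglongrightarrow> 0"
      using L by blast
  qed
qed

text \<open>The space is an isometric copy of a complete fibre.\<close>

lemma complete_single_image:
  assumes V: "complex_normed V" "carrier V = single t ` fset F t" and t: "t \<in> carrier G"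
    and single: "\<And>a. a \<in> fset F t \<Longrightarrow> nrm V (single t a) = fnrm F t a"
  shows "complete_wrt (carrier V) (nrm V)"
proof -
  interpret V: complex_normed V by (rule V)
  interpret B: complex_banach "fibre F t" by (rule banach[OF t])
  have diff: "single t a - single t b = single t (a - b)" for a b :: 'v
    by (auto simp: single_def)
  have [simp]: "a - b \<in> fset F t" if "a \<in> fset F t" "b \<in> fset F t" for a b
    using B.diff_closed[of a b] that by (simp add: fibre_def)
  show ?thesis
    unfolding V.complete_wrt_iff
  proof (intro allI impI)
    fix x :: "nat \<Rightarrow> 'g \<Rightarrow> 'v"
    assume x: "\<forall>n. x n \<in> carrier V"
      and cauchy: "\<forall>\<epsilon>>0. \<exists>N. \<forall>m\<ge>N. \<forall>n\<ge>N. nrm V (x m - x n) < \<epsilon>"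
    from x have "\<forall>n. \<exists>a\<in>fset F t. x n = single t a"
      by (auto simp: V)
    then obtain a where a: "\<And>n. a n \<in> fset F t" "\<And>n. x n = single t (a n)"
      by metis
    have "\<forall>\<epsilon>>0. \<exists>N. \<forall>m\<ge>N. \<forall>n\<ge>N. fnrm F t (a m - a n) < \<epsilon>"
      using cauchy a by (simp add: diff single)
    then have "\<exists>l\<in>fset F t. (\<lambda>n. fnrm F t (a n - l)) \<longlonglongrightarrow> 0"
      using spec[OF B.complete[unfolded B.complete_wrt_iff], of a] a(1) by (simp add: fibre_def)
    then obtain l where l: "l \<in> fset F t" "(\<lambda>n. fnrm F t (a n - l)) \<longlonglongrightarrow> 0"
      by blast
    have "nrm V (x n - single t l) = fnrm F t (a n - l)" for n
      using single[of "a n - l"] a(1)[of n] l(1) by (simp only: a(2) diff) simp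
    then show "\<exists>l\<in>carrier V. (\<lambda>n. nrm V (x n - l)) \<longlonglongrightarrow> 0"
      using l by (intro bexI[of _ "single t l"]) (simp_all add: V)
  qed
qed

end

section \<open>Graded pairings of sections\<close>

text \<open>One formula for the product, both actions and both inner products; \<phi> gives the
  degree of a homogeneous result. Summing over both degrees, instead of solving for one of them,
  keeps the two arguments symmetric.\<close>

definition conv :: "('g, 'k) monoid_scheme \<Rightarrow> ('g \<Rightarrow> 'g \<Rightarrow> 'g)
    \<Rightarrow> ('g \<Rightarrow> 'g \<Rightarrow> 'u \<Rightarrow> 'v \<Rightarrow> 'w::ab_group_add) \<Rightarrow> ('g \<Rightarrow> 'u) \<Rightarrow> ('g \<Rightarrow> 'v) \<Rightarrow> 'g \<Rightarrow> 'w"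
  where "conv G \<phi> m f g =
    (\<Sum>t\<in>carrier G. \<Sum>s\<in>carrier G. single (\<phi> t s) (m t s (f t) (g s)))"

text \<open>Only biadditivity is demanded, because the axioms make the inner products linear in just
  one variable; scalars are treated separately for each argument.\<close>

locale graded_pairing =
  U: section_space G U + V: section_space G V + W: section_space G W
  for G :: "('g, 'k) monoid_scheme" (structure)
    and U :: "('g, 'u::ab_group_add, 'l) banach_family_scheme"
    and V :: "('g, 'v::ab_group_add, 'm) banach_family_scheme"
    and W :: "('g, 'w::ab_group_add, 'n) banach_family_scheme" +
  fixes \<phi> :: "'g \<Rightarrow> 'g \<Rightarrow> 'g" and m :: "'g \<Rightarrow> 'g \<Rightarrow> 'u \<Rightarrow> 'v \<Rightarrow> 'w"
  assumes degree: "t \<in> carrier G \<Longrightarrow> s \<in> carrier G \<Longrightarrow> \<phi> t s \<in> carrier G"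
    and pair_closed: "t \<in> carrier G \<Longrightarrow> s \<in> carrier G \<Longrightarrow> a \<in> fset U t \<Longrightarrow> b \<in> fset V s
      \<Longrightarrow> m t s a b \<in> fset W (\<phi> t s)"
    and pair_add_left: "t \<in> carrier G \<Longrightarrow> s \<in> carrier G \<Longrightarrow> a \<in> fset U t \<Longrightarrow> a' \<in> fset U t
      \<Longrightarrow> b \<in> fset V s \<Longrightarrow> m t s (a + a') b = m t s a b + m t s a' b"
    and pair_add_right: "t \<in> carrier G \<Longrightarrow> s \<in> carrier G \<Longrightarrow> a \<in> fset U t \<Longrightarrow> b \<in> fset V s
      \<Longrightarrow> b' \<in> fset V s \<Longrightarrow> m t s a (b + b') = m t s a b + m t s a b'"
begin

lemma pair_zero_left [simp]:
  "t \<in> carrier G \<Longrightarrow> s \<in> carrier G \<Longrightarrow> b \<in> fset V s \<Longrightarrow> m t s 0 b = 0"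
  using pair_add_left[of t s 0 0 b] by simp

lemma pair_zero_right [simp]:
  "t \<in> carrier G \<Longrightarrow> s \<in> carrier G \<Longrightarrow> a \<in> fset U t \<Longrightarrow> m t s a 0 = 0"
  using pair_add_right[of t s a 0 0] by simp

lemma conv_closed [simp]:
  "f \<in> sections G U \<Longrightarrow> g \<in> sections G V \<Longrightarrow> conv G \<phi> m f g \<in> sections G W"
  unfolding conv_def
  by (intro W.section_sum W.single_section degree pair_closed U.section_apply V.section_apply)

lemma conv_add_left:
  "f \<in> sections G U \<Longrightarrow> f' \<in> sections G U \<Longrightarrow> g \<in> sections G V
    \<Longrightarrow> conv G \<phi> m (f + f') g = conv G \<phi> m f g + conv G \<phi> m f' g"
  using U.section_apply[of f] U.section_apply[of f'] V.section_apply[of g]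
  by (simp add: conv_def pair_add_left single_add sum.distrib cong: sum.cong)

lemma conv_add_right:
  "f \<in> sections G U \<Longrightarrow> g \<in> sections G V \<Longrightarrow> g' \<in> sections G V
    \<Longrightarrow> conv G \<phi> m f (g + g') = conv G \<phi> m f g + conv G \<phi> m f g'"
  using U.section_apply[of f] V.section_apply[of g] V.section_apply[of g']
  by (simp add: conv_def pair_add_right single_add sum.distrib cong: sum.cong)

lemma conv_single:
  assumes t: "t \<in> carrier G" and s: "s \<in> carrier G" and a: "a \<in> fset U t" and b: "b \<in> fset V s"
  shows "conv G \<phi> m (single t a) (single s b) = single (\<phi> t s) (m t s a b)"
proof -
  have "(\<Sum>s'\<in>carrier G. single (\<phi> t' s') (m t' s' (single t a t') (single s b s')))
      = (if t' = t then single (\<phi> t s) (m t s a b) else 0)" if t': "t' \<in> carrier G" for t'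
  proof (cases "t' = t")
    case True
    have "(\<Sum>s'\<in>carrier G. single (\<phi> t s') (m t s' a (single s b s')))
        = (\<Sum>s'\<in>carrier G. if s' = s then single (\<phi> t s) (m t s a b) else 0)"
      using t a by (intro sum.cong) (auto simp: single_apply)
    then show ?thesis
      using True s U.finite_group by simp
  next
    case False
    then show ?thesis
      using t' b s by (simp add: single_apply)
  qed
  then show ?thesis
    using t U.finite_group by (simp add: conv_def)
qed

lemma conv_apply:
  "conv G \<phi> m f g r
    = (\<Sum>t\<in>carrier G. \<Sum>s\<in>carrier G. if r = \<phi> t s then m t s (f t) (g s) else 0)"
  by (simp add: conv_def sum_fun_apply single_apply)

lemma conv_scl_left:
  assumes "\<And>t s a b. t \<in> carrier G \<Longrightarrow> s \<in> carrier G \<Longrightarrow> a \<in> fset U t \<Longrightarrow> b \<in> fset V s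
      \<Longrightarrow> m t s (fscl U c a) b = fscl W d (m t s a b)"
    and "f \<in> sections G U" "g \<in> sections G V"
  shows "conv G \<phi> m (\<lambda>t. fscl U c (f t)) g = (\<lambda>r. fscl W d (conv G \<phi> m f g r))"
  using assms(1) U.section_apply[OF assms(2)] V.section_apply[OF assms(3)]
  by (intro ext) (auto simp: conv_apply W.fs.scale_sum_right intro!: sum.cong)

lemma conv_scl_right:
  assumes "\<And>t s a b. t \<in> carrier G \<Longrightarrow> s \<in> carrier G \<Longrightarrow> a \<in> fset U t \<Longrightarrow> b \<in> fset V s
      \<Longrightarrow> m t s a (fscl V c b) = fscl W d (m t s a b)"
    and "f \<in> sections G U" "g \<in> sections G V"
  shows "conv G \<phi> m f (\<lambda>t. fscl V c (g t)) = (\<lambda>r. fscl W d (conv G \<phi> m f g r))"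
  using assms(1) U.section_apply[OF assms(2)] V.section_apply[OF assms(3)]
  by (intro ext) (auto simp: conv_apply W.fs.scale_sum_right intro!: sum.cong)

end

section \<open>The C*-algebra of sections of a bundle\<close>

lemma (in cstar_algebra) cstar_subalgebra:
  assumes S: "vs.subspace S" "S \<subseteq> carrier A"
    and mul: "\<And>a b. a \<in> S \<Longrightarrow> b \<in> S \<Longrightarrow> mul A a b \<in> S"
    and star: "\<And>a. a \<in> S \<Longrightarrow> star A a \<in> S"
    and complete: "complete_wrt S (nrm A)"
  shows "cstar_algebra (A\<lparr>carrier := S\<rparr>)"
proof -
  have *: "x \<in> carrier A" if "x \<in> S" for x
    using S(2) that by blast
  show ?thesis
  proof (intro cstar_algebra.intro complex_banach.intro complex_space.intro
      complex_banach_axioms.intro cstar_algebra_axioms.intro)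
    show "vector_space (scl (A\<lparr>carrier := S\<rparr>))"
      using vector_space by simp
    show "module.subspace (scl (A\<lparr>carrier := S\<rparr>)) (carrier (A\<lparr>carrier := S\<rparr>))"
      using S by simp
    show "bilinear_map (A\<lparr>carrier := S\<rparr>) (A\<lparr>carrier := S\<rparr>) (A\<lparr>carrier := S\<rparr>) (mul (A\<lparr>carrier := S\<rparr>))"
      by (auto simp: bilinear_map_def semilinear_map_def mul mul_distribs *)
    show "conj_linear_map (A\<lparr>carrier := S\<rparr>) (A\<lparr>carrier := S\<rparr>) (star (A\<lparr>carrier := S\<rparr>))"
      by (auto simp: semilinear_map_def star star_distribs *)
  qed (simp_all add: * norm_nonneg norm_eq_0 norm_scl norm_triangle complete mul_assoc star_mul
      star_star norm_mul cstar_identity)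
qed

locale finite_cstar_bundle = cstar_bundle G \<A>
  for G :: "('g, 'k) monoid_scheme" (structure)
    and \<A> :: "('g, 'a::ab_group_add, 'm) fell_bundle_scheme" +
  assumes finite_carrier: "finite (carrier G)"
begin

sublocale section_space G \<A>
  by (intro section_space.intro section_space_axioms.intro is_group finite_carrier fibre_banach)

lemma bmul_closed: "t \<in> carrier G \<Longrightarrow> s \<in> carrier G \<Longrightarrow> a \<in> fset \<A> t \<Longrightarrow> b \<in> fset \<A> s
    \<Longrightarrow> bmul \<A> t s a b \<in> fset \<A> (t \<otimes> s)"
  using bmul_bilinear[of t s] by (auto simp: bilinear_map_def semilinear_map_def fibre_def)

sublocale prod: graded_pairing G \<A> \<A> \<A> "(\<otimes>)" "bmul \<A>"
proof
  fix t s a b assume ts: "t \<in> carrier G" "s \<in> carrier G"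
  note b = bmul_bilinear[OF ts, unfolded bilinear_map_def semilinear_map_def fibre_def, simplified]
  show "bmul \<A> t s a b \<in> fset \<A> (t \<otimes> s)" if "a \<in> fset \<A> t" "b \<in> fset \<A> s"
    using b that by blast
  show "bmul \<A> t s (a + a') b = bmul \<A> t s a b + bmul \<A> t s a' b"
    if "a \<in> fset \<A> t" "a' \<in> fset \<A> t" "b \<in> fset \<A> s" for a'
    using b that by blast
  show "bmul \<A> t s a (b + b') = bmul \<A> t s a b + bmul \<A> t s a b'"
    if "a \<in> fset \<A> t" "b \<in> fset \<A> s" "b' \<in> fset \<A> s" for b'
    using b that by blast
qed simp

lemma bmul_scl_left: "t \<in> carrier G \<Longrightarrow> s \<in> carrier G \<Longrightarrow> a \<in> fset \<A> t \<Longrightarrow> b \<in> fset \<A> s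
    \<Longrightarrow> bmul \<A> t s (fscl \<A> c a) b = fscl \<A> c (bmul \<A> t s a b)"
  using bmul_bilinear[of t s] by (auto simp: bilinear_map_def semilinear_map_def fibre_def)

lemma bmul_scl_right: "t \<in> carrier G \<Longrightarrow> s \<in> carrier G \<Longrightarrow> a \<in> fset \<A> t \<Longrightarrow> b \<in> fset \<A> s
    \<Longrightarrow> bmul \<A> t s a (fscl \<A> c b) = fscl \<A> c (bmul \<A> t s a b)"
  using bmul_bilinear[of t s] by (auto simp: bilinear_map_def semilinear_map_def fibre_def)

lemma bstar_closed [simp]: "t \<in> carrier G \<Longrightarrow> a \<in> fset \<A> t \<Longrightarrow> bstar \<A> t a \<in> fset \<A> (inv t)"
  using bstar_conj_linear[of t] by (auto simp: semilinear_map_def fibre_def)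

lemma bstar_add: "t \<in> carrier G \<Longrightarrow> a \<in> fset \<A> t \<Longrightarrow> b \<in> fset \<A> t
    \<Longrightarrow> bstar \<A> t (a + b) = bstar \<A> t a + bstar \<A> t b"
  using bstar_conj_linear[of t] by (auto simp: semilinear_map_def fibre_def)

lemma bstar_scl: "t \<in> carrier G \<Longrightarrow> a \<in> fset \<A> t
    \<Longrightarrow> bstar \<A> t (fscl \<A> c a) = fscl \<A> (cnj c) (bstar \<A> t a)"
  using bstar_conj_linear[of t] by (auto simp: semilinear_map_def fibre_def)

lemma bstar_zero: "t \<in> carrier G \<Longrightarrow> bstar \<A> t 0 = 0"
  using bstar_add[of t 0 0] by simp

text \<open>The norm stays a parameter so that the algebraic facts apply both while the C*-norm is
  being built and after it is chosen.\<close>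

abbreviation S :: "(('g \<Rightarrow> 'a) \<Rightarrow> real) \<Rightarrow> ('g \<Rightarrow> 'a) cstar"
  where "S \<equiv> section_star_algebra G \<A>"

lemma section_algebra_sel:
  "carrier (S n) = sections G \<A>" "scl (S n) = (\<lambda>c f t. fscl \<A> c (f t))" "nrm (S n) = n"
  "mul (S n) = conv G (\<otimes>) (bmul \<A>)"
  "star (S n) = (\<lambda>f t. if t \<in> carrier G then bstar \<A> (inv t) (f (inv t)) else 0)"
proof -
  \<comment> \<open>For given t and r the only possible s is the inverse of t times r, and it occurs
    in the sum exactly when r lies in the group.\<close>
  have *: "(\<Sum>s\<in>carrier G. if r = t \<otimes> s then bmul \<A> t s (f t) (g s) else 0)
      = (if r \<in> carrier G then bmul \<A> t (inv t \<otimes> r) (f t) (g (inv t \<otimes> r)) else 0)"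
    if t: "t \<in> carrier G" for r t f g
  proof -
    have "(\<Sum>s\<in>carrier G. if r = t \<otimes> s then bmul \<A> t s (f t) (g s) else 0)
      = (\<Sum>s\<in>carrier G. if s = inv t \<otimes> r \<and> r \<in> carrier G then bmul \<A> t s (f t) (g s) else 0)"
      using t by (intro sum.cong if_cong) (auto simp flip: m_assoc)
    then show ?thesis
      using t finite_group by auto
  qed
  have "conv G (\<otimes>) (bmul \<A>) f g r = mul (S n) f g r" for f g r
    using finite_group by (auto simp: prod.conv_apply * section_star_algebra_def cong: sum.cong)
  then show "mul (S n) = conv G (\<otimes>) (bmul \<A>)"
    by (metis ext)
qed (simp_all add: section_star_algebra_def)

lemma star_section_single: "t \<in> carrier G \<Longrightarrow> a \<in> fset \<A> t
    \<Longrightarrow> star (S n) (single t a) = single (inv t) (bstar \<A> t a)"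
  by (intro ext) (auto simp: section_algebra_sel single_apply bstar_zero)

lemma star_section_closed [simp]:
  assumes f: "f \<in> sections G \<A>" shows "star (S n) f \<in> sections G \<A>"
proof -
  have "bstar \<A> (inv t) (f (inv t)) \<in> fset \<A> t" if t: "t \<in> carrier G" for t
    using bstar_closed[OF inv_closed[OF t] section_apply[OF f inv_closed[OF t]]] t by simp
  then show ?thesis
    by (auto simp: section_algebra_sel sections_def)
qed

lemma star_section_add: "f \<in> sections G \<A> \<Longrightarrow> g \<in> sections G \<A>
    \<Longrightarrow> star (S n) (f + g) = star (S n) f + star (S n) g"
  using section_apply[of f] section_apply[of g] by (auto simp: section_algebra_sel bstar_add)

lemma star_algebra_sections: "star_algebra (S n)"
proof (rule star_algebra.intro)
  show "complex_space (S n)"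
    by (rule sections_complex_space) (simp_all add: section_algebra_sel)
  have scl_left: "conv G (\<otimes>) (bmul \<A>) (\<lambda>t. fscl \<A> c (f t)) g
      = (\<lambda>t. fscl \<A> c (conv G (\<otimes>) (bmul \<A>) f g t))"
    if "f \<in> sections G \<A>" "g \<in> sections G \<A>" for c f g
    using that by (intro prod.conv_scl_left bmul_scl_left)
  have scl_right: "conv G (\<otimes>) (bmul \<A>) f (\<lambda>t. fscl \<A> c (g t))
      = (\<lambda>t. fscl \<A> c (conv G (\<otimes>) (bmul \<A>) f g t))"
    if "f \<in> sections G \<A>" "g \<in> sections G \<A>" for c f g
    using that by (intro prod.conv_scl_right bmul_scl_right)
  have assoc: "conv G (\<otimes>) (bmul \<A>) (conv G (\<otimes>) (bmul \<A>) f g) h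
      = conv G (\<otimes>) (bmul \<A>) f (conv G (\<otimes>) (bmul \<A>) g h)"
    if f: "f \<in> sections G \<A>" and g: "g \<in> sections G \<A>" and h: "h \<in> sections G \<A>" for f g h
    using f
  proof (induction rule: section_induct)
    case (single t a)
    note a = this
    show ?case using g
    proof (induction rule: section_induct)
      case (single s b)
      note b = this
      show ?case using h
      proof (induction rule: section_induct)
        case (single r c)
        then show ?case
          using a b by (simp add: prod.conv_single bmul_closed bmul_assoc m_assoc)
      qed (use a b in \<open>simp del: plus_fun_apply add: prod.conv_add_right\<close>)
    qed (use a h in \<open>simp del: plus_fun_apply add: prod.conv_add_right prod.conv_add_left\<close>)
  qed (use g h in \<open>simp del: plus_fun_apply add: prod.conv_add_left\<close>)
  have star_mul: "star (S n) (conv G (\<otimes>) (bmul \<A>) f g)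
      = conv G (\<otimes>) (bmul \<A>) (star (S n) g) (star (S n) f)"
    if f: "f \<in> sections G \<A>" and g: "g \<in> sections G \<A>" for f g
    using f
  proof (induction rule: section_induct)
    case (single t a)
    note a = this
    show ?case using g
    proof (induction rule: section_induct)
      case (single s b)
      then show ?case
        using a by (simp add: prod.conv_single bmul_closed star_section_single bstar_bmul inv_mult_group)
    qed (use a in \<open>simp del: plus_fun_apply add: prod.conv_add_right prod.conv_add_left star_section_add\<close>)
  qed (use g in \<open>simp del: plus_fun_apply add: prod.conv_add_right prod.conv_add_left star_section_add\<close>)
  have star_star: "star (S n) (star (S n) f) = f" if f: "f \<in> sections G \<A>" for f
    using f
    by (induction rule: section_induct) (simp_all del: plus_fun_apply add: star_section_single bstar_bstar star_section_add)
  have star_scl: "star (S n) (\<lambda>t. fscl \<A> c (f t)) = (\<lambda>t. fscl \<A> (cnj c) (star (S n) f t))"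
    if "f \<in> sections G \<A>" for c f
    using section_apply[OF that] by (auto simp: section_algebra_sel bstar_scl)
  show "star_algebra_axioms (S n)"
    by (rule star_algebra_axioms.intro)
      (simp_all add: bilinear_map_def semilinear_map_def section_algebra_sel(1-4) prod.conv_add_left
        prod.conv_add_right scl_left scl_right assoc star_mul star_star star_scl star_section_add)
qed

section \<open>The unit fibre as a C*-algebra\<close>

lemma cstar_algebra_unit_fibre: "cstar_algebra (unit_fibre G \<A>)"
proof -
  interpret B: complex_banach "fibre \<A> \<one>"
    by (rule fibre_banach) simp
  have sel: "carrier (unit_fibre G \<A>) = carrier (fibre \<A> \<one>)"
    "scl (unit_fibre G \<A>) = scl (fibre \<A> \<one>)" "nrm (unit_fibre G \<A>) = nrm (fibre \<A> \<one>)"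
    by (simp_all add: unit_fibre_def fibre_def)
  show ?thesis
  proof (intro cstar_algebra.intro complex_banach.intro complex_space.intro
      complex_banach_axioms.intro cstar_algebra_axioms.intro)
    show "vector_space (scl (unit_fibre G \<A>))"
      unfolding sel by (rule B.vector_space)
    show "module.subspace (scl (unit_fibre G \<A>)) (carrier (unit_fibre G \<A>))"
      unfolding sel by (rule B.subspace)
    show "bilinear_map (unit_fibre G \<A>) (unit_fibre G \<A>) (unit_fibre G \<A>) (mul (unit_fibre G \<A>))"
      using bmul_bilinear[of \<one> \<one>]
      by (simp add: bilinear_map_def semilinear_map_def unit_fibre_def fibre_def)
    show "conj_linear_map (unit_fibre G \<A>) (unit_fibre G \<A>) (star (unit_fibre G \<A>))"
      using bstar_conj_linear[of \<one>]
      by (simp add: semilinear_map_def unit_fibre_def fibre_def)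
  next
    fix x y z assume x: "x \<in> carrier (unit_fibre G \<A>)"
    show "0 \<le> nrm (unit_fibre G \<A>) x"
      using x unfolding sel by (rule B.norm_nonneg)
    show "(nrm (unit_fibre G \<A>) x = 0) = (x = 0)"
      using x unfolding sel by (rule B.norm_eq_0)
    show "nrm (unit_fibre G \<A>) (scl (unit_fibre G \<A>) c x) = cmod c * nrm (unit_fibre G \<A>) x" for c
      using x unfolding sel by (rule B.norm_scl)
    show "star (unit_fibre G \<A>) (star (unit_fibre G \<A>) x) = x"
      using x bstar_bstar[of \<one> x] by (simp add: unit_fibre_def)
    show "nrm (unit_fibre G \<A>) (mul (unit_fibre G \<A>) (star (unit_fibre G \<A>) x) x)
        = (nrm (unit_fibre G \<A>) x)\<^sup>2"
      using x norm_bstar_bmul[of \<one> x] by (simp add: unit_fibre_def)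
    assume y: "y \<in> carrier (unit_fibre G \<A>)"
    show "nrm (unit_fibre G \<A>) (x + y) \<le> nrm (unit_fibre G \<A>) x + nrm (unit_fibre G \<A>) y"
      using x y unfolding sel by (rule B.norm_triangle)
    show "star (unit_fibre G \<A>) (mul (unit_fibre G \<A>) x y)
        = mul (unit_fibre G \<A>) (star (unit_fibre G \<A>) y) (star (unit_fibre G \<A>) x)"
      using x y bstar_bmul[of \<one> \<one> x y] by (simp add: unit_fibre_def)
    show "nrm (unit_fibre G \<A>) (mul (unit_fibre G \<A>) x y)
        \<le> nrm (unit_fibre G \<A>) x * nrm (unit_fibre G \<A>) y"
      using x y norm_bmul[of \<one> \<one> x y] by (simp add: unit_fibre_def)
    assume "z \<in> carrier (unit_fibre G \<A>)"
    then show "mul (unit_fibre G \<A>) (mul (unit_fibre G \<A>) x y) z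
        = mul (unit_fibre G \<A>) x (mul (unit_fibre G \<A>) y z)"
      using x y bmul_assoc[of \<one> \<one> \<one> x y z] by (simp add: unit_fibre_def)
  qed (simp add: sel B.complete)
qed

lemma unit_fibre_sel [simp]:
  "carrier (unit_fibre G \<A>) = fset \<A> \<one>" "scl (unit_fibre G \<A>) = fscl \<A>"
  "nrm (unit_fibre G \<A>) = fnrm \<A> \<one>" "mul (unit_fibre G \<A>) = bmul \<A> \<one> \<one>"
  "star (unit_fibre G \<A>) = bstar \<A> \<one>"
  by (simp_all add: unit_fibre_def)

text \<open>Only pairs of mutually inverse degrees contribute in degree e. Every term is positive by
  a bundle axiom, which is the source of positivity and definiteness of evaluation at the
  unit.\<close>

lemma star_mul_section_one:
  assumes f: "f \<in> sections G \<A>"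
  shows "mul (S n) (star (S n) f) f \<one>
    = (\<Sum>t\<in>carrier G. bmul \<A> (inv t) t (bstar \<A> t (f t)) (f t))"
proof -
  have "mul (S n) (star (S n) f) f \<one> = (\<Sum>s\<in>carrier G. \<Sum>t\<in>carrier G.
      if \<one> = t \<otimes> s then bmul \<A> t s (star (S n) f t) (f s) else 0)"
    unfolding section_algebra_sel(4) prod.conv_apply by (rule sum.swap)
  also have "\<dots> = (\<Sum>s\<in>carrier G. \<Sum>t\<in>carrier G.
      if t = inv s then bmul \<A> (inv s) s (bstar \<A> s (f s)) (f s) else 0)"
    by (intro sum.cong refl) (auto simp: section_algebra_sel inv_equality dest: inv_equality[OF sym])
  also have "\<dots> = (\<Sum>s\<in>carrier G. bmul \<A> (inv s) s (bstar \<A> s (f s)) (f s))"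
    using finite_group by (intro sum.cong) auto
  finally show ?thesis .
qed

end

locale unital_cstar_bundle = finite_cstar_bundle G \<A>
  for G :: "('g, 'k) monoid_scheme" (structure)
    and \<A> :: "('g, 'a::ab_group_add, 'm) fell_bundle_scheme" +
  fixes u :: 'a
  assumes u_closed [simp]: "u \<in> fset \<A> \<one>"
    and bmul_unit_left: "t \<in> carrier G \<Longrightarrow> a \<in> fset \<A> t \<Longrightarrow> bmul \<A> \<one> t u a = a"
    and bmul_unit_right: "t \<in> carrier G \<Longrightarrow> a \<in> fset \<A> t \<Longrightarrow> bmul \<A> t \<one> a u = a"
begin

lemma is_unit_sections: "is_unit_of (S n) (single \<one> u)"
proof -
  have "conv G (\<otimes>) (bmul \<A>) (single \<one> u) f = f \<and> conv G (\<otimes>) (bmul \<A>) f (single \<one> u) = f"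
    if "f \<in> sections G \<A>" for f
    using that
    by (induction rule: section_induct)
      (simp_all del: plus_fun_apply add: prod.conv_single bmul_unit_left bmul_unit_right prod.conv_add_left prod.conv_add_right)
  then show ?thesis
    by (simp add: is_unit_of_def section_algebra_sel(1,4))
qed

lemma unital_star_algebra_sections: "unital_star_algebra (S n) (single \<one> u)"
  by (intro unital_star_algebra.intro unital_star_algebra_axioms.intro star_algebra_sections
      is_unit_sections)

sublocale A: unital_cstar_algebra "unit_fibre G \<A>" u
proof -
  interpret B: cstar_algebra "unit_fibre G \<A>"
    by (rule cstar_algebra_unit_fibre)
  have "is_unit_of (unit_fibre G \<A>) u"
    by (simp add: is_unit_of_def bmul_unit_left bmul_unit_right)
  then show "unital_cstar_algebra (unit_fibre G \<A>) u"
    by (intro unital_cstar_algebra.intro cstar_algebra_unit_fibre unital_star_algebra.intro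
        unital_star_algebra_axioms.intro B.star_algebra_axioms)
qed

text \<open>The zero function is a placeholder: \<open>expectation\<close> reads only the *-algebra,
  and \<open>op_norm\<close> is then built from it.\<close>

abbreviation S0 :: "('g \<Rightarrow> 'a) cstar"
  where "S0 \<equiv> S (\<lambda>_. 0)"

lemma pos_bstar_bmul: "t \<in> carrier G \<Longrightarrow> a \<in> fset \<A> t
    \<Longrightarrow> A.pos (bmul \<A> (inv t) t (bstar \<A> t a) a)"
  using bstar_bmul_positive by (simp add: A.positive_in_iff_pos)

lemma pos_star_mul_section:
  assumes "f \<in> sections G \<A>" shows "A.pos (mul (S n) (star (S n) f) f \<one>)"
  unfolding star_mul_section_one[OF assms]
  by (intro A.pos_sum pos_bstar_bmul section_apply[OF assms])

text \<open>A term of a sum of positive elements is dominated by the sum, and the norm is monotone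
  on positive elements.\<close>

lemma norm_coord_le:
  assumes f: "f \<in> sections G \<A>" and t: "t \<in> carrier G"
  shows "(fnrm \<A> t (f t))\<^sup>2 \<le> fnrm \<A> \<one> (mul (S n) (star (S n) f) f \<one>)"
proof -
  let ?p = "\<lambda>t. bmul \<A> (inv t) t (bstar \<A> t (f t)) (f t)"
  have "(\<Sum>t\<in>carrier G. ?p t) - ?p t = (\<Sum>t\<in>carrier G - {t}. ?p t)"
    using finite_group t by (simp add: sum.remove[of _ t])
  moreover have "A.pos \<dots>"
    using section_apply[OF f] by (intro A.pos_sum pos_bstar_bmul) auto
  ultimately have "nrm (unit_fibre G \<A>) (?p t) \<le> nrm (unit_fibre G \<A>) (\<Sum>t\<in>carrier G. ?p t)"
    using t section_apply[OF f] by (intro A.norm_mono pos_bstar_bmul) auto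
  then show ?thesis
    using t section_apply[OF f t] by (simp add: star_mul_section_one[OF f] norm_bstar_bmul)
qed

lemma star_mul_section_eq_0:
  assumes f: "f \<in> sections G \<A>" and eq: "mul (S n) (star (S n) f) f \<one> = 0"
  shows "f = 0"
proof
  fix t
  show "f t = 0 t"
  proof (cases "t \<in> carrier G")
    case True
    interpret B: complex_banach "fibre \<A> t" by (rule banach[OF True])
    have "fnrm \<A> t (f t) = 0"
      using norm_coord_le[OF f True, of n] A.norm_zero by (simp add: eq)
    then show ?thesis
      using B.norm_eq_0[of "f t"] section_apply[OF f True] by (simp add: fibre_def)
  qed (simp add: section_off[OF f])
qed

sublocale expectation S0 "single \<one> u" "unit_fibre G \<A>" u "\<lambda>f. f \<one>" "single \<one>"
proof (intro expectation.intro unital_star_algebra_sections A.unital_cstar_algebra_axioms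
    expectation_axioms.intro)
  show "linear_map S0 (unit_fibre G \<A>) (\<lambda>f. f \<one>)"
    by (auto simp: semilinear_map_def section_algebra_sel section_apply)
  show "star S0 f \<one> = star (unit_fibre G \<A>) (f \<one>)" for f
    by (simp add: section_algebra_sel)
  show "mul S0 f (single \<one> a) \<one> = mul (unit_fibre G \<A>) (f \<one>) a"
    if f: "f \<in> carrier S0" and a: "a \<in> carrier (unit_fibre G \<A>)" for f a
    using f unfolding section_algebra_sel
  proof (induction rule: section_induct)
    case (single t b)
    then show ?case
      using a by (simp add: prod.conv_single) (simp add: single_apply)
  next
    case (add f g)
    then show ?case
      using a section_apply[of f \<one>] section_apply[of g \<one>]
      by (simp del: plus_fun_apply add: prod.conv_add_left)
        (simp add: prod.pair_add_left)
  qed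
  show "single \<one> (star (unit_fibre G \<A>) a) = star S0 (single \<one> a)"
    if "a \<in> carrier (unit_fibre G \<A>)" for a
    using that by (simp add: star_section_single)
  show "A.pos (mul S0 (star S0 f) f \<one>)" if "f \<in> carrier S0" for f
    using that by (simp add: pos_star_mul_section section_algebra_sel(1))
  show "f = 0" if "f \<in> carrier S0" "mul S0 (star S0 f) f \<one> = 0" for f
    using that by (simp add: star_mul_section_eq_0 section_algebra_sel(1))
qed (simp_all add: section_algebra_sel(1))

text \<open>With s = norm(a)^2, the element s - a^* a of the unit fibre is positive, hence a square
  k^2 with k selfadjoint. So s \<open>ip f f\<close> - \<open>ip\<close> (a f) (a f) equals
  \<open>ip\<close> (k f) (k f), which is positive.\<close>

lemma norm2_single_le:
  assumes t: "t \<in> carrier G" and a: "a \<in> fset \<A> t" and f: "f \<in> sections G \<A>"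
  shows "norm2 (mul S0 (single t a) f) \<le> fnrm \<A> t a * norm2 f"
proof -
  interpret B: complex_banach "fibre \<A> t" by (rule banach[OF t])
  let ?x = "single t a"
  define s where "s = (fnrm \<A> t a)\<^sup>2"
  define p where "p = bmul \<A> (inv t) t (bstar \<A> t a) a"
  have p: "A.pos p"
    unfolding p_def by (rule pos_bstar_bmul[OF t a])
  have [simp]: "p \<in> fset \<A> \<one>"
    using A.pos_closed[OF p] by simp
  have c [simp]: "f \<in> carrier S0" "?x \<in> carrier S0" "single \<one> b \<in> carrier S0 \<longleftrightarrow> b \<in> fset \<A> \<one>" for b
    using t a f by (auto simp: section_algebra_sel(1) sections_def single_apply split: if_splits)
  have xx: "mul S0 (star S0 ?x) ?x = single \<one> p"
    using t a by (simp add: star_section_single section_algebra_sel(4) prod.conv_single p_def)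
  have "nrm (unit_fibre G \<A>) p = s"
    using norm_bstar_bmul[OF t a] by (simp add: p_def s_def)
  then have "A.pos (scl (unit_fibre G \<A>) (of_real s) u - p)"
    using p by (intro A.pos_scalar_minus A.pos_selfadjoint) auto
  then obtain k where k: "A.selfadjoint k" "fscl \<A> (of_real s) u - p = bmul \<A> \<one> \<one> k k"
    by (auto simp: A.pos_def)
  have kc [simp]: "k \<in> fset \<A> \<one>"
    using A.selfadjoint_closed[OF k(1)] by simp
  have "star S0 (single \<one> k) = single \<one> k"
    using A.selfadjoint_star[OF k(1)] by (simp add: star_section_single)
  then have "ip (mul S0 (single \<one> k) f) (mul S0 (single \<one> k) f)
      = ip f (mul S0 (single \<one> (bmul \<A> \<one> \<one> k k)) f)"
    by (simp add: ip_mul_left flip: S.mul_assoc)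
      (simp add: section_algebra_sel(4) prod.conv_single)
  also have "single \<one> (bmul \<A> \<one> \<one> k k) = scl S0 (of_real s) (single \<one> u) - single \<one> p"
    by (auto simp: section_algebra_sel(2) single_apply fun_eq_iff simp flip: k(2))
  also have "ip f (mul S0 \<dots> f) = scl (unit_fibre G \<A>) (of_real s) (ip f f)
      - ip (mul S0 ?x f) (mul S0 ?x f)"
    by (simp add: S.mul_distribs ip_diff_right ip_scl_right xx ip_mul_left flip: S.mul_assoc)
  finally have "A.pos (scl (unit_fibre G \<A>) (of_real s) (ip f f) - ip (mul S0 ?x f) (mul S0 ?x f))"
    using ip_pos[of "mul S0 (single \<one> k) f"] by simp
  from A.norm_mono[OF ip_pos this]
  have "nrm (unit_fibre G \<A>) (ip (mul S0 ?x f) (mul S0 ?x f)) \<le> s * nrm (unit_fibre G \<A>) (ip f f)"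
    using A.norm_scl[of "ip f f" "of_real s"] ip_closed[of f f] by (simp add: s_def norm_power)
  then have "norm2 (mul S0 ?x f) \<le> sqrt (s * nrm (unit_fibre G \<A>) (ip f f))"
    unfolding norm2_def by (rule real_sqrt_le_mono)
  also have "\<dots> = fnrm \<A> t a * norm2 f"
    using B.norm_nonneg[of a] a by (simp add: norm2_def real_sqrt_mult s_def fibre_def)
  finally show ?thesis .
qed

sublocale bounded_expectation S0 "single \<one> u" "unit_fibre G \<A>" u "\<lambda>f. f \<one>" "single \<one>"
proof
  fix f assume "f \<in> carrier S0"
  then have "f \<in> sections G \<A>" by (simp add: section_algebra_sel(1))
  then show "\<exists>K\<ge>0. \<forall>g\<in>carrier S0. norm2 (mul S0 f g) \<le> K * norm2 g"
  proof (induction rule: section_induct)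
    case (single t a)
    interpret B: complex_banach "fibre \<A> t" by (rule banach[OF single(1)])
    show ?case
      using single norm2_single_le[OF single] B.norm_nonneg[of a]
      by (intro exI[of _ "fnrm \<A> t a"]) (simp add: fibre_def section_algebra_sel(1))
  next
    case (add f g)
    then obtain K L where "0 \<le> K" "\<And>h. h \<in> carrier S0 \<Longrightarrow> norm2 (mul S0 f h) \<le> K * norm2 h"
      "0 \<le> L" "\<And>h. h \<in> carrier S0 \<Longrightarrow> norm2 (mul S0 g h) \<le> L * norm2 h"
      by blast
    moreover have "norm2 (mul S0 (f + g) h) \<le> norm2 (mul S0 f h) + norm2 (mul S0 g h)"
      if "h \<in> carrier S0" for h
      using add(1,2) that norm2_triangle[of "mul S0 f h" "mul S0 g h"]
      by (simp add: section_algebra_sel(1,4) prod.conv_add_left del: plus_fun_apply)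
    ultimately show ?case
      by (intro exI[of _ "K + L"]) (force simp: distrib_right simp del: plus_fun_apply)
  qed
qed

lemma op_norm_single_le:
  assumes t: "t \<in> carrier G" and a: "a \<in> fset \<A> t"
  shows "op_norm (single t a) \<le> fnrm \<A> t a"
proof -
  interpret B: complex_banach "fibre \<A> t" by (rule banach[OF t])
  show ?thesis
    using B.norm_nonneg[of a] a norm2_single_le[OF t a]
    by (intro op_norm_le) (simp_all add: fibre_def section_algebra_sel(1))
qed

lemma fnrm_le_op_norm:
  assumes f: "f \<in> sections G \<A>" and t: "t \<in> carrier G"
  shows "fnrm \<A> t (f t) \<le> op_norm f"
proof -
  have f': "f \<in> carrier S0"
    using f by (simp add: section_algebra_sel(1))
  have "(fnrm \<A> t (f t))\<^sup>2 \<le> (norm2 f)\<^sup>2"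
    using norm_coord_le[OF f t] by (simp add: norm2_square[OF f'] ip_def)
  then have "fnrm \<A> t (f t) \<le> norm2 f"
    by (rule power2_le_imp_le) (rule norm2_nonneg[OF f'])
  also have "\<dots> \<le> op_norm f"
    by (rule norm2_le_op_norm[OF f'])
  finally show ?thesis .
qed

lemma op_norm_single: "t \<in> carrier G \<Longrightarrow> a \<in> fset \<A> t \<Longrightarrow> op_norm (single t a) = fnrm \<A> t a"
  using fnrm_le_op_norm[of "single t a" t] by (intro antisym op_norm_single_le) auto

lemma cstar_algebra_op_norm: "cstar_algebra (S op_norm)"
proof -
  interpret Alg: star_algebra "S op_norm" by (rule star_algebra_sections)
  have sel: "carrier (S op_norm) = carrier S0" "scl (S op_norm) = scl S0"
    "mul (S op_norm) = mul S0" "star (S op_norm) = star S0" "nrm (S op_norm) = op_norm"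
    by (simp_all only: section_algebra_sel)
  interpret N: complex_normed "S op_norm"
    by unfold_locales
      (simp_all only: sel op_norm_nonneg op_norm_eq_0 op_norm_scl op_norm_triangle)
  have complete: "complete_wrt (carrier (S op_norm)) (nrm (S op_norm))"
    by (rule sections_complete)
      (simp_all add: N.complex_normed_axioms section_algebra_sel(1,3) fnrm_le_op_norm op_norm_single_le)
  show ?thesis
    by unfold_locales
      (fact complete N.norm_nonneg N.norm_eq_0 N.norm_scl N.norm_triangle Alg.mul_bilinear Alg.mul_assoc
          Alg.star_conj_linear Alg.star_mul Alg.star_star
        | simp only: sel op_norm_mul op_norm_cstar)+
qed

section \<open>The chosen C*-norm and evaluation at the unit\<close>

abbreviation C :: "('g \<Rightarrow> 'a) cstar"
  where "C \<equiv> section_algebra G \<A>"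

text \<open>\<open>op_norm\<close> witnesses that the choice behind \<open>section_norm\<close> has
  something to choose from. From here on the chosen norm is known only through these two
  properties.\<close>

lemma section_norm:
  "cstar_algebra C"
  "t \<in> carrier G \<Longrightarrow> a \<in> fset \<A> t \<Longrightarrow> section_norm G \<A> (single t a) = fnrm \<A> t a"
proof -
  have "\<exists>n. cstar_algebra (section_star_algebra G \<A> n) \<and>
      (\<forall>t\<in>carrier G. \<forall>a\<in>fset \<A> t. n ((\<lambda>_. 0)(t := a)) = fnrm \<A> t a)"
    using cstar_algebra_op_norm op_norm_single by (auto simp flip: single_def)
  from someI_ex[OF this] show "cstar_algebra C"
    "t \<in> carrier G \<Longrightarrow> a \<in> fset \<A> t \<Longrightarrow> section_norm G \<A> (single t a) = fnrm \<A> t a"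
    by (simp_all add: section_algebra_def section_norm_def single_def)
qed

lemmas C_sel = section_algebra_sel[where n = "section_norm G \<A>", folded section_algebra_def]

sublocale C: unital_cstar_algebra C "single \<one> u"
  by (intro unital_cstar_algebra.intro section_norm(1))
    (simp only: section_algebra_def unital_star_algebra_sections)

lemma norm_C_single: "t \<in> carrier G \<Longrightarrow> a \<in> fset \<A> t \<Longrightarrow> nrm C (single t a) = fnrm \<A> t a"
  by (simp add: C_sel section_norm)

lemma pos_C_at_one:
  assumes "C.pos f" shows "A.pos (f \<one>)"
proof -
  obtain h where h: "C.selfadjoint h" "f = mul C h h"
    using assms by (auto simp: C.pos_def)
  have "h \<in> sections G \<A>"
    using C.selfadjoint_closed[OF h(1)] by (simp add: C_sel)
  from pos_star_mul_section[OF this, of "section_norm G \<A>"] show ?thesis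
    using h by (simp add: C.selfadjoint_star flip: section_algebra_def)
qed

text \<open>Evaluation at the unit preserves positivity and sends the unit of \<open>C\<close> to u;
  apply it to the positive element norm(f) - f. This avoids any formula for the chosen norm.\<close>

lemma norm_pos_at_one_le:
  assumes f: "C.pos f" shows "fnrm \<A> \<one> (f \<one>) \<le> nrm C f"
proof -
  have "C.pos (scl C (of_real (nrm C f)) (single \<one> u) - f)"
    using f by (intro C.pos_scalar_minus C.pos_selfadjoint) auto
  from pos_C_at_one[OF this]
  have "A.pos (scl (unit_fibre G \<A>) (of_real (nrm C f)) u - f \<one>)"
    by (simp add: C_sel)
  with pos_C_at_one[OF f] have "nrm (unit_fibre G \<A>) (f \<one>) \<le> nrm C f"
    using C.norm_nonneg f by (intro A.norm_le_scalar) auto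
  then show ?thesis by simp
qed

lemma unit_fibre_sections_eq: "unit_fibre_sections G \<A> = single \<one> ` fset \<A> \<one>"
  by (simp add: unit_fibre_sections_def single_def)

lemma unit_fibre_sections_subset: "unit_fibre_sections G \<A> \<subseteq> carrier C"
  by (auto simp: unit_fibre_sections_eq C_sel)

lemma unit_fibre_sections_subspace: "C.vs.subspace (unit_fibre_sections G \<A>)"
  unfolding C.vs.subspace_def unfolding unit_fibre_sections_eq C_sel
  by (auto simp flip: single_add single_scl intro: image_eqI[of 0 "single \<one>" 0])

lemma cstar_algebra_unit_fibre_sections:
  "cstar_algebra (C\<lparr>carrier := unit_fibre_sections G \<A>\<rparr>)"
proof (rule C.cstar_subalgebra[OF unit_fibre_sections_subspace unit_fibre_sections_subset])
  show "mul C a b \<in> unit_fibre_sections G \<A>"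
    if "a \<in> unit_fibre_sections G \<A>" "b \<in> unit_fibre_sections G \<A>" for a b
    using that prod.pair_closed[of \<one> \<one>]
    by (auto simp: unit_fibre_sections_eq C_sel(4) prod.conv_single)
  show "star C a \<in> unit_fibre_sections G \<A>" if "a \<in> unit_fibre_sections G \<A>" for a
    using that bstar_closed[of \<one>] star_section_single[of \<one> _ "section_norm G \<A>"]
    by (auto simp: unit_fibre_sections_eq simp flip: section_algebra_def)
  let ?V = "C\<lparr>carrier := unit_fibre_sections G \<A>\<rparr>"
  have *: "x \<in> carrier C" if "x \<in> unit_fibre_sections G \<A>" for x
    using that unit_fibre_sections_subset by blast
  have "complex_normed ?V"
    by (intro complex_normed.intro complex_space.intro complex_normed_axioms.intro)
      (simp_all add: * C.vector_space unit_fibre_sections_subspace C.norm_nonneg C.norm_eq_0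
        C.norm_scl C.norm_triangle)
  from complete_single_image[OF this] show "complete_wrt (unit_fibre_sections G \<A>) (nrm C)"
    by (simp add: unit_fibre_sections_eq norm_C_single)
qed

lemma unital_inclusion_unit_fibre: "unital_inclusion (unit_fibre_sections G \<A>) C"
  unfolding unital_inclusion_def
  using section_norm(1) unit_fibre_sections_subset cstar_algebra_unit_fibre_sections C.is_unit
  by (auto simp: unit_fibre_sections_eq)

end

text \<open>Multiply the unit with homogeneous sections and read off the single coordinate that can
  be nonzero.\<close>

lemma (in finite_cstar_bundle) unital_cstar_bundle_if_unit:
  assumes "\<exists>e\<in>unit_fibre_sections G \<A>. is_unit_of (section_algebra G \<A>) e"
  obtains u where "unital_cstar_bundle G \<A> u"
proof -
  from assms obtain u where u: "u \<in> fset \<A> \<one>"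
    and unit: "is_unit_of (section_algebra G \<A>) (single \<one> u)"
    by (auto simp: unit_fibre_sections_def single_def)
  have *: "conv G (\<otimes>) (bmul \<A>) (single \<one> u) (single t a) = single t a
      \<and> conv G (\<otimes>) (bmul \<A>) (single t a) (single \<one> u) = single t a"
    if "t \<in> carrier G" "a \<in> fset \<A> t" for t a
    using unit that by (simp add: is_unit_of_def section_algebra_def section_algebra_sel(1,4))
  have "bmul \<A> \<one> t u a = a \<and> bmul \<A> t \<one> a u = a" if "t \<in> carrier G" "a \<in> fset \<A> t" for t a
    using *[OF that] that u by (simp add: prod.conv_single) (metis single_same)
  then have "unital_cstar_bundle G \<A> u"
    using u by unfold_locales auto
  then show thesis by (rule that)
qed

section \<open>Bimodules over unital C*-algebras\<close>

text \<open>
  Positivity of the inner products is only assumed on a subspace \<open>X\<close> whose inner products span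
  the units; this is what makes it available on all of \<open>Y\<close>.
\<close>

locale pre_bimodule =
  C: unital_cstar_algebra C c1 + D: unital_cstar_algebra D d1 + Y: complex_space Y
  for C :: "('c::ab_group_add, 'p) cstar_scheme" and c1 :: 'c
    and D :: "('d::ab_group_add, 'q) cstar_scheme" and d1 :: 'd
    and Y :: "('c, 'd, 'y::ab_group_add, 'r) bimodule_scheme" +
  fixes X :: "'y set"
  assumes lact_bilinear: "bilinear_map C Y Y (lact Y)"
    and ract_bilinear: "bilinear_map Y D Y (ract Y)"
    and lip_linear: "y \<in> carrier Y \<Longrightarrow> linear_map Y C (\<lambda>x. lip Y x y)"
    and rip_linear: "x \<in> carrier Y \<Longrightarrow> linear_map Y D (\<lambda>y. rip Y x y)"
    and lip_lact: "c \<in> carrier C \<Longrightarrow> x \<in> carrier Y \<Longrightarrow> y \<in> carrier Y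
      \<Longrightarrow> lip Y (lact Y c x) y = mul C c (lip Y x y)"
    and rip_ract: "x \<in> carrier Y \<Longrightarrow> y \<in> carrier Y \<Longrightarrow> d \<in> carrier D
      \<Longrightarrow> rip Y x (ract Y y d) = mul D (rip Y x y) d"
    and lip_star: "x \<in> carrier Y \<Longrightarrow> y \<in> carrier Y \<Longrightarrow> star C (lip Y x y) = lip Y y x"
    and rip_star: "x \<in> carrier Y \<Longrightarrow> y \<in> carrier Y \<Longrightarrow> star D (rip Y x y) = rip Y y x"
    and lip_definite: "x \<in> carrier Y \<Longrightarrow> lip Y x x = 0 \<Longrightarrow> x = 0"
    and rip_definite: "x \<in> carrier Y \<Longrightarrow> rip Y x x = 0 \<Longrightarrow> x = 0"
    and lip_lact_rip: "x \<in> carrier Y \<Longrightarrow> y \<in> carrier Y \<Longrightarrow> z \<in> carrier Y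
      \<Longrightarrow> lact Y (lip Y x y) z = ract Y x (rip Y y z)"
    and X_subset: "X \<subseteq> carrier Y"
    and X_subspace: "module.subspace (scl Y) X"
    and lip_pos_X: "x \<in> X \<Longrightarrow> C.pos (lip Y x x)"
    and rip_pos_X: "x \<in> X \<Longrightarrow> D.pos (rip Y x x)"
    and lip_unit: "c1 \<in> left_ip_span C Y X X"
    and rip_unit: "d1 \<in> right_ip_span D Y X X"
begin

lemma lact_closed [simp]: "c \<in> carrier C \<Longrightarrow> x \<in> carrier Y \<Longrightarrow> lact Y c x \<in> carrier Y"
  using lact_bilinear by (simp add: bilinear_map_def semilinear_map_def)

lemma ract_closed [simp]: "x \<in> carrier Y \<Longrightarrow> d \<in> carrier D \<Longrightarrow> ract Y x d \<in> carrier Y"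
  using ract_bilinear by (simp add: bilinear_map_def semilinear_map_def)

lemma lip_closed [simp]: "x \<in> carrier Y \<Longrightarrow> y \<in> carrier Y \<Longrightarrow> lip Y x y \<in> carrier C"
  using lip_linear by (simp add: semilinear_map_def)

lemma rip_closed [simp]: "x \<in> carrier Y \<Longrightarrow> y \<in> carrier Y \<Longrightarrow> rip Y x y \<in> carrier D"
  using rip_linear by (simp add: semilinear_map_def)

lemma ract_add_right: "x \<in> carrier Y \<Longrightarrow> d \<in> carrier D \<Longrightarrow> d' \<in> carrier D
    \<Longrightarrow> ract Y x (d + d') = ract Y x d + ract Y x d'"
  using ract_bilinear by (simp add: bilinear_map_def semilinear_map_def)

lemma ract_scl_right: "x \<in> carrier Y \<Longrightarrow> d \<in> carrier D
    \<Longrightarrow> ract Y x (scl D c d) = scl Y c (ract Y x d)"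
  using ract_bilinear by (simp add: bilinear_map_def semilinear_map_def)

lemma ract_add_left: "x \<in> carrier Y \<Longrightarrow> x' \<in> carrier Y \<Longrightarrow> d \<in> carrier D
    \<Longrightarrow> ract Y (x + x') d = ract Y x d + ract Y x' d"
  using ract_bilinear by (simp add: bilinear_map_def semilinear_map_def)

lemma ract_scl_left: "x \<in> carrier Y \<Longrightarrow> d \<in> carrier D
    \<Longrightarrow> ract Y (scl Y c x) d = scl Y c (ract Y x d)"
  using ract_bilinear by (simp add: bilinear_map_def semilinear_map_def)

lemma lact_add_left: "x \<in> carrier Y \<Longrightarrow> c \<in> carrier C \<Longrightarrow> c' \<in> carrier C
    \<Longrightarrow> lact Y (c + c') x = lact Y c x + lact Y c' x"
  using lact_bilinear by (simp add: bilinear_map_def semilinear_map_def)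

lemma lact_scl_left: "x \<in> carrier Y \<Longrightarrow> c \<in> carrier C
    \<Longrightarrow> lact Y (scl C z c) x = scl Y z (lact Y c x)"
  using lact_bilinear by (simp add: bilinear_map_def semilinear_map_def)

lemma lact_add_right: "x \<in> carrier Y \<Longrightarrow> x' \<in> carrier Y \<Longrightarrow> c \<in> carrier C
    \<Longrightarrow> lact Y c (x + x') = lact Y c x + lact Y c x'"
  using lact_bilinear by (simp add: bilinear_map_def semilinear_map_def)

lemma lact_scl_right: "x \<in> carrier Y \<Longrightarrow> c \<in> carrier C
    \<Longrightarrow> lact Y c (scl Y z x) = scl Y z (lact Y c x)"
  using lact_bilinear by (simp add: bilinear_map_def semilinear_map_def)

lemma ract_zero_right [simp]: "x \<in> carrier Y \<Longrightarrow> ract Y x 0 = 0"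
  using ract_scl_right[of x 0 0] by simp

lemma ract_minus_right: "x \<in> carrier Y \<Longrightarrow> d \<in> carrier D \<Longrightarrow> ract Y x (- d) = - ract Y x d"
  using ract_scl_right[of x d "-1"] by simp

lemma lip_add_left: "x \<in> carrier Y \<Longrightarrow> x' \<in> carrier Y \<Longrightarrow> y \<in> carrier Y
    \<Longrightarrow> lip Y (x + x') y = lip Y x y + lip Y x' y"
  using lip_linear by (simp add: semilinear_map_def)

lemma lip_scl_left: "x \<in> carrier Y \<Longrightarrow> y \<in> carrier Y \<Longrightarrow> lip Y (scl Y c x) y = scl C c (lip Y x y)"
  using lip_linear by (simp add: semilinear_map_def)

lemma lip_add_right: "x \<in> carrier Y \<Longrightarrow> y \<in> carrier Y \<Longrightarrow> y' \<in> carrier Y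
    \<Longrightarrow> lip Y x (y + y') = lip Y x y + lip Y x y'"
  using arg_cong[OF lip_add_left[of y y' x], of "star C"] by (simp add: lip_star C.star_add)

lemma lip_scl_right: "x \<in> carrier Y \<Longrightarrow> y \<in> carrier Y
    \<Longrightarrow> lip Y x (scl Y c y) = scl C (cnj c) (lip Y x y)"
  using arg_cong[OF lip_scl_left[of y x c], of "star C"] by (simp add: lip_star C.star_scl)

lemma rip_add_right: "x \<in> carrier Y \<Longrightarrow> y \<in> carrier Y \<Longrightarrow> y' \<in> carrier Y
    \<Longrightarrow> rip Y x (y + y') = rip Y x y + rip Y x y'"
  using rip_linear by (simp add: semilinear_map_def)

lemma rip_scl_right: "x \<in> carrier Y \<Longrightarrow> y \<in> carrier Y \<Longrightarrow> rip Y x (scl Y c y) = scl D c (rip Y x y)"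
  using rip_linear by (simp add: semilinear_map_def)

lemma rip_add_left: "x \<in> carrier Y \<Longrightarrow> x' \<in> carrier Y \<Longrightarrow> y \<in> carrier Y
    \<Longrightarrow> rip Y (x + x') y = rip Y x y + rip Y x' y"
  using arg_cong[OF rip_add_right[of y x x'], of "star D"] by (simp add: rip_star D.star_add)

lemma rip_scl_left: "x \<in> carrier Y \<Longrightarrow> y \<in> carrier Y
    \<Longrightarrow> rip Y (scl Y c x) y = scl D (cnj c) (rip Y x y)"
  using arg_cong[OF rip_scl_right[of y x c], of "star D"] by (simp add: rip_star D.star_scl)

lemma lip_minus_left: "x \<in> carrier Y \<Longrightarrow> y \<in> carrier Y \<Longrightarrow> lip Y (- x) y = - lip Y x y"
  using lip_scl_left[of x y "-1"] by simp

lemma lip_diff_left: "x \<in> carrier Y \<Longrightarrow> x' \<in> carrier Y \<Longrightarrow> y \<in> carrier Y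
    \<Longrightarrow> lip Y (x - x') y = lip Y x y - lip Y x' y"
  using lip_add_left[of x "- x'" y] by (simp add: lip_minus_left)

lemma rip_minus_right: "x \<in> carrier Y \<Longrightarrow> y \<in> carrier Y \<Longrightarrow> rip Y x (- y) = - rip Y x y"
  using rip_scl_right[of x y "-1"] by simp

lemma rip_diff_right: "x \<in> carrier Y \<Longrightarrow> y \<in> carrier Y \<Longrightarrow> y' \<in> carrier Y
    \<Longrightarrow> rip Y x (y - y') = rip Y x y - rip Y x y'"
  using rip_add_right[of x y "- y'"] by (simp add: rip_minus_right)

lemma rip_diff_left: "x \<in> carrier Y \<Longrightarrow> x' \<in> carrier Y \<Longrightarrow> y \<in> carrier Y
    \<Longrightarrow> rip Y (x - x') y = rip Y x y - rip Y x' y"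
  using arg_cong[OF rip_diff_right[of y x x'], of "star D"] by (simp add: rip_star D.star_diff)

lemma rip_ract_left: "x \<in> carrier Y \<Longrightarrow> y \<in> carrier Y \<Longrightarrow> d \<in> carrier D
    \<Longrightarrow> rip Y (ract Y x d) y = mul D (star D d) (rip Y x y)"
  using arg_cong[OF rip_ract[of y x d], of "star D"] by (simp add: rip_star D.star_mul)

text \<open>Definiteness lets elements be compared through their inner products. The module laws
  absent from the axioms of an equivalence bundle, such as associativity of the actions, are
  obtained in this way.\<close>

lemma eq_if_lip_eq:
  assumes "x \<in> carrier Y" "x' \<in> carrier Y" "\<And>y. y \<in> carrier Y \<Longrightarrow> lip Y x y = lip Y x' y"
  shows "x = x'"
  using assms lip_definite[of "x - x'"] by (simp add: lip_diff_left)

lemma eq_if_rip_eq: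
  assumes "x \<in> carrier Y" "x' \<in> carrier Y" "\<And>y. y \<in> carrier Y \<Longrightarrow> rip Y y x = rip Y y x'"
  shows "x = x'"
  using assms rip_definite[of "x - x'"] by (simp add: rip_diff_right)

lemma lact_lact: "a \<in> carrier C \<Longrightarrow> c \<in> carrier C \<Longrightarrow> x \<in> carrier Y
    \<Longrightarrow> lact Y (mul C a c) x = lact Y a (lact Y c x)"
  by (rule eq_if_lip_eq) (simp_all add: lip_lact C.mul_assoc)

lemma ract_ract: "x \<in> carrier Y \<Longrightarrow> b \<in> carrier D \<Longrightarrow> d \<in> carrier D
    \<Longrightarrow> ract Y x (mul D b d) = ract Y (ract Y x b) d"
  by (rule eq_if_rip_eq) (simp_all add: rip_ract D.mul_assoc)

lemma ract_unit: "x \<in> carrier Y \<Longrightarrow> ract Y x d1 = x"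
  by (rule eq_if_rip_eq) (simp_all add: rip_ract)

text \<open>Faithfulness of the action: a and b multiply every \<open>lip Y x y\<close> to the same
  result, hence also the elements of the span of these, and the unit lies in that span.\<close>

lemma eq_if_lact_eq:
  assumes a: "a \<in> carrier C" and b: "b \<in> carrier C"
    and eq: "\<And>x. x \<in> carrier Y \<Longrightarrow> lact Y a x = lact Y b x"
  shows "a = b"
proof -
  have "C.vs.subspace {c \<in> carrier C. mul C a c = mul C b c}"
    using a b by (auto simp: C.vs.subspace_def C.mul_distribs)
  moreover have "{lip Y x y |x y. x \<in> X \<and> y \<in> X} \<subseteq> {c \<in> carrier C. mul C a c = mul C b c}"
    using X_subset a b eq by (auto simp: subset_iff simp flip: lip_lact)
  ultimately have "left_ip_span C Y X X \<subseteq> {c \<in> carrier C. mul C a c = mul C b c}"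
    unfolding left_ip_span_def by (rule C.vs.span_minimal[rotated])
  then show ?thesis
    using lip_unit a b by auto
qed

text \<open>No axiom relates \<open>lip\<close> and \<open>ract\<close> directly, so both sides are
  compared through their action on z: by \<open>lip_lact_rip\<close> each becomes x acted on by d
  \<open>rip Y y z\<close>.\<close>

lemma lip_ract:
  assumes [simp]: "x \<in> carrier Y" "d \<in> carrier D" "y \<in> carrier Y"
  shows "lip Y (ract Y x d) y = lip Y x (ract Y y (star D d))"
proof (rule eq_if_lact_eq)
  fix z assume [simp]: "z \<in> carrier Y"
  show "lact Y (lip Y (ract Y x d) y) z = lact Y (lip Y x (ract Y y (star D d))) z"
    by (simp add: lip_lact_rip rip_ract_left D.star_star ract_ract)
qed simp_all

lemma lact_ract: "c \<in> carrier C \<Longrightarrow> x \<in> carrier Y \<Longrightarrow> d \<in> carrier D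
    \<Longrightarrow> ract Y (lact Y c x) d = lact Y c (ract Y x d)"
  by (rule eq_if_lip_eq) (simp_all add: lip_ract lip_lact)

text \<open>
  Polarisation: \<open>\<langle>x,x\<rangle> + \<langle>y,y\<rangle> - \<langle>x,y\<rangle> - \<langle>y,x\<rangle> = \<langle>x - y, x - y\<rangle>\<close> is positive, so twice the unit is
  dominated by a sum of elements \<open>\<langle>w,w\<rangle>\<close>; conjugation by its inverse square root yields the unit.
\<close>

lemma rip_span_dominated:
  assumes "v \<in> right_ip_span D Y X X"
  shows "\<exists>ws. set ws \<subseteq> X \<and> D.pos ((\<Sum>w\<leftarrow>ws. rip Y w w) - (v + star D v)) \<and> v \<in> carrier D"
  using assms unfolding right_ip_span_def
proof (induction rule: D.vs.span_induct_alt)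
  case base
  show ?case
    by (intro exI[of _ "[]"]) (simp add: D.pos_zero)
next
  case (step c p v)
  obtain x y' where x: "x \<in> X" "y' \<in> X" and p: "p = rip Y x y'"
    using step(1) by auto
  \<comment> \<open>The coefficient c is absorbed into the linear argument of \<open>rip\<close>, so
    each summand is an inner product of two elements of \<open>X\<close>.\<close>
  define y where "y = scl Y c y'"
  have y: "y \<in> X"
    unfolding y_def by (rule Y.vs.subspace_scale[OF X_subspace x(2)])
  have xy [simp]: "x \<in> carrier Y" "y \<in> carrier Y" "y' \<in> carrier Y"
    using x y X_subset by auto
  obtain ws where ws: "set ws \<subseteq> X" "D.pos ((\<Sum>w\<leftarrow>ws. rip Y w w) - (v + star D v))" "v \<in> carrier D"
    using step by blast
  have cp: "scl D c p = rip Y x y"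
    by (simp add: p y_def rip_scl_right)
  have "D.pos (rip Y (x - y) (x - y))"
    by (intro rip_pos_X Y.vs.subspace_diff[OF X_subspace] x y)
  from D.pos_add[OF this ws(2)]
  have "D.pos ((\<Sum>w\<leftarrow>x # y # ws. rip Y w w) - (scl D c p + v + star D (scl D c p + v)))"
    using ws(3) by (simp add: cp D.star_add rip_star rip_diff_left rip_diff_right algebra_simps)
  then show ?case
    using x y ws by (intro exI[of _ "x # y # ws"]) (simp add: cp)
qed

lemma rip_unit_sum: obtains ws where "set ws \<subseteq> carrier Y" "(\<Sum>w\<leftarrow>ws. rip Y w w) = d1"
proof -
  obtain ws where ws: "set ws \<subseteq> X" "D.pos ((\<Sum>w\<leftarrow>ws. rip Y w w) - (d1 + d1))"
    using rip_span_dominated[OF rip_unit] by auto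
  let ?h = "\<Sum>w\<leftarrow>ws. rip Y w w"
  have "D.pos d1"
    using D.pos_square[OF D.selfadjoint_unit] by simp
  \<comment> \<open>The bound by twice the unit is weakened to h \<ge> 1, the hypothesis of
    \<open>inverse_sqrt\<close>.\<close>
  from D.pos_add[OF ws(2) this] have "D.pos (?h - d1)"
    by simp
  then obtain k where k: "D.selfadjoint k" "mul D (mul D k ?h) k = d1"
    by (rule D.inverse_sqrt)
  have kc [simp]: "k \<in> carrier D" using k by simp
  \<comment> \<open>Conjugating the sum by the selfadjoint k replaces each w by w k.\<close>
  have "set vs \<subseteq> X \<Longrightarrow> (\<Sum>w\<leftarrow>vs. rip Y w w) \<in> carrier D \<and>
      (\<Sum>w\<leftarrow>map (\<lambda>w. ract Y w k) vs. rip Y w w) = mul D (mul D k (\<Sum>w\<leftarrow>vs. rip Y w w)) k" for vs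
    using X_subset
    by (induction vs)
      (auto simp: subset_iff rip_ract rip_ract_left D.selfadjoint_star[OF k(1)] D.mul_distribs)
  from this[OF ws(1)] have "(\<Sum>w\<leftarrow>map (\<lambda>w. ract Y w k) ws. rip Y w w) = d1"
    using k by simp
  moreover have "set (map (\<lambda>w. ract Y w k) ws) \<subseteq> carrier Y"
    using ws X_subset by auto
  ultimately show thesis
    using that by blast
qed

lemma lip_pos:
  assumes x [simp]: "x \<in> carrier Y" shows "C.pos (lip Y x x)"
proof -
  obtain ws where ws: "set ws \<subseteq> carrier Y" "(\<Sum>w\<leftarrow>ws. rip Y w w) = d1"
    by (rule rip_unit_sum)
  have "set vs \<subseteq> carrier Y \<Longrightarrow> (\<Sum>w\<leftarrow>vs. rip Y w w) \<in> carrier D \<and>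
      C.pos (lip Y (ract Y x (\<Sum>w\<leftarrow>vs. rip Y w w)) x)" for vs
  proof (induction vs)
    case Nil
    show ?case
      using lip_scl_left[of 0 x 0] by (simp add: C.pos_zero)
  next
    case (Cons w vs)
    have [simp]: "w \<in> carrier Y" using Cons by simp
    have "C.pos (mul C (star C (lip Y w x)) (lip Y w x))"
      by (rule C.pos_star_mul) simp
    also have "mul C (star C (lip Y w x)) (lip Y w x) = lip Y (ract Y x (rip Y w w)) x"
      by (simp add: lip_star lip_lact flip: lip_lact_rip)
    finally show ?case
      using Cons by (simp add: ract_add_right lip_add_left C.pos_add)
  qed
  from this[OF ws(1)] show ?thesis
    by (simp add: ws(2) ract_unit)
qed

end

text \<open>The conjugate module, which exchanges the roles of \<open>C\<close> and
  \<open>D\<close>; it carries positivity, adjointability and the norm comparison from the left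
  inner product over to the right one.\<close>

definition dual_bimodule ::
  "('c, 'm) cstar_scheme \<Rightarrow> ('d, 'n) cstar_scheme \<Rightarrow> ('c, 'd, 'y, 'q) bimodule_scheme
    \<Rightarrow> ('d, 'c, 'y) bimodule"
  where "dual_bimodule C D Y = \<lparr>carrier = carrier Y, scl = (\<lambda>c. scl Y (cnj c)),
    lact = (\<lambda>d y. ract Y y (star D d)), ract = (\<lambda>y c. lact Y (star C c) y),
    lip = rip Y, rip = lip Y\<rparr>"

context pre_bimodule
begin

lemma dual_sel:
  "carrier (dual_bimodule C D Y) = carrier Y" "scl (dual_bimodule C D Y) = (\<lambda>c. scl Y (cnj c))"
  "lact (dual_bimodule C D Y) = (\<lambda>d y. ract Y y (star D d))"
  "ract (dual_bimodule C D Y) = (\<lambda>y c. lact Y (star C c) y)"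
  "lip (dual_bimodule C D Y) = rip Y" "rip (dual_bimodule C D Y) = lip Y"
  by (simp_all add: dual_bimodule_def)

lemma dual: "pre_bimodule D d1 C c1 (dual_bimodule C D Y) X"
proof (intro pre_bimodule.intro pre_bimodule_axioms.intro C.unital_cstar_algebra_axioms
    D.unital_cstar_algebra_axioms)
  have vs: "vector_space (scl (dual_bimodule C D Y))"
    by unfold_locales (auto simp: dual_sel Y.vs.scale_left_distrib Y.vs.scale_right_distrib)
  have sub: "module.subspace (scl (dual_bimodule C D Y)) S" if S: "Y.vs.subspace S" for S
  proof -
    interpret vs: vector_space "scl (dual_bimodule C D Y)" by (rule vs)
    show ?thesis
      using S unfolding vs.subspace_def Y.vs.subspace_def by (simp add: dual_sel)
  qed
  show "complex_space (dual_bimodule C D Y)"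
    using vs sub Y.subspace by (intro complex_space.intro) (simp_all add: dual_sel)
  show "module.subspace (scl (dual_bimodule C D Y)) X"
    by (rule sub[OF X_subspace])
  have [simp]: "lact Y (lip Y z y) x = ract Y z (rip Y y x)"
    if "x \<in> carrier Y" "y \<in> carrier Y" "z \<in> carrier Y" for x y z
    using that by (simp add: lip_lact_rip)
  show "bilinear_map D (dual_bimodule C D Y) (dual_bimodule C D Y) (lact (dual_bimodule C D Y))"
    by (auto simp: bilinear_map_def semilinear_map_def dual_sel D.star_distribs ract_add_left
        ract_add_right ract_scl_left ract_scl_right)
  show "bilinear_map (dual_bimodule C D Y) C (dual_bimodule C D Y) (ract (dual_bimodule C D Y))"
    by (auto simp: bilinear_map_def semilinear_map_def dual_sel C.star_distribs lact_add_left
        lact_add_right lact_scl_left lact_scl_right)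
  show "linear_map (dual_bimodule C D Y) D (\<lambda>x. lip (dual_bimodule C D Y) x y)"
    if "y \<in> carrier (dual_bimodule C D Y)" for y
    using that by (auto simp: semilinear_map_def dual_sel rip_add_left rip_scl_left)
  show "linear_map (dual_bimodule C D Y) C (\<lambda>y. rip (dual_bimodule C D Y) x y)"
    if "x \<in> carrier (dual_bimodule C D Y)" for x
    using that by (auto simp: semilinear_map_def dual_sel lip_add_right lip_scl_right)
  show "rip (dual_bimodule C D Y) x (ract (dual_bimodule C D Y) y c)
      = mul C (rip (dual_bimodule C D Y) x y) c"
    if "x \<in> carrier (dual_bimodule C D Y)" "y \<in> carrier (dual_bimodule C D Y)" "c \<in> carrier C"
    for x y c
    using that arg_cong[OF lip_lact[of "star C c" y x], of "star C"]
    by (simp add: dual_sel lip_star C.star_distribs)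
qed (use X_subset lip_unit rip_unit in
    \<open>simp_all add: dual_sel rip_ract_left D.star_star rip_star lip_star rip_definite lip_definite
      lip_lact_rip lip_pos_X rip_pos_X left_ip_span_def right_ip_span_def\<close>)

lemma rip_pos: "x \<in> carrier Y \<Longrightarrow> D.pos (rip Y x x)"
  using pre_bimodule.lip_pos[OF dual, of x] by (simp add: dual_sel)

lemma rip_lact: "c \<in> carrier C \<Longrightarrow> x \<in> carrier Y \<Longrightarrow> y \<in> carrier Y
    \<Longrightarrow> rip Y (lact Y c x) y = rip Y x (lact Y (star C c) y)"
  using pre_bimodule.lip_ract[OF dual, of x "star C c" y] by (simp add: dual_sel C.star_star)

text \<open>For positive q = k^2, the element \<open>lip Y (ract Y y q) y\<close> is the inner
  product of y k with itself, hence positive. Apply this to p and to norm(p) - p and use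
  monotonicity of the norm.\<close>

lemma norm_lip_ract_le:
  assumes p: "D.pos p" and y [simp]: "y \<in> carrier Y"
  shows "nrm C (lip Y (ract Y y p) y) \<le> nrm D p * nrm C (lip Y y y)"
proof -
  have pos: "C.pos (lip Y (ract Y y q) y)" if q: "D.pos q" for q
  proof -
    obtain k where k: "D.selfadjoint k" "q = mul D k k"
      using q by (auto simp: D.pos_def)
    then have "lip Y (ract Y y q) y = lip Y (ract Y y k) (ract Y y k)"
      by (simp add: ract_ract lip_ract D.selfadjoint_star)
    then show ?thesis
      using lip_pos[of "ract Y y k"] k by simp
  qed
  have pc [simp]: "p \<in> carrier D"
    using p by simp
  have "D.pos (scl D (of_real (nrm D p)) d1 - p)"
    using p by (intro D.pos_scalar_minus D.pos_selfadjoint) auto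
  from pos[OF this] have "C.pos (scl C (of_real (nrm D p)) (lip Y y y) - lip Y (ract Y y p) y)"
    using ract_add_right[of y "scl D (of_real (nrm D p)) d1" "- p"]
    by (simp add: ract_minus_right ract_scl_right ract_unit lip_diff_left lip_scl_left)
  from C.norm_mono[OF pos[OF p] this] show ?thesis
    by (simp add: C.norm_scl D.norm_nonneg)
qed

section \<open>Equality of the two norms and the norm axioms\<close>

lemma left_norm_square: "x \<in> carrier Y \<Longrightarrow> (left_norm C Y x)\<^sup>2 = nrm C (lip Y x x)"
  by (simp add: left_norm_def C.norm_nonneg)

lemma left_norm_nonneg: "x \<in> carrier Y \<Longrightarrow> 0 \<le> left_norm C Y x"
  by (simp add: left_norm_def C.norm_nonneg)

text \<open>By compatibility, the square of \<open>lip Y x x\<close> is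
  \<open>lip Y (ract Y x (rip Y x x)) x\<close>, whose norm is at most
  norm(\<open>rip Y x x\<close>) norm(\<open>lip Y x x\<close>); cancel one factor. The dual module
  gives the reverse inequality.\<close>

lemma left_norm_le_right_norm:
  assumes x [simp]: "x \<in> carrier Y" shows "left_norm C Y x \<le> right_norm D Y x"
proof (cases "lip Y x x = 0")
  case True
  then show ?thesis
    by (simp add: left_norm_def right_norm_def D.norm_nonneg)
next
  case False
  then have *: "0 < nrm C (lip Y x x)"
    using C.norm_nonneg[of "lip Y x x"] C.norm_eq_0[of "lip Y x x"] by simp
  have "(nrm C (lip Y x x))\<^sup>2 = nrm C (lip Y (ract Y x (rip Y x x)) x)"
    using C.norm_square[of "lip Y x x"]
    by (simp add: C.selfadjoint_def lip_star lip_lact flip: lip_lact_rip)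
  also have "\<dots> \<le> nrm D (rip Y x x) * nrm C (lip Y x x)"
    by (rule norm_lip_ract_le) (simp_all add: rip_pos)
  finally have "nrm C (lip Y x x) \<le> nrm D (rip Y x x)"
    using * by (simp add: power2_eq_square)
  then show ?thesis
    by (simp add: left_norm_def right_norm_def)
qed

lemma right_norm_eq_left_norm: "x \<in> carrier Y \<Longrightarrow> right_norm D Y x = left_norm C Y x"
  using left_norm_le_right_norm[of x] pre_bimodule.left_norm_le_right_norm[OF dual, of x]
  by (simp add: left_norm_def right_norm_def dual_sel)

text \<open>Cauchy-Schwarz from compatibility: the adjoint of \<open>lip Y x y\<close> times itself
  is \<open>lip Y (ract Y y (rip Y x x)) y\<close>, and both inner products give x the same
  norm.\<close>

lemma norm_lip_le:
  assumes x [simp]: "x \<in> carrier Y" and y [simp]: "y \<in> carrier Y"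
  shows "nrm C (lip Y x y) \<le> left_norm C Y x * left_norm C Y y"
proof (rule power2_le_imp_le)
  have "(nrm C (lip Y x y))\<^sup>2 = nrm C (lip Y (ract Y y (rip Y x x)) y)"
    using C.cstar_identity[of "lip Y x y"]
    by (simp add: lip_star flip: lip_lact_rip lip_lact)
  also have "\<dots> \<le> nrm D (rip Y x x) * nrm C (lip Y y y)"
    by (rule norm_lip_ract_le) (simp_all add: rip_pos)
  also have "nrm D (rip Y x x) = (right_norm D Y x)\<^sup>2"
    by (simp add: right_norm_def D.norm_nonneg)
  finally show "(nrm C (lip Y x y))\<^sup>2 \<le> (left_norm C Y x * left_norm C Y y)\<^sup>2"
    by (simp add: right_norm_eq_left_norm left_norm_square power_mult_distrib)
qed (simp add: left_norm_nonneg)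

lemma complex_normed_left_norm:
  assumes S: "S \<subseteq> carrier Y" "Y.vs.subspace S"
  shows "complex_normed \<lparr>carrier = S, scl = scl Y, nrm = left_norm C Y\<rparr>"
proof (intro complex_normed.intro complex_space.intro complex_normed_axioms.intro; simp)
  have *: "x \<in> carrier Y" if "x \<in> S" for x
    using that S by blast
  show "vector_space (scl Y)" "Y.vs.subspace S"
    by (fact Y.vector_space S)+
  show "0 \<le> left_norm C Y x" if "x \<in> S" for x
    by (rule left_norm_nonneg[OF *[OF that]])
  show "left_norm C Y x = 0 \<longleftrightarrow> x = 0" if "x \<in> S" for x
    using *[OF that] C.norm_eq_0[of "lip Y x x"] lip_definite[of x] lip_scl_left[of 0 0 0]
    by (auto simp: left_norm_def)
  show "left_norm C Y (scl Y c x) = cmod c * left_norm C Y x" if "x \<in> S" for c x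
    using *[OF that]
    by (simp add: left_norm_def lip_scl_left lip_scl_right C.norm_scl real_sqrt_mult norm_mult
        flip: mult.assoc)
  show "left_norm C Y (x + y) \<le> left_norm C Y x + left_norm C Y y" if "x \<in> S" "y \<in> S" for x y
  proof (rule power2_le_imp_le)
    note xy [simp] = *[OF that(1)] *[OF that(2)]
    have "nrm C (lip Y x y) \<le> left_norm C Y x * left_norm C Y y"
      "nrm C (lip Y y x) \<le> left_norm C Y x * left_norm C Y y"
      using norm_lip_le[of x y] norm_lip_le[of y x] by (simp_all add: mult.commute)
    moreover have "nrm C ((lip Y x x + lip Y x y) + (lip Y y x + lip Y y y))
        \<le> (nrm C (lip Y x x) + nrm C (lip Y x y)) + (nrm C (lip Y y x) + nrm C (lip Y y y))"
      by (intro order_trans[OF C.norm_triangle] add_mono C.norm_triangle) auto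
    ultimately show "(left_norm C Y (x + y))\<^sup>2 \<le> (left_norm C Y x + left_norm C Y y)\<^sup>2"
      by (simp add: left_norm_square power2_sum lip_add_left lip_add_right algebra_simps)
  qed (simp add: left_norm_nonneg *[OF that(1)] *[OF that(2)])
qed

lemma equivalence_bimodule:
  assumes complete: "complete_wrt (carrier Y) (left_norm C Y)"
    and left_full: "left_ip_span C Y (carrier Y) (carrier Y) = carrier C"
    and right_full: "right_ip_span D Y (carrier Y) (carrier Y) = carrier D"
  shows "equivalence_bimodule C D Y"
proof (intro equivalence_bimodule.intro equivalence_bimodule_axioms.intro C.cstar_algebra_axioms
    D.cstar_algebra_axioms Y.complex_space_axioms)
  have "norm_dist (carrier Y) (right_norm D Y) = norm_dist (carrier Y) (left_norm C Y)"
    by (auto simp: norm_dist_def right_norm_eq_left_norm fun_eq_iff)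
  with complete show "complete_wrt (carrier Y) (right_norm D Y)"
    by (simp add: complete_wrt_def)
  show "dense_wrt (carrier C) (nrm C) (left_ip_span C Y (carrier Y) (carrier Y))"
    unfolding left_full by (rule C.dense_wrt_carrier)
  show "dense_wrt (carrier D) (nrm D) (right_ip_span D Y (carrier Y) (carrier Y))"
    unfolding right_full by (rule D.dense_wrt_carrier)
qed (fact lact_bilinear ract_bilinear lact_lact ract_ract lact_ract lip_linear rip_linear lip_lact
    rip_ract lip_star rip_star lip_definite rip_definite rip_lact lip_ract lip_lact_rip complete
    | simp add: C.positive_in_iff_pos D.positive_in_iff_pos lip_pos rip_pos)+

end

text \<open>\<open>X\<close> is a pre-bimodule over \<open>A\<close> and \<open>B\<close>, with
  itself as the distinguished subspace. Positivity is assumed in the subalgebras, because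
  \<open>positive_in\<close> asks for the factor b inside the carrier.\<close>

lemma (in pre_bimodule) equivalence_bimodule_restrict:
  assumes A: "cstar_algebra (C\<lparr>carrier := A\<rparr>)" "A \<subseteq> carrier C" "c1 \<in> A"
    and B: "cstar_algebra (D\<lparr>carrier := B\<rparr>)" "B \<subseteq> carrier D" "d1 \<in> B"
    and lact: "\<And>a x. a \<in> A \<Longrightarrow> x \<in> X \<Longrightarrow> lact Y a x \<in> X"
    and ract: "\<And>x b. x \<in> X \<Longrightarrow> b \<in> B \<Longrightarrow> ract Y x b \<in> X"
    and lip: "\<And>x y. x \<in> X \<Longrightarrow> y \<in> X \<Longrightarrow> lip Y x y \<in> A"
    and rip: "\<And>x y. x \<in> X \<Longrightarrow> y \<in> X \<Longrightarrow> rip Y x y \<in> B"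
    and lip_positive: "\<And>x. x \<in> X \<Longrightarrow> positive_in (C\<lparr>carrier := A\<rparr>) (lip Y x x)"
    and rip_positive: "\<And>x. x \<in> X \<Longrightarrow> positive_in (D\<lparr>carrier := B\<rparr>) (rip Y x x)"
    and left_full: "left_ip_span C Y X X = A"
    and right_full: "right_ip_span D Y X X = B"
    and complete: "complete_wrt X (left_norm C Y)"
  shows "equivalence_bimodule (C\<lparr>carrier := A\<rparr>) (D\<lparr>carrier := B\<rparr>) (Y\<lparr>carrier := X\<rparr>)"
proof -
  have a: "c \<in> carrier C" if "c \<in> A" for c using that A by blast
  have b: "d \<in> carrier D" if "d \<in> B" for d using that B by blast
  have x: "y \<in> carrier Y" if "y \<in> X" for y using that X_subset by blast
  interpret A: cstar_algebra "C\<lparr>carrier := A\<rparr>" by (rule A)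
  interpret B: cstar_algebra "D\<lparr>carrier := B\<rparr>" by (rule B)
  interpret A: unital_cstar_algebra "C\<lparr>carrier := A\<rparr>" c1
    by unfold_locales (simp add: is_unit_of_def a A)
  interpret B: unital_cstar_algebra "D\<lparr>carrier := B\<rparr>" d1
    by unfold_locales (simp add: is_unit_of_def b B)
  have left: "left_ip_span (C\<lparr>carrier := A\<rparr>) (Y\<lparr>carrier := X\<rparr>) X X = A"
    and right: "right_ip_span (D\<lparr>carrier := B\<rparr>) (Y\<lparr>carrier := X\<rparr>) X X = B"
    using left_full right_full by (simp_all add: left_ip_span_def right_ip_span_def)
  interpret X: pre_bimodule "C\<lparr>carrier := A\<rparr>" c1 "D\<lparr>carrier := B\<rparr>" d1 "Y\<lparr>carrier := X\<rparr>" X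
  proof (intro pre_bimodule.intro pre_bimodule_axioms.intro A.unital_cstar_algebra_axioms
      B.unital_cstar_algebra_axioms complex_space.intro)
    show "bilinear_map (C\<lparr>carrier := A\<rparr>) (Y\<lparr>carrier := X\<rparr>) (Y\<lparr>carrier := X\<rparr>) (lact (Y\<lparr>carrier := X\<rparr>))"
      by (simp add: bilinear_map_def semilinear_map_def a x lact lact_add_left lact_add_right
          lact_scl_left lact_scl_right)
    show "bilinear_map (Y\<lparr>carrier := X\<rparr>) (D\<lparr>carrier := B\<rparr>) (Y\<lparr>carrier := X\<rparr>) (ract (Y\<lparr>carrier := X\<rparr>))"
      by (simp add: bilinear_map_def semilinear_map_def b x ract ract_add_left ract_add_right
          ract_scl_left ract_scl_right)
    show "linear_map (Y\<lparr>carrier := X\<rparr>) (C\<lparr>carrier := A\<rparr>) (\<lambda>x. lip (Y\<lparr>carrier := X\<rparr>) x y)"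
      if "y \<in> carrier (Y\<lparr>carrier := X\<rparr>)" for y
      using that by (simp add: semilinear_map_def x lip lip_add_left lip_scl_left)
    show "linear_map (Y\<lparr>carrier := X\<rparr>) (D\<lparr>carrier := B\<rparr>) (\<lambda>y. rip (Y\<lparr>carrier := X\<rparr>) z y)"
      if "z \<in> carrier (Y\<lparr>carrier := X\<rparr>)" for z
      using that by (simp add: semilinear_map_def x rip rip_add_right rip_scl_right)
  qed (simp_all add: left right A B a b x Y.vector_space X_subspace lip_lact rip_ract lip_star
      rip_star lip_definite rip_definite lip_lact_rip lip_positive rip_positive
      flip: A.positive_in_iff_pos B.positive_in_iff_pos)
  show ?thesis
    using complete
    by (intro X.equivalence_bimodule) (simp_all add: left right left_norm_def[abs_def])
qed

section \<open>The bimodule of sections of an equivalence bundle\<close>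

definition section_bimodule ::
  "('g, 'k) monoid_scheme \<Rightarrow> ('g, 'a::ab_group_add, 'b::ab_group_add, 'x::ab_group_add, 'l) equiv_bundle_scheme
    \<Rightarrow> ('g \<Rightarrow> 'a, 'g \<Rightarrow> 'b, 'g \<Rightarrow> 'x) bimodule"
  where "section_bimodule G \<X> =
    \<lparr>carrier = sections G \<X>, scl = (\<lambda>c f t. fscl \<X> c (f t)),
     lact = conv G (\<lambda>t s. t \<otimes>\<^bsub>G\<^esub> s) (elact \<X>),
     ract = conv G (\<lambda>t s. t \<otimes>\<^bsub>G\<^esub> s) (eract \<X>),
     lip = conv G (\<lambda>t s. t \<otimes>\<^bsub>G\<^esub> inv\<^bsub>G\<^esub> s) (elip \<X>),
     rip = conv G (\<lambda>t s. inv\<^bsub>G\<^esub> t \<otimes>\<^bsub>G\<^esub> s) (erip \<X>)\<rparr>"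

locale full_equivalence_bundle =
  equivalence_bundle G \<A> \<B> \<X> +
  AU: unital_cstar_bundle G \<A> u + BU: unital_cstar_bundle G \<B> v
  for G :: "('g, 'k) monoid_scheme" (structure)
    and \<A> :: "('g, 'a::ab_group_add, 'm) fell_bundle_scheme"
    and \<B> :: "('g, 'b::ab_group_add, 'n) fell_bundle_scheme"
    and \<X> :: "('g, 'a, 'b, 'x::ab_group_add, 'l) equiv_bundle_scheme"
    and u :: 'a and v :: 'b +
  assumes elip_span: "t \<in> carrier G \<Longrightarrow> s \<in> carrier G \<Longrightarrow>
      module.span (fscl \<A>) {elip \<X> t s x y | x y. x \<in> fset \<X> t \<and> y \<in> fset \<X> s}
        = fset \<A> (t \<otimes> inv s)"
    and erip_span: "t \<in> carrier G \<Longrightarrow> s \<in> carrier G \<Longrightarrow>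
      module.span (fscl \<B>) {erip \<X> t s x y | x y. x \<in> fset \<X> t \<and> y \<in> fset \<X> s}
        = fset \<B> (inv t \<otimes> s)"
begin

sublocale XS: section_space G \<X>
  by (intro section_space.intro section_space_axioms.intro A.is_group AU.finite_carrier X_banach)

lemma elip_closed: "t \<in> carrier G \<Longrightarrow> s \<in> carrier G \<Longrightarrow> x \<in> fset \<X> t \<Longrightarrow> y \<in> fset \<X> s
    \<Longrightarrow> elip \<X> t s x y \<in> fset \<A> (t \<otimes> inv s)"
  using elip_linear[of t s y] by (simp add: semilinear_map_def fibre_def)

lemma erip_closed: "t \<in> carrier G \<Longrightarrow> s \<in> carrier G \<Longrightarrow> x \<in> fset \<X> t \<Longrightarrow> y \<in> fset \<X> s
    \<Longrightarrow> erip \<X> t s x y \<in> fset \<B> (inv t \<otimes> s)"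
  using erip_linear[of t s x] by (simp add: semilinear_map_def fibre_def)

lemma elip_add_left: "t \<in> carrier G \<Longrightarrow> s \<in> carrier G \<Longrightarrow> x \<in> fset \<X> t \<Longrightarrow> x' \<in> fset \<X> t
    \<Longrightarrow> y \<in> fset \<X> s \<Longrightarrow> elip \<X> t s (x + x') y = elip \<X> t s x y + elip \<X> t s x' y"
  using elip_linear[of t s y] by (simp add: semilinear_map_def fibre_def)

lemma erip_add_right: "t \<in> carrier G \<Longrightarrow> s \<in> carrier G \<Longrightarrow> x \<in> fset \<X> t \<Longrightarrow> y \<in> fset \<X> s
    \<Longrightarrow> y' \<in> fset \<X> s \<Longrightarrow> erip \<X> t s x (y + y') = erip \<X> t s x y + erip \<X> t s x y'"
  using erip_linear[of t s x] by (simp add: semilinear_map_def fibre_def)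

lemma elip_add_right:
  assumes "t \<in> carrier G" "s \<in> carrier G" "x \<in> fset \<X> t" "y \<in> fset \<X> s" "y' \<in> fset \<X> s"
  shows "elip \<X> t s x (y + y') = elip \<X> t s x y + elip \<X> t s x y'"
proof -
  have "elip \<X> t s x (y + y') = bstar \<A> (s \<otimes> inv t) (elip \<X> s t (y + y') x)"
    using assms by (simp add: elip_star)
  also have "\<dots> = bstar \<A> (s \<otimes> inv t) (elip \<X> s t y x) + bstar \<A> (s \<otimes> inv t) (elip \<X> s t y' x)"
    using assms by (simp add: elip_add_left AU.bstar_add elip_closed)
  finally show ?thesis
    using assms by (simp add: elip_star)
qed

lemma erip_add_left:
  assumes "t \<in> carrier G" "s \<in> carrier G" "x \<in> fset \<X> t" "x' \<in> fset \<X> t" "y \<in> fset \<X> s"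
  shows "erip \<X> t s (x + x') y = erip \<X> t s x y + erip \<X> t s x' y"
proof -
  have "erip \<X> t s (x + x') y = bstar \<B> (inv s \<otimes> t) (erip \<X> s t y (x + x'))"
    using assms by (simp add: erip_star)
  also have "\<dots> = bstar \<B> (inv s \<otimes> t) (erip \<X> s t y x) + bstar \<B> (inv s \<otimes> t) (erip \<X> s t y x')"
    using assms by (simp add: erip_add_right BU.bstar_add erip_closed)
  finally show ?thesis
    using assms by (simp add: erip_star)
qed

sublocale la: graded_pairing G \<A> \<X> \<X> "\<lambda>t s. t \<otimes> s" "elact \<X>"
proof
  fix t s a x assume ts: "t \<in> carrier G" "s \<in> carrier G"
  note b = elact_bilinear[OF ts, unfolded bilinear_map_def semilinear_map_def fibre_def, simplified]
  show "elact \<X> t s a x \<in> fset \<X> (t \<otimes> s)" if "a \<in> fset \<A> t" "x \<in> fset \<X> s"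
    using b that by blast
  show "elact \<X> t s (a + a') x = elact \<X> t s a x + elact \<X> t s a' x"
    if "a \<in> fset \<A> t" "a' \<in> fset \<A> t" "x \<in> fset \<X> s" for a'
    using b that by blast
  show "elact \<X> t s a (x + x') = elact \<X> t s a x + elact \<X> t s a x'"
    if "a \<in> fset \<A> t" "x \<in> fset \<X> s" "x' \<in> fset \<X> s" for x'
    using b that by blast
qed simp

sublocale ra: graded_pairing G \<X> \<B> \<X> "\<lambda>t s. t \<otimes> s" "eract \<X>"
proof
  fix t s a x assume ts: "t \<in> carrier G" "s \<in> carrier G"
  note b = eract_bilinear[OF ts, unfolded bilinear_map_def semilinear_map_def fibre_def, simplified]
  show "eract \<X> t s x a \<in> fset \<X> (t \<otimes> s)" if "x \<in> fset \<X> t" "a \<in> fset \<B> s"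
    using b that by blast
  show "eract \<X> t s (x + x') a = eract \<X> t s x a + eract \<X> t s x' a"
    if "x \<in> fset \<X> t" "x' \<in> fset \<X> t" "a \<in> fset \<B> s" for x'
    using b that by blast
  show "eract \<X> t s x (a + a') = eract \<X> t s x a + eract \<X> t s x a'"
    if "x \<in> fset \<X> t" "a \<in> fset \<B> s" "a' \<in> fset \<B> s" for a'
    using b that by blast
qed simp

sublocale li: graded_pairing G \<X> \<X> \<A> "\<lambda>t s. t \<otimes> inv s" "elip \<X>"
  by unfold_locales (simp_all add: elip_closed elip_add_left elip_add_right)

sublocale ri: graded_pairing G \<X> \<X> \<B> "\<lambda>t s. inv t \<otimes> s" "erip \<X>"
  by unfold_locales (simp_all add: erip_closed erip_add_left erip_add_right)

abbreviation "Y \<equiv> section_bimodule G \<X>"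
abbreviation "X0 \<equiv> single \<one> ` fset \<X> \<one>"

lemma Y_sel:
  "carrier Y = sections G \<X>" "scl Y = (\<lambda>c f t. fscl \<X> c (f t))"
  "lact Y = conv G (\<lambda>t s. t \<otimes> s) (elact \<X>)" "ract Y = conv G (\<lambda>t s. t \<otimes> s) (eract \<X>)"
  "lip Y = conv G (\<lambda>t s. t \<otimes> inv s) (elip \<X>)" "rip Y = conv G (\<lambda>t s. inv t \<otimes> s) (erip \<X>)"
  by (simp_all add: section_bimodule_def)

lemma complex_space_Y: "complex_space Y"
  by (rule XS.sections_complex_space) (simp_all add: Y_sel)

lemma X0_subset: "X0 \<subseteq> carrier Y"
  by (auto simp: Y_sel)

lemma X0_subspace: "module.subspace (scl Y) X0"
proof -
  interpret Y: complex_space Y by (rule complex_space_Y)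
  show ?thesis
    unfolding Y.vs.subspace_def unfolding Y_sel
    by (auto simp flip: single_add XS.single_scl intro: image_eqI[of 0 "single \<one>" 0])
qed

text \<open>Degrees t and s contribute in degree e only if t = s. The terms are positive, whence
  definiteness of the inner product and bounds for the coordinates.\<close>

lemma lip_Y_one:
  "lip Y f f \<one> = (\<Sum>t\<in>carrier G. elip \<X> t t (f t) (f t))"
proof -
  have "(\<one> = t \<otimes> inv s) = (s = t)" if "t \<in> carrier G" "s \<in> carrier G" for t s
    using that by (metis A.inv_closed A.inv_equality A.inv_inv A.r_inv)
  then show ?thesis
    using XS.finite_group by (simp add: Y_sel li.conv_apply cong: sum.cong)
qed

lemma rip_Y_one:
  "rip Y f f \<one> = (\<Sum>t\<in>carrier G. erip \<X> t t (f t) (f t))"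
proof -
  have "(\<one> = inv t \<otimes> s) = (s = t)" if "t \<in> carrier G" "s \<in> carrier G" for t s
    using that by (metis A.inv_closed A.inv_equality A.inv_inv A.l_inv)
  then show ?thesis
    using XS.finite_group by (simp add: Y_sel ri.conv_apply cong: sum.cong)
qed

lemma elip_pos: "t \<in> carrier G \<Longrightarrow> x \<in> fset \<X> t \<Longrightarrow> AU.A.pos (elip \<X> t t x x)"
  using elip_positive by (simp add: AU.A.positive_in_iff_pos)

lemma erip_pos: "t \<in> carrier G \<Longrightarrow> x \<in> fset \<X> t \<Longrightarrow> BU.A.pos (erip \<X> t t x x)"
  using erip_positive by (simp add: BU.A.positive_in_iff_pos)

lemma lip_Y_X0_positive:
  assumes "f \<in> X0"
  shows "positive_in (AU.C\<lparr>carrier := unit_fibre_sections G \<A>\<rparr>) (lip Y f f)"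
proof -
  obtain x where x: "x \<in> fset \<X> \<one>" "f = single \<one> x"
    using assms by auto
  then obtain b where b: "b \<in> fset \<A> \<one>" "elip \<X> \<one> \<one> x x = bmul \<A> \<one> \<one> (bstar \<A> \<one> b) b"
    using elip_positive[of \<one> x] by (auto simp: positive_in_def)
  have "lip Y f f = mul AU.C (star AU.C (single \<one> b)) (single \<one> b)"
    using x b AU.bstar_closed[of \<one> b] AU.star_section_single[of \<one> b "section_norm G \<A>"]
    by (simp add: Y_sel li.conv_single AU.C_sel(4) AU.prod.conv_single flip: section_algebra_def)
  then show ?thesis
    using b by (auto simp: positive_in_def AU.unit_fibre_sections_eq)
qed

lemma rip_Y_X0_positive:
  assumes "f \<in> X0"
  shows "positive_in (BU.C\<lparr>carrier := unit_fibre_sections G \<B>\<rparr>) (rip Y f f)"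
proof -
  obtain x where x: "x \<in> fset \<X> \<one>" "f = single \<one> x"
    using assms by auto
  then obtain b where b: "b \<in> fset \<B> \<one>" "erip \<X> \<one> \<one> x x = bmul \<B> \<one> \<one> (bstar \<B> \<one> b) b"
    using erip_positive[of \<one> x] by (auto simp: positive_in_def)
  have "rip Y f f = mul BU.C (star BU.C (single \<one> b)) (single \<one> b)"
    using x b BU.bstar_closed[of \<one> b] BU.star_section_single[of \<one> b "section_norm G \<B>"]
    by (simp add: Y_sel ri.conv_single BU.C_sel(4) BU.prod.conv_single flip: section_algebra_def)
  then show ?thesis
    using b by (auto simp: positive_in_def BU.unit_fibre_sections_eq)
qed

text \<open>Transfers the span hypothesis on fibres to homogeneous sections. \<open>S\<close> and
  \<open>T\<close> are arbitrary supersets so that the spans over \<open>X0\<close> and over all of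
  \<open>Y\<close> are both covered.\<close>

lemma single_in_left_ip_span:
  assumes ts: "t \<in> carrier G" "s \<in> carrier G" and a: "a \<in> fset \<A> (t \<otimes> inv s)"
    and S: "single t ` fset \<X> t \<subseteq> S" and T: "single s ` fset \<X> s \<subseteq> T"
  shows "single (t \<otimes> inv s) a \<in> left_ip_span AU.C Y S T"
proof -
  have "a \<in> AU.fs.span {elip \<X> t s x y | x y. x \<in> fset \<X> t \<and> y \<in> fset \<X> s}"
    using a elip_span[OF ts] by simp
  then show ?thesis
  proof (induction rule: AU.fs.span_induct_alt)
    case base
    show ?case
      unfolding left_ip_span_def single_zero by (rule AU.C.vs.span_zero)
  next
    case (step c p b)
    then obtain x y where xy: "x \<in> fset \<X> t" "y \<in> fset \<X> s" "p = elip \<X> t s x y"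
      by auto
    have "lip Y (single t x) (single s y) \<in> left_ip_span AU.C Y S T"
      unfolding left_ip_span_def using S T xy(1,2) by (intro AU.C.vs.span_base) blast
    then have "single (t \<otimes> inv s) p \<in> left_ip_span AU.C Y S T"
      using ts xy by (simp add: Y_sel li.conv_single)
    then have "scl AU.C c (single (t \<otimes> inv s) p) + single (t \<otimes> inv s) b \<in> left_ip_span AU.C Y S T"
      using step(2) unfolding left_ip_span_def by (intro AU.C.vs.span_add AU.C.vs.span_scale)
    then show ?case
      by (simp add: AU.C_sel(2) single_add AU.single_scl del: plus_fun_apply)
  qed
qed

lemma single_in_right_ip_span:
  assumes ts: "t \<in> carrier G" "s \<in> carrier G" and a: "a \<in> fset \<B> (inv t \<otimes> s)"
    and S: "single t ` fset \<X> t \<subseteq> S" and T: "single s ` fset \<X> s \<subseteq> T"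
  shows "single (inv t \<otimes> s) a \<in> right_ip_span BU.C Y S T"
proof -
  have "a \<in> BU.fs.span {erip \<X> t s x y | x y. x \<in> fset \<X> t \<and> y \<in> fset \<X> s}"
    using a erip_span[OF ts] by simp
  then show ?thesis
  proof (induction rule: BU.fs.span_induct_alt)
    case base
    show ?case
      unfolding right_ip_span_def single_zero by (rule BU.C.vs.span_zero)
  next
    case (step c p b)
    then obtain x y where xy: "x \<in> fset \<X> t" "y \<in> fset \<X> s" "p = erip \<X> t s x y"
      by auto
    have "rip Y (single t x) (single s y) \<in> right_ip_span BU.C Y S T"
      unfolding right_ip_span_def using S T xy(1,2) by (intro BU.C.vs.span_base) blast
    then have "single (inv t \<otimes> s) p \<in> right_ip_span BU.C Y S T"
      using ts xy by (simp add: Y_sel ri.conv_single)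
    then have "scl BU.C c (single (inv t \<otimes> s) p) + single (inv t \<otimes> s) b \<in> right_ip_span BU.C Y S T"
      using step(2) unfolding right_ip_span_def by (intro BU.C.vs.span_add BU.C.vs.span_scale)
    then show ?case
      by (simp add: BU.C_sel(2) single_add BU.single_scl del: plus_fun_apply)
  qed
qed

section \<open>The spans of the inner products\<close>

lemma lip_Y_X0: "f \<in> X0 \<Longrightarrow> g \<in> X0 \<Longrightarrow> lip Y f g \<in> unit_fibre_sections G \<A>"
  using elip_closed[of \<one> \<one>] by (auto simp: Y_sel li.conv_single AU.unit_fibre_sections_eq)

lemma rip_Y_X0: "f \<in> X0 \<Longrightarrow> g \<in> X0 \<Longrightarrow> rip Y f g \<in> unit_fibre_sections G \<B>"
  using erip_closed[of \<one> \<one>] by (auto simp: Y_sel ri.conv_single BU.unit_fibre_sections_eq)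

lemma left_span_X0: "left_ip_span AU.C Y X0 X0 = unit_fibre_sections G \<A>"
proof (rule antisym)
  show "left_ip_span AU.C Y X0 X0 \<subseteq> unit_fibre_sections G \<A>"
    unfolding left_ip_span_def
    by (rule AU.C.vs.span_minimal) (auto intro: AU.unit_fibre_sections_subspace lip_Y_X0)
  show "unit_fibre_sections G \<A> \<subseteq> left_ip_span AU.C Y X0 X0"
    using single_in_left_ip_span[of \<one> \<one>] by (auto simp: AU.unit_fibre_sections_eq)
qed

lemma right_span_X0: "right_ip_span BU.C Y X0 X0 = unit_fibre_sections G \<B>"
proof (rule antisym)
  show "right_ip_span BU.C Y X0 X0 \<subseteq> unit_fibre_sections G \<B>"
    unfolding right_ip_span_def
    by (rule BU.C.vs.span_minimal) (auto intro: BU.unit_fibre_sections_subspace rip_Y_X0)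
  show "unit_fibre_sections G \<B> \<subseteq> right_ip_span BU.C Y X0 X0"
    using single_in_right_ip_span[of \<one> \<one>] by (auto simp: BU.unit_fibre_sections_eq)
qed

text \<open>The pair of degrees (t, e) already produces every element of degree t, so the second
  argument may be confined to \<open>X0\<close>. Taking T = \<open>carrier Y\<close> gives fullness
  of \<open>Y\<close>, and T = \<open>X0\<close> the last condition on the inclusion.\<close>

lemma left_span_Y:
  assumes T: "X0 \<subseteq> T" "T \<subseteq> carrier Y"
  shows "left_ip_span AU.C Y (carrier Y) T = carrier AU.C"
proof (rule antisym)
  show "left_ip_span AU.C Y (carrier Y) T \<subseteq> carrier AU.C"
    unfolding left_ip_span_def using T
    by (intro AU.C.span_subset) (auto simp: Y_sel AU.C_sel(1) intro!: li.conv_closed)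
  show "carrier AU.C \<subseteq> left_ip_span AU.C Y (carrier Y) T"
  proof
    fix f assume "f \<in> carrier AU.C"
    then have f: "f \<in> sections G \<A>" by (simp add: AU.C_sel)
    have "single t (f t) \<in> left_ip_span AU.C Y (carrier Y) T" if t: "t \<in> carrier G" for t
    proof -
      have "single t ` fset \<X> t \<subseteq> carrier Y"
        using t by (auto simp: Y_sel)
      then show ?thesis
        using single_in_left_ip_span[OF t A.one_closed, of "f t" "carrier Y" T] t T(1)
          AU.section_apply[OF f t] by simp
    qed
    then have "(\<Sum>t\<in>carrier G. single t (f t)) \<in> left_ip_span AU.C Y (carrier Y) T"
      unfolding left_ip_span_def by (rule AU.C.vs.span_sum)
    then show "f \<in> left_ip_span AU.C Y (carrier Y) T"
      using AU.section_decompose[OF f] by simp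
  qed
qed

lemma right_span_Y:
  assumes T: "X0 \<subseteq> T" "T \<subseteq> carrier Y"
  shows "right_ip_span BU.C Y (carrier Y) T = carrier BU.C"
proof (rule antisym)
  show "right_ip_span BU.C Y (carrier Y) T \<subseteq> carrier BU.C"
    unfolding right_ip_span_def using T
    by (intro BU.C.span_subset) (auto simp: Y_sel BU.C_sel(1) intro!: ri.conv_closed)
  show "carrier BU.C \<subseteq> right_ip_span BU.C Y (carrier Y) T"
  proof
    fix f assume "f \<in> carrier BU.C"
    then have f: "f \<in> sections G \<B>" by (simp add: BU.C_sel)
    have "single t (f t) \<in> right_ip_span BU.C Y (carrier Y) T" if t: "t \<in> carrier G" for t
    proof -
      \<comment> \<open>The right inner product inverts the first degree, so degree t comes from the
        pair of the inverse of t and e.\<close>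
      have "single (inv t) ` fset \<X> (inv t) \<subseteq> carrier Y"
        using t by (auto simp: Y_sel)
      then show ?thesis
        using single_in_right_ip_span[OF A.inv_closed[OF t] A.one_closed, of "f t" "carrier Y" T]
          t T(1) BU.section_apply[OF f t] by simp
    qed
    then have "(\<Sum>t\<in>carrier G. single t (f t)) \<in> right_ip_span BU.C Y (carrier Y) T"
      unfolding right_ip_span_def by (rule BU.C.vs.span_sum)
    then show "f \<in> right_ip_span BU.C Y (carrier Y) T"
      using BU.section_decompose[OF f] by simp
  qed
qed

sublocale pre: pre_bimodule AU.C "single \<one> u" BU.C "single \<one> v" Y X0
proof (intro pre_bimodule.intro pre_bimodule_axioms.intro AU.C.unital_cstar_algebra_axioms
    BU.C.unital_cstar_algebra_axioms complex_space_Y X0_subset X0_subspace)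
  have elact_scl: "elact \<X> t s (fscl \<A> c a) x = fscl \<X> c (elact \<X> t s a x)"
    "elact \<X> t s a (fscl \<X> c x) = fscl \<X> c (elact \<X> t s a x)"
    if "t \<in> carrier G" "s \<in> carrier G" "a \<in> fset \<A> t" "x \<in> fset \<X> s" for t s a x c
    using that elact_bilinear[of t s] by (auto simp: bilinear_map_def semilinear_map_def fibre_def)
  show "bilinear_map AU.C Y Y (lact Y)"
    by (simp add: bilinear_map_def semilinear_map_def Y_sel AU.C_sel(1,2) la.conv_add_left
        la.conv_add_right la.conv_scl_left[OF elact_scl(1)] la.conv_scl_right[OF elact_scl(2)]
        del: plus_fun_apply)
  have eract_scl: "eract \<X> t s x (fscl \<B> c b) = fscl \<X> c (eract \<X> t s x b)"
    "eract \<X> t s (fscl \<X> c x) b = fscl \<X> c (eract \<X> t s x b)"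
    if "t \<in> carrier G" "s \<in> carrier G" "x \<in> fset \<X> t" "b \<in> fset \<B> s" for t s b x c
    using that eract_bilinear[of t s] by (auto simp: bilinear_map_def semilinear_map_def fibre_def)
  show "bilinear_map Y BU.C Y (ract Y)"
    by (simp add: bilinear_map_def semilinear_map_def Y_sel BU.C_sel(1,2) ra.conv_add_left
        ra.conv_add_right ra.conv_scl_left[OF eract_scl(2)] ra.conv_scl_right[OF eract_scl(1)]
        del: plus_fun_apply)
  have elip_scl: "elip \<X> t s (fscl \<X> c x) y = fscl \<A> c (elip \<X> t s x y)"
    if "t \<in> carrier G" "s \<in> carrier G" "x \<in> fset \<X> t" "y \<in> fset \<X> s" for t s x y c
    using that elip_linear[of t s y] by (auto simp: semilinear_map_def fibre_def)
  show "linear_map Y AU.C (\<lambda>f. lip Y f g)" if "g \<in> carrier Y" for g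
    using that by (simp add: semilinear_map_def Y_sel AU.C_sel(1,2) li.conv_add_left
        li.conv_scl_left[OF elip_scl] del: plus_fun_apply)
  have erip_scl: "erip \<X> t s x (fscl \<X> c y) = fscl \<B> c (erip \<X> t s x y)"
    if "t \<in> carrier G" "s \<in> carrier G" "x \<in> fset \<X> t" "y \<in> fset \<X> s" for t s x y c
    using that erip_linear[of t s x] by (auto simp: semilinear_map_def fibre_def)
  show "linear_map Y BU.C (\<lambda>g. rip Y f g)" if "f \<in> carrier Y" for f
    using that by (simp add: semilinear_map_def Y_sel BU.C_sel(1,2) ri.conv_add_right
        ri.conv_scl_right[OF erip_scl] del: plus_fun_apply)
next
  fix a f g assume a: "a \<in> carrier AU.C" and f: "f \<in> carrier Y" and g: "g \<in> carrier Y"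
  note a = a[unfolded AU.C_sel(1)] and f = f[unfolded Y_sel(1)] and g = g[unfolded Y_sel(1)]
  \<comment> \<open>As in the identities below, both sides are additive in each argument, and the
    homogeneous case is a bundle axiom up to associativity in the group.\<close>
  show "lip Y (lact Y a f) g = mul AU.C a (lip Y f g)"
    unfolding Y_sel AU.C_sel(4) using a
  proof (induction rule: AU.section_induct)
    case (single r a)
    note a = this
    show ?case using f
    proof (induction rule: XS.section_induct)
      case (single t x)
      note x = this
      show ?case using g
      proof (induction rule: XS.section_induct)
        case (single s y)
        then show ?case
          using a x by (simp add: la.conv_single li.conv_single AU.prod.conv_single la.pair_closed
              elip_closed elip_elact A.m_assoc)
      qed (use a x in \<open>simp add: li.conv_add_right AU.prod.conv_add_right del: plus_fun_apply\<close>)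
    qed (use a g in \<open>simp add: la.conv_add_right li.conv_add_left AU.prod.conv_add_right
        del: plus_fun_apply\<close>)
  qed (use f g in \<open>simp add: la.conv_add_left li.conv_add_left AU.prod.conv_add_left
      del: plus_fun_apply\<close>)
next
  fix f g b assume f: "f \<in> carrier Y" and g: "g \<in> carrier Y" and b: "b \<in> carrier BU.C"
  note b = b[unfolded BU.C_sel(1)] and f = f[unfolded Y_sel(1)] and g = g[unfolded Y_sel(1)]
  show "rip Y f (ract Y g b) = mul BU.C (rip Y f g) b"
    unfolding Y_sel BU.C_sel(4) using b
  proof (induction rule: BU.section_induct)
    case (single r b)
    note b = this
    show ?case using f
    proof (induction rule: XS.section_induct)
      case (single t x)
      note x = this
      show ?case using g
      proof (induction rule: XS.section_induct)
        case (single s y)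
        then show ?case
          using b x by (simp add: ra.conv_single ri.conv_single BU.prod.conv_single ra.pair_closed
              erip_closed erip_eract A.m_assoc)
      qed (use b x in \<open>simp add: ra.conv_add_left ri.conv_add_right BU.prod.conv_add_left
          del: plus_fun_apply\<close>)
    qed (use b g in \<open>simp add: ri.conv_add_left BU.prod.conv_add_left del: plus_fun_apply\<close>)
  qed (use f g in \<open>simp add: ra.conv_add_right ri.conv_add_right BU.prod.conv_add_right
      del: plus_fun_apply\<close>)
next
  fix f g assume f: "f \<in> carrier Y" and g: "g \<in> carrier Y"
  note f = f[unfolded Y_sel(1)] and g = g[unfolded Y_sel(1)]
  show "star AU.C (lip Y f g) = lip Y g f"
    unfolding Y_sel section_algebra_def using f
  proof (induction rule: XS.section_induct)
    case (single t x)
    note x = this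
    show ?case using g
    proof (induction rule: XS.section_induct)
      case (single s y)
      then show ?case
        using x by (simp add: li.conv_single elip_closed AU.star_section_single elip_star
            A.inv_mult_group)
    qed (use x in \<open>simp add: li.conv_add_left li.conv_add_right AU.star_section_add
        del: plus_fun_apply\<close>)
  qed (use g in \<open>simp add: li.conv_add_left li.conv_add_right AU.star_section_add
      del: plus_fun_apply\<close>)
  show "star BU.C (rip Y f g) = rip Y g f"
    unfolding Y_sel section_algebra_def using f
  proof (induction rule: XS.section_induct)
    case (single t x)
    note x = this
    show ?case using g
    proof (induction rule: XS.section_induct)
      case (single s y)
      then show ?case
        using x by (simp add: ri.conv_single erip_closed BU.star_section_single erip_star
            A.inv_mult_group)
    qed (use x in \<open>simp add: ri.conv_add_left ri.conv_add_right BU.star_section_add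
        del: plus_fun_apply\<close>)
  qed (use g in \<open>simp add: ri.conv_add_left ri.conv_add_right BU.star_section_add
      del: plus_fun_apply\<close>)
next
  fix f assume f: "f \<in> carrier Y"
  note f = f[unfolded Y_sel(1)]
  have ext: "f = 0" if "\<And>t. t \<in> carrier G \<Longrightarrow> f t = 0"
    using that XS.section_off[OF f] by (metis ext zero_fun_apply)
  show "f = 0" if eq: "lip Y f f = 0"
  proof (rule ext)
    fix t assume t: "t \<in> carrier G"
    have pos: "AU.A.pos (elip \<X> s s (f s) (f s))" if "s \<in> carrier G" for s
      using that by (intro elip_pos XS.section_apply[OF f])
    \<comment> \<open>Take the coordinate at e: positive terms with sum 0 all vanish, and each fibre
      is definite.\<close>
    have "(\<Sum>t\<in>carrier G. elip \<X> t t (f t) (f t)) = 0"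
      using eq by (simp flip: lip_Y_one)
    from elip_definite[OF t XS.section_apply[OF f t]
        AU.A.pos_sum_eq_0[OF AU.finite_carrier pos this t]]
    show "f t = 0" .
  qed
  show "f = 0" if eq: "rip Y f f = 0"
  proof (rule ext)
    fix t assume t: "t \<in> carrier G"
    have pos: "BU.A.pos (erip \<X> s s (f s) (f s))" if "s \<in> carrier G" for s
      using that by (intro erip_pos XS.section_apply[OF f])
    have "(\<Sum>t\<in>carrier G. erip \<X> t t (f t) (f t)) = 0"
      using eq by (simp flip: rip_Y_one)
    from erip_definite[OF t XS.section_apply[OF f t]
        BU.A.pos_sum_eq_0[OF AU.finite_carrier pos this t]]
    show "f t = 0" .
  qed
next
  fix f g h assume f: "f \<in> carrier Y" and g: "g \<in> carrier Y" and h: "h \<in> carrier Y"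
  note f = f[unfolded Y_sel(1)] and g = g[unfolded Y_sel(1)] and h = h[unfolded Y_sel(1)]
  show "lact Y (lip Y f g) h = ract Y f (rip Y g h)"
    unfolding Y_sel using f
  proof (induction rule: XS.section_induct)
    case (single t x)
    note x = this
    show ?case using g
    proof (induction rule: XS.section_induct)
      case (single s y)
      note y = this
      show ?case using h
      proof (induction rule: XS.section_induct)
        case (single r z)
        then show ?case
          using x y by (simp add: la.conv_single li.conv_single ra.conv_single ri.conv_single
              elip_closed erip_closed elip_elact_erip A.m_assoc)
      qed (use x y in \<open>simp add: la.conv_add_right ri.conv_add_right ra.conv_add_right
          del: plus_fun_apply\<close>)
    qed (use x h in \<open>simp add: li.conv_add_right la.conv_add_left ri.conv_add_left
        ra.conv_add_right del: plus_fun_apply\<close>)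
  qed (use g h in \<open>simp add: li.conv_add_left la.conv_add_left ra.conv_add_left
      del: plus_fun_apply\<close>)
next
  fix f assume f: "f \<in> X0"
  show "AU.C.pos (lip Y f f)"
    using lip_Y_X0_positive[OF f] AU.unit_fibre_sections_subset
    by (auto simp: positive_in_def AU.C.pos_star_mul)
  show "BU.C.pos (rip Y f f)"
    using rip_Y_X0_positive[OF f] BU.unit_fibre_sections_subset
    by (auto simp: positive_in_def BU.C.pos_star_mul)
next
  show "single \<one> u \<in> left_ip_span AU.C Y X0 X0"
    by (simp add: left_span_X0 AU.unit_fibre_sections_eq)
  show "single \<one> v \<in> right_ip_span BU.C Y X0 X0"
    by (simp add: right_span_X0 BU.unit_fibre_sections_eq)
qed

section \<open>Completeness of \<open>Y\<close> and closedness of \<open>X0\<close>\<close>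

lemma left_norm_single:
  assumes "t \<in> carrier G" "x \<in> fset \<X> t"
  shows "left_norm AU.C Y (single t x) = fnrm \<X> t x"
  using assms elip_closed[of t t x x]
  by (simp add: left_norm_def Y_sel li.conv_single AU.norm_C_single norm_elip)

text \<open>The square of the coordinate norm is the norm of one diagonal term; that term is
  dominated by the value of \<open>lip Y f f\<close> at the unit, whose norm is at most the norm in
  \<open>C\<close> since \<open>lip Y f f\<close> is positive there.\<close>

lemma fnrm_le_left_norm:
  assumes f: "f \<in> sections G \<X>" and t: "t \<in> carrier G"
  shows "fnrm \<X> t (f t) \<le> left_norm AU.C Y f"
proof -
  let ?p = "\<lambda>t. elip \<X> t t (f t) (f t)"
  have "(\<Sum>t\<in>carrier G. ?p t) - ?p t = (\<Sum>t\<in>carrier G - {t}. ?p t)"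
    using AU.finite_carrier t by (simp add: sum.remove[of _ t])
  moreover have "AU.A.pos \<dots>"
    using XS.section_apply[OF f] by (intro AU.A.pos_sum elip_pos) auto
  ultimately have "fnrm \<A> \<one> (?p t) \<le> fnrm \<A> \<one> (lip Y f f \<one>)"
    using t XS.section_apply[OF f] AU.A.norm_mono[of "?p t" "\<Sum>t\<in>carrier G. ?p t"] elip_pos
    by (simp add: lip_Y_one)
  also have "\<dots> \<le> nrm AU.C (lip Y f f)"
    using f by (intro AU.norm_pos_at_one_le pre.lip_pos) (simp add: Y_sel)
  finally show ?thesis
    using XS.section_apply[OF f t] t by (simp add: left_norm_def norm_elip)
qed

lemma complete_Y: "complete_wrt (carrier Y) (left_norm AU.C Y)"
proof -
  have "complex_normed \<lparr>carrier = carrier Y, scl = scl Y, nrm = left_norm AU.C Y\<rparr>"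
    by (rule pre.complex_normed_left_norm) (simp_all add: pre.Y.subspace)
  from XS.sections_complete[OF this] show ?thesis
    by (simp add: Y_sel(1) fnrm_le_left_norm left_norm_single)
qed

lemma complete_X0: "complete_wrt X0 (left_norm AU.C Y)"
proof -
  have "complex_normed \<lparr>carrier = X0, scl = scl Y, nrm = left_norm AU.C Y\<rparr>"
    by (rule pre.complex_normed_left_norm[OF X0_subset X0_subspace])
  from XS.complete_single_image[OF this] show ?thesis
    by (simp add: left_norm_single)
qed

text \<open>A section f outside \<open>X0\<close> has a nonzero coordinate at some t other than e.
  Elements of \<open>X0\<close> vanish at t, so the norm of that coordinate bounds the distance from
  f to all of them from below.\<close>

lemma closed_X0: "closed_wrt (carrier Y) (left_norm AU.C Y) X0"
proof -
  interpret N: complex_normed "\<lparr>carrier = carrier Y, scl = scl Y, nrm = left_norm AU.C Y\<rparr>"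
    by (rule pre.complex_normed_left_norm) (simp_all add: pre.Y.subspace)
  have "\<exists>r>0. \<forall>g\<in>X0. r \<le> left_norm AU.C Y (f - g)" if f: "f \<in> carrier Y" "f \<notin> X0" for f
  proof -
    have f': "f \<in> sections G \<X>"
      using f by (simp add: Y_sel)
    have "\<exists>t\<in>carrier G. t \<noteq> \<one> \<and> f t \<noteq> 0"
    proof (rule ccontr)
      assume "\<not> ?thesis"
      then have "f = single \<one> (f \<one>)"
        using XS.section_off[OF f'] by (auto simp: single_def fun_eq_iff)
      then show False
        using f(2) XS.section_apply[OF f' A.one_closed] by blast
    qed
    then obtain t where t: "t \<in> carrier G" "t \<noteq> \<one>" "f t \<noteq> 0"
      by blast
    interpret B: complex_banach "fibre \<X> t" by (rule X_banach[OF t(1)])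
    have "0 < fnrm \<X> t (f t)"
      using B.norm_nonneg[of "f t"] B.norm_eq_0[of "f t"] XS.section_apply[OF f' t(1)] t(3)
      by (simp add: fibre_def)
    moreover have "fnrm \<X> t (f t) \<le> left_norm AU.C Y (f - g)" if g: "g \<in> X0" for g
    proof -
      have "f - g \<in> sections G \<X>"
        using N.diff_closed[of f g] f g X0_subset by (auto simp: Y_sel)
      from fnrm_le_left_norm[OF this t(1)] show ?thesis
        using g t(2) by (auto simp: single_apply)
    qed
    ultimately show ?thesis by blast
  qed
  then show ?thesis
    using N.closed_wrtI[of X0] X0_subset by simp
qed

lemma lact_X0: "a \<in> unit_fibre_sections G \<A> \<Longrightarrow> f \<in> X0 \<Longrightarrow> lact Y a f \<in> X0"
  using la.pair_closed[of \<one> \<one>] by (auto simp: Y_sel la.conv_single AU.unit_fibre_sections_eq)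

lemma ract_X0: "f \<in> X0 \<Longrightarrow> b \<in> unit_fibre_sections G \<B> \<Longrightarrow> ract Y f b \<in> X0"
  using ra.pair_closed[of \<one> \<one>] by (auto simp: Y_sel ra.conv_single BU.unit_fibre_sections_eq)

theorem strongly_Morita_equivalent_sections:
  "strongly_Morita_equivalent TYPE('g \<Rightarrow> 'x)
    (unit_fibre_sections G \<A>) AU.C (unit_fibre_sections G \<B>) BU.C"
  unfolding strongly_Morita_equivalent_def
proof (intro conjI exI[of _ Y] exI[of _ X0] ballI)
  show "equivalence_bimodule AU.C BU.C Y"
    by (intro pre.equivalence_bimodule complete_Y left_span_Y right_span_Y X0_subset subset_refl)
  show "equivalence_bimodule (AU.C\<lparr>carrier := unit_fibre_sections G \<A>\<rparr>)
      (BU.C\<lparr>carrier := unit_fibre_sections G \<B>\<rparr>) (Y\<lparr>carrier := X0\<rparr>)"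
    by (intro pre.equivalence_bimodule_restrict AU.cstar_algebra_unit_fibre_sections
        BU.cstar_algebra_unit_fibre_sections AU.unit_fibre_sections_subset
        BU.unit_fibre_sections_subset lact_X0 ract_X0 lip_Y_X0 rip_Y_X0 lip_Y_X0_positive
        rip_Y_X0_positive left_span_X0 right_span_X0 complete_X0)
      (simp_all add: AU.unit_fibre_sections_eq BU.unit_fibre_sections_eq)
  show "left_ip_span AU.C Y (carrier Y) X0 = carrier AU.C"
    by (intro left_span_Y X0_subset subset_refl)
  show "right_ip_span BU.C Y (carrier Y) X0 = carrier BU.C"
    by (intro right_span_Y X0_subset subset_refl)
qed (fact AU.unital_inclusion_unit_fibre BU.unital_inclusion_unit_fibre X0_subset X0_subspace
    closed_X0 | (erule lact_X0 ract_X0 lip_Y_X0 rip_Y_X0, assumption))+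

end

theorem proposition2p1:
  fixes G :: "('g, 'k) monoid_scheme" (structure)
    and \<A> :: "('g, 'a::ab_group_add) fell_bundle"
    and \<B> :: "('g, 'b::ab_group_add) fell_bundle"
    and \<X> :: "('g, 'a, 'b, 'x::ab_group_add) equiv_bundle"
  assumes "group G" and "finite (carrier G)"
    and "cstar_bundle G \<A>" and "cstar_bundle G \<B>"
    and "\<exists>u\<in>unit_fibre_sections G \<A>. is_unit_of (section_algebra G \<A>) u"
    and "\<exists>u\<in>unit_fibre_sections G \<B>. is_unit_of (section_algebra G \<B>) u"
    and "equivalence_bundle G \<A> \<B> \<X>"
    and "\<And>t s. t \<in> carrier G \<Longrightarrow> s \<in> carrier G \<Longrightarrow>
      module.span (fscl \<A>) {elip \<X> t s x y | x y. x \<in> fset \<X> t \<and> y \<in> fset \<X> s}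
        = fset \<A> (t \<otimes> inv s)"
    and "\<And>t s. t \<in> carrier G \<Longrightarrow> s \<in> carrier G \<Longrightarrow>
      module.span (fscl \<B>) {erip \<X> t s x y | x y. x \<in> fset \<X> t \<and> y \<in> fset \<X> s}
        = fset \<B> (inv t \<otimes> s)"
  shows "strongly_Morita_equivalent TYPE('g \<Rightarrow> 'x)
    (unit_fibre_sections G \<A>) (section_algebra G \<A>)
    (unit_fibre_sections G \<B>) (section_algebra G \<B>)"
proof -
  have fin: "finite_cstar_bundle G \<A>" "finite_cstar_bundle G \<B>"
    using assms(2-4) by (simp_all add: finite_cstar_bundle_def finite_cstar_bundle_axioms_def)
  obtain u where "unital_cstar_bundle G \<A> u"
    using finite_cstar_bundle.unital_cstar_bundle_if_unit[OF fin(1) assms(5)] .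
  moreover obtain v where "unital_cstar_bundle G \<B> v"
    using finite_cstar_bundle.unital_cstar_bundle_if_unit[OF fin(2) assms(6)] .
  ultimately have "full_equivalence_bundle G \<A> \<B> \<X> u v"
    using assms(7-9) by (intro full_equivalence_bundle.intro full_equivalence_bundle_axioms.intro)
  then show ?thesis
    by (rule full_equivalence_bundle.strongly_Morita_equivalent_sections)
qed

end
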